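(* Let $\mathfrak g$ be of type $A_N$ or $B_N$ and let $(i_t,k_t)\in\mathcal Y$, $1\le t\le T$, be a snake. Then $$\chi_q\Big(L\Big(\prod_{t=1}^TY_{i_t,k_t}\Big)\Big)=\sum_{\mathcal T\in\mathrm{Tab}(\lambda/\mu)}M(\mathcal T),$$ where $(\lambda/\mu)=(\lambda/\mu)_{(i_t,k_t)_{1\le t\le T}}$ is the skew diagram corresponding to the snake.
   Context: **Quantum affine algebras.** $\mathfrak g$ is of type $A_N$ or $B_N$ ($N\ge2$ in type $B$, node $N$ being the short root), $I=\{1,\dots,N\}$, $C$ the Cartan matrix; $r^\vee=1$ in type A and $r^\vee=2$ in type B; $r_i=1$ for all $i$ in type A; in type B, $r_i=2$ for $i<N$ and $r_N=1$; $B_{ij}=r_iC_{ij}$. Fix $q\in\mathbb C^*$ not a root of unity; $[n]_q=\frac{q^n-q^{-n}}{q-q^{-1}}$. $U_q(\widehat{\mathfrak g})$ is the untwisted quantum affine algebra in Drinfeld's new realization, with generators $x^\pm_{i,n}$, $k_i^{\pm1}$, $h_{i,n}$ ($n\neq0$), central $c^{\pm1/2}$, normalized so that $k_ix^\pm_{j,n}k_i^{-1}=q^{\pm B_{ij}}x^\pm_{j,n}$, $[h_{i,n},x^\pm_{j,m}]=\pm\frac1n[nB_{ij}]_qc^{\mp|n|/2}x^\pm_{j,n+m}$, and with $\phi_i^\pm(u)=\sum_{n\ge0}\phi^\pm_{i,\pm n}u^{\pm n}=k_i^{\pm1}\exp(\pm(q-q^{-1})\sum_{m\ge1}h_{i,\pm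 m}u^{\pm m})$. Modules are finite-dimensional of type 1 ($c^{\pm1/2}$ acts as the identity, and the $k_i$ act diagonalizably by powers of $q$ given by integral weights). Monomials $m=\prod Y_{i,b}^{w_{i,b}-x_{i,b}}$ ($w_{i,b},x_{i,b}\ge0$) in formal variables $(Y_{i,b})_{i\in I,b\in\mathbb C^*}$ are identified with $l$-weights: $\gamma(m)_i^\pm(u)=q^{r_i(\deg Q_i-\deg R_i)}\frac{Q_i(uq^{-r_i})R_i(uq^{r_i})}{Q_i(uq^{r_i})R_i(uq^{-r_i})}$ (expanded in powers of $u^{\pm1}$), with $Q_i(u)=\prod_b(1-ub)^{w_{i,b}}$, $R_i(u)=\prod_b(1-ub)^{x_{i,b}}$. $V_m$ is the corresponding generalized simultaneous eigenspace of the $\phi^\pm_{i,\pm r}$ in $V$, and $\chi_q(V)=\sum_m\dim(V_m)m$. For a monomial $m$ with all exponents $\ge0$, $L(m)$ is the unique finite-dimensional irreducible module with highest $l$-weight $\boldsymbol\gamma(m)$. Fix $a\in\mathbb C^*$ and write $Y_{i,k}:=Y_{i,aq^k}$ for $(i,k)\in I\times\mathbb Z$. **Snakes.** Type A: $\mathcal Y=\{(i,k)\in I\times\mathbb Z:i-k\equiv1\bmod2\}$. Type B: $\mathcal Y=\{(i,k)\in I\times\mathbb Z:i<N,\ 2i-k\equiv2\bmod4\}$. For points of $\mathcal Y$: $(i',k')$ is in snake position with respect to $(i,k)$ iff, in type A, $k'-k\ge|i'-i|+2$, and in type B, $k'-k\ge2|i'-i|+4$ and $k'-k\equiv2|i'-i|\bmod4$.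 A sequence $(i_t,k_t)_{1\le t\le T}$, $T\ge1$, is a snake iff $(i_t,k_t)$ is in snake position with respect to $(i_{t-1},k_{t-1})$ for all $2\le t\le T$. The corresponding skew diagram is $$(\lambda/\mu)_{(i_t,k_t)_{1\le t\le T}}=\Big\{(s,t)\in\mathbb Z\times\mathbb Z_{\ge0}:1\le t\le T,\ t-\tfrac{k_t}{2r^\vee}-\tfrac{i_t-1}2\le s\le t-\tfrac{k_t}{2r^\vee}+\tfrac{i_t-1}2\Big\},$$ where $(s,t)$ is the box in row $s$, column $t$. **Tableaux.** The alphabet is the totally ordered set: type A: $1<2<\dots<N<N+1$; type B: $1<2<\dots<N<0<\bar N<\dots<\bar2<\bar1$. A skew tableau of shape $(\lambda/\mu)$ is a map $\mathcal T$ from $(\lambda/\mu)$ to the alphabet such that, whenever the boxes involved belong to $(\lambda/\mu)$: type A: (H) $\mathcal T(i,j)\le\mathcal T(i,j+1)$ and (V) $\mathcal T(i,j)<\mathcal T(i+1,j)$; type B: (H) $\mathcal T(i,j)\le\mathcal T(i,j+1)$ and $(\mathcal T(i,j),\mathcal T(i,j+1))\ne(0,0)$, and (V) $\mathcal T(i,j)<\mathcal T(i+1,j)$ or $(\mathcal T(i,j),\mathcal T(i+1,j))=(0,0)$. $\mathrm{Tab}(\lambda/\mu)$ is the set of skew tableaux of that shape. To $\mathcal T$ is associated the monomial $$M(\mathcal T)=\prod_{(i,j)\in(\lambda/\mu)}\boxed{\mathcal T(i,j)}_{\,2r^\vee(j-i)}$$ where, with $Y_{0,k}:=1$ and $Y_{N+1,k}:=1$: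 Type A: $\boxed i_k=Y_{i-1,i+k}^{-1}Y_{i,i-1+k}$ for $1\le i\le N+1$. Type B: $\boxed i_k=Y_{i-1,2i+k}^{-1}Y_{i,2i-2+k}$ for $1\le i\le N-1$; $\boxed N_k=Y_{N-1,2N+k}^{-1}Y_{N,2N-3+k}Y_{N,2N-1+k}$; $\boxed0_k=Y_{N,2N+1+k}^{-1}Y_{N,2N-3+k}$; $\boxed{\bar N}_k=Y_{N,2N-1+k}^{-1}Y_{N,2N+1+k}^{-1}Y_{N-1,2N-2+k}$; $\boxed{\bar i}_k=Y_{i,4N-2i+k}^{-1}Y_{i-1,4N-2-2i+k}$ for $1\le i\le N-1$. *)

theory Defs
  imports
    Complex_Main
    "HOL-Library.Poly_Mapping"
    "HOL-Library.FuncSet"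
    "HOL-Combinatorics.Permutations"
    "HOL-Computational_Algebra.Formal_Power_Series"
    "HOL-Computational_Algebra.Polynomial_FPS"
    "HOL-Number_Theory.Cong"
begin

section \<open>Lie types\<close>

datatype lie_type = TypeA nat | TypeB nat

fun lie_rank :: "lie_type \<Rightarrow> nat" where
  "lie_rank (TypeA N) = N"
| "lie_rank (TypeB N) = N"

fun valid_lie_type :: "lie_type \<Rightarrow> bool" where
  "valid_lie_type (TypeA N) \<longleftrightarrow> N \<ge> 1"
| "valid_lie_type (TypeB N) \<longleftrightarrow> N \<ge> 2"

definition nodes :: "lie_type \<Rightarrow> nat set" where
  "nodes g = {1..lie_rank g}"

text \<open>In type B the short simple root is the last one, so the only entry equal to \<open>-2\<close>
  is \<open>C\<^sub>N\<^sub>,\<^sub>N\<^sub>-\<^sub>1\<close>.\<close>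

fun cartan :: "lie_type \<Rightarrow> nat \<Rightarrow> nat \<Rightarrow> int" where
  "cartan (TypeA N) i j =
     (if i = j then 2 else if i = Suc j \<or> j = Suc i then -1 else 0)"
| "cartan (TypeB N) i j =
     (if i = j then 2
      else if i = N \<and> i = Suc j then -2
      else if i = Suc j \<or> j = Suc i then -1 else 0)"

fun dual_lacing :: "lie_type \<Rightarrow> int" where
  "dual_lacing (TypeA N) = 1"
| "dual_lacing (TypeB N) = 2"

fun symm :: "lie_type \<Rightarrow> nat \<Rightarrow> int" where
  "symm (TypeA N) i = 1"
| "symm (TypeB N) i = (if i < N then 2 else 1)"

definition symm_cartan :: "lie_type \<Rightarrow> nat \<Rightarrow> nat \<Rightarrow> int" where
  "symm_cartan g i j = symm g i * cartan g i j"


section \<open>Quantum integers\<close>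

definition qint :: "complex \<Rightarrow> int \<Rightarrow> complex" where
  "qint q n = (q powi n - q powi (- n)) / (q - inverse q)"

definition qfact :: "complex \<Rightarrow> nat \<Rightarrow> complex" where
  "qfact q n = (\<Prod>l = 1..n. qint q (int l))"

definition qbinom :: "complex \<Rightarrow> nat \<Rightarrow> nat \<Rightarrow> complex" where
  "qbinom q n l = qfact q n / (qfact q l * qfact q (n - l))"

definition not_root_of_unity :: "complex \<Rightarrow> bool" where
  "not_root_of_unity q \<longleftrightarrow> (\<forall>n::nat. n > 0 \<longrightarrow> q ^ n \<noteq> 1)"


section \<open>Free associative algebras\<close>

datatype 'g free_word = Word "'g list"

instantiation free_word :: (type) monoid_add
begin

definition zero_free_word :: "'a free_word" where
  "0 = Word []"

fun plus_free_word :: "'a free_word \<Rightarrow> 'a free_word \<Rightarrow> 'a free_word" where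
  "Word xs + Word ys = Word (xs @ ys)"

instance
proof
  fix a b c :: "'a free_word"
  show "a + b + c = a + (b + c)"
    by (cases a; cases b; cases c) simp
  show "0 + a = a"
    by (cases a) (simp add: zero_free_word_def)
  show "a + 0 = a"
    by (cases a) (simp add: zero_free_word_def)
qed

end

text \<open>Finitely supported functions on words with the convolution product, i.e. noncommutative
  polynomials; the \<open>ring_1\<close> structure is the library's, with concatenation of words as
  the monoid operation.\<close>

type_synonym 'g free_alg = "'g free_word \<Rightarrow>\<^sub>0 complex"

definition free_gen :: "'g \<Rightarrow> 'g free_alg" where
  "free_gen x = Poly_Mapping.single (Word [x]) 1"

definition free_const :: "complex \<Rightarrow> 'g free_alg" where
  "free_const c = Poly_Mapping.single 0 c"

text \<open>Exponential of a series without constant term, whose coefficients need not commute.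
  Powers beyond the \<open>n\<close>-th do not contribute to the \<open>n\<close>-th coefficient.\<close>

definition nc_exp :: "'g free_alg fps \<Rightarrow> 'g free_alg fps" where
  "nc_exp S = Abs_fps (\<lambda>n. \<Sum>p\<le>n. free_const (1 / fact p) * fps_nth (S ^ p) n)"


section \<open>The quantum affine algebra in Drinfeld's new realization\<close>

datatype sign = Plus | Minus

fun sgn_int :: "sign \<Rightarrow> int" where
  "sgn_int Plus = 1"
| "sgn_int Minus = -1"

datatype gen =
    GX sign nat int
  | GK nat
  | GKinv nat
  | GH nat int
  | GC
  | GCinv

type_synonym dalg = "gen free_alg"

definition gx :: "sign \<Rightarrow> nat \<Rightarrow> int \<Rightarrow> dalg" where
  "gx e i n = free_gen (GX e i n)"

definition gh :: "nat \<Rightarrow> int \<Rightarrow> dalg" where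
  "gh i n = free_gen (GH i n)"

fun gk :: "sign \<Rightarrow> nat \<Rightarrow> dalg" where
  "gk Plus i = free_gen (GK i)"
| "gk Minus i = free_gen (GKinv i)"

text \<open>\<open>c_half n\<close> stands for \<open>c\<close> to the power \<open>n / 2\<close>.\<close>

definition c_half :: "int \<Rightarrow> dalg" where
  "c_half n = (if n \<ge> 0 then free_gen GC ^ nat n else free_gen GCinv ^ nat (- n))"

text \<open>For \<open>r \<ge> 0\<close>, \<open>phi q e i r\<close> is the coefficient of \<open>u\<close> to the power \<open>\<plusminus>r\<close> in
  \<open>\<phi>\<^sub>i\<^sup>\<plusminus>(u)\<close>, where \<open>e\<close> is the sign.\<close>

definition h_series :: "complex \<Rightarrow> sign \<Rightarrow> nat \<Rightarrow> dalg fps" where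
  "h_series q e i = Abs_fps (\<lambda>m. if m = 0 then 0
     else free_const (of_int (sgn_int e) * (q - inverse q)) * gh i (sgn_int e * int m))"

definition phi :: "complex \<Rightarrow> sign \<Rightarrow> nat \<Rightarrow> nat \<Rightarrow> dalg" where
  "phi q e i r = gk e i * fps_nth (nc_exp (h_series q e i)) r"

definition phi_int :: "complex \<Rightarrow> sign \<Rightarrow> nat \<Rightarrow> int \<Rightarrow> dalg" where
  "phi_int q e i n = (if sgn_int e * n \<ge> 0 then phi q e i (nat (sgn_int e * n)) else 0)"

text \<open>The defining relations \<open>lhs = rhs\<close>.  The datatype of generators is not restricted to
  nodes of the Dynkin diagram and to \<open>n \<noteq> 0\<close> in \<open>h\<^sub>i\<^sub>,\<^sub>n\<close>; the first group of rules removes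
  the superfluous generators from the quotient by setting them to zero.\<close>

inductive drinfeld_rel :: "lie_type \<Rightarrow> complex \<Rightarrow> dalg \<Rightarrow> dalg \<Rightarrow> bool"
  for g :: lie_type and q :: complex where
  no_x: "i \<notin> nodes g \<Longrightarrow> drinfeld_rel g q (gx e i n) 0"
| no_k: "i \<notin> nodes g \<Longrightarrow> drinfeld_rel g q (gk e i) 0"
| no_h: "i \<notin> nodes g \<or> n = 0 \<Longrightarrow> drinfeld_rel g q (gh i n) 0"
| c_inv: "drinfeld_rel g q (free_gen GC * free_gen GCinv) 1"
| c_inv': "drinfeld_rel g q (free_gen GCinv * free_gen GC) 1"
| c_central: "drinfeld_rel g q (free_gen GC * free_gen y) (free_gen y * free_gen GC)"
| c_inv_central: "drinfeld_rel g q (free_gen GCinv * free_gen y) (free_gen y * free_gen GCinv)"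
| k_inv: "i \<in> nodes g \<Longrightarrow> drinfeld_rel g q (gk Plus i * gk Minus i) 1"
| k_inv': "i \<in> nodes g \<Longrightarrow> drinfeld_rel g q (gk Minus i * gk Plus i) 1"
| k_k: "i \<in> nodes g \<Longrightarrow> j \<in> nodes g \<Longrightarrow>
    drinfeld_rel g q (gk Plus i * gk Plus j) (gk Plus j * gk Plus i)"
| k_h: "i \<in> nodes g \<Longrightarrow> j \<in> nodes g \<Longrightarrow> n \<noteq> 0 \<Longrightarrow>
    drinfeld_rel g q (gk Plus i * gh j n) (gh j n * gk Plus i)"
| k_x: "i \<in> nodes g \<Longrightarrow> j \<in> nodes g \<Longrightarrow>
    drinfeld_rel g q (gk Plus i * gx e j n * gk Minus i)
      (free_const (q powi (sgn_int e * symm_cartan g i j)) * gx e j n)"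
| h_h: "i \<in> nodes g \<Longrightarrow> j \<in> nodes g \<Longrightarrow> n \<noteq> 0 \<Longrightarrow> m \<noteq> 0 \<Longrightarrow>
    drinfeld_rel g q (gh i n * gh j m - gh j m * gh i n)
      (if n = - m
       then free_const (qint q (n * symm_cartan g i j) / of_int n / (q - inverse q))
              * (c_half (2 * n) - c_half (- 2 * n))
       else 0)"
| h_x: "i \<in> nodes g \<Longrightarrow> j \<in> nodes g \<Longrightarrow> n \<noteq> 0 \<Longrightarrow>
    drinfeld_rel g q (gh i n * gx e j m - gx e j m * gh i n)
      (free_const (of_int (sgn_int e) * qint q (n * symm_cartan g i j) / of_int n)
         * c_half (- sgn_int e * \<bar>n\<bar>) * gx e j (n + m))"
| x_x: "i \<in> nodes g \<Longrightarrow> j \<in> nodes g \<Longrightarrow>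
    drinfeld_rel g q
      (gx e i (n + 1) * gx e j m
         - free_const (q powi (sgn_int e * symm_cartan g i j)) * gx e j m * gx e i (n + 1))
      (free_const (q powi (sgn_int e * symm_cartan g i j)) * gx e i n * gx e j (m + 1)
         - gx e j (m + 1) * gx e i n)"
| xp_xm: "i \<in> nodes g \<Longrightarrow> j \<in> nodes g \<Longrightarrow>
    drinfeld_rel g q (gx Plus i n * gx Minus j m - gx Minus j m * gx Plus i n)
      (if i = j
       then free_const (1 / (q powi symm g i - q powi (- symm g i)))
              * (c_half (n - m) * phi_int q Plus i (n + m)
                 - c_half (m - n) * phi_int q Minus i (n + m))
       else 0)"
| serre: "i \<in> nodes g \<Longrightarrow> j \<in> nodes g \<Longrightarrow> i \<noteq> j \<Longrightarrow> s = nat (1 - cartan g i j) \<Longrightarrow>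
    drinfeld_rel g q
      (\<Sum>\<pi> | \<pi> permutes {1..s}. \<Sum>p = 0..s.
         free_const ((-1) ^ p * qbinom (q powi symm g i) s p)
           * prod_list (map (\<lambda>l. gx e i (ns (\<pi> l))) [1..<p + 1])
           * gx e j m
           * prod_list (map (\<lambda>l. gx e i (ns (\<pi> l))) [p + 1..<s + 1]))
      0"


section \<open>Monomials and l-weights\<close>

text \<open>A Laurent monomial in the \<open>Y\<^sub>i\<^sub>,\<^sub>b\<close> is its finitely supported exponent function, so products
  of monomials are sums of exponent functions.  Laurent polynomials are elements of the group
  ring of monomials.\<close>

type_synonym monomial = "(nat \<times> complex) \<Rightarrow>\<^sub>0 int"
type_synonym laurent = "monomial \<Rightarrow>\<^sub>0 int"

definition monomials :: "lie_type \<Rightarrow> monomial set" where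
  "monomials g = {m. Poly_Mapping.keys m \<subseteq> nodes g \<times> (- {0})}"

text \<open>The exponent is split as \<open>w - x\<close> with \<open>w\<close>, \<open>x\<close> its positive and negative parts; any other
  splitting yields the same l-weight.\<close>

definition Q_poly :: "monomial \<Rightarrow> nat \<Rightarrow> complex poly" where
  "Q_poly m i = (\<Prod>b | Poly_Mapping.lookup m (i, b) > 0.
     [:1, - b:] ^ nat (Poly_Mapping.lookup m (i, b)))"

definition R_poly :: "monomial \<Rightarrow> nat \<Rightarrow> complex poly" where
  "R_poly m i = (\<Prod>b | Poly_Mapping.lookup m (i, b) < 0.
     [:1, - b:] ^ nat (- Poly_Mapping.lookup m (i, b)))"

definition lw_num :: "lie_type \<Rightarrow> complex \<Rightarrow> monomial \<Rightarrow> nat \<Rightarrow> complex poly" where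
  "lw_num g q m i =
     pcompose (Q_poly m i) [:0, q powi (- symm g i):] * pcompose (R_poly m i) [:0, q powi symm g i:]"

definition lw_den :: "lie_type \<Rightarrow> complex \<Rightarrow> monomial \<Rightarrow> nat \<Rightarrow> complex poly" where
  "lw_den g q m i =
     pcompose (Q_poly m i) [:0, q powi symm g i:] * pcompose (R_poly m i) [:0, q powi (- symm g i):]"

definition lw_const :: "lie_type \<Rightarrow> complex \<Rightarrow> monomial \<Rightarrow> nat \<Rightarrow> complex" where
  "lw_const g q m i =
     q powi (symm g i * (int (degree (Q_poly m i)) - int (degree (R_poly m i))))"

text \<open>\<open>l_weight g q m e i\<close> is the series \<open>\<gamma>(m)\<^sub>i\<^sup>\<plusminus>\<close> in the variable \<open>u\<close> for \<open>Plus\<close> and in the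
  variable \<open>1/u\<close> for \<open>Minus\<close>.  In the latter case a polynomial \<open>p\<close> is \<open>u\<close> to the power
  \<open>degree p\<close> times \<open>reflect_poly p\<close> evaluated at \<open>1/u\<close>, and the powers of \<open>u\<close> cancel because
  numerator and denominator have the same degree.\<close>

fun l_weight :: "lie_type \<Rightarrow> complex \<Rightarrow> monomial \<Rightarrow> sign \<Rightarrow> nat \<Rightarrow> complex fps" where
  "l_weight g q m Plus i =
     fps_const (lw_const g q m i)
       * (fps_of_poly (lw_num g q m i) / fps_of_poly (lw_den g q m i))"
| "l_weight g q m Minus i =
     fps_const (lw_const g q m i)
       * (fps_of_poly (reflect_poly (lw_num g q m i)) / fps_of_poly (reflect_poly (lw_den g q m i)))"


section \<open>Modules and q-characters\<close>

text \<open>A module over the quantum affine algebra: a unital action of the free algebra on a complex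
  vector space that respects the defining relations, i.e. factors through the quotient by the
  two-sided ideal they generate.\<close>

locale quantum_affine_module = vector_space scale
  for scale :: "complex \<Rightarrow> 'v::ab_group_add \<Rightarrow> 'v" +
  fixes g :: lie_type and q :: complex and act :: "dalg \<Rightarrow> 'v \<Rightarrow> 'v"
  assumes act_add_right: "act y (v + w) = act y v + act y w"
    and act_add_left: "act (y + z) v = act y v + act z v"
    and act_mult: "act (y * z) v = act y (act z v)"
    and act_const: "act (free_const c) v = scale c v"
    and act_rel: "drinfeld_rel g q y z \<Longrightarrow> act y v = act z v"
begin

definition finite_dim :: bool where
  "finite_dim \<longleftrightarrow> (\<exists>B. finite B \<and> span B = UNIV)"

text \<open>A weight \<open>\<lambda>\<close> is given by its coordinates with respect to the fundamental weights; the
  pairing of \<open>\<lambda>\<close> with the simple root \<open>\<alpha>\<^sub>i\<close> is \<open>r\<^sub>i \<lambda>\<^sub>i\<close>.\<close>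

definition weight_space :: "(nat \<Rightarrow> int) \<Rightarrow> 'v set" where
  "weight_space wt = {v. \<forall>i\<in>nodes g. act (gk Plus i) v = scale (q powi (symm g i * wt i)) v}"

definition type_one :: bool where
  "type_one \<longleftrightarrow> (\<forall>v. act (free_gen GC) v = v) \<and> (\<forall>v. act (free_gen GCinv) v = v)
     \<and> span (\<Union>wt. weight_space wt) = UNIV"

definition submodule :: "'v set \<Rightarrow> bool" where
  "submodule W \<longleftrightarrow> subspace W \<and> (\<forall>y. \<forall>v\<in>W. act y v \<in> W)"

definition irreducible_module :: bool where
  "irreducible_module \<longleftrightarrow> (UNIV :: 'v set) \<noteq> {0}
     \<and> (\<forall>W. submodule W \<longrightarrow> W = {0} \<or> W = UNIV)"

definition highest_l_weight :: "monomial \<Rightarrow> bool" where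
  "highest_l_weight m \<longleftrightarrow> (\<exists>v. v \<noteq> 0 \<and> range (\<lambda>y. act y v) = UNIV
     \<and> (\<forall>i\<in>nodes g. \<forall>n. act (gx Plus i n) v = 0)
     \<and> (\<forall>i\<in>nodes g. \<forall>e r. act (phi q e i r) v = scale (fps_nth (l_weight g q m e i) r) v))"

text \<open>The module is (a model of) \<open>L(m)\<close>, which is determined by \<open>m\<close> up to isomorphism.\<close>

definition is_L :: "monomial \<Rightarrow> bool" where
  "is_L m \<longleftrightarrow> finite_dim \<and> type_one \<and> irreducible_module \<and> highest_l_weight m"

definition l_weight_space :: "monomial \<Rightarrow> 'v set" where
  "l_weight_space m = {v. \<exists>p. \<forall>i\<in>nodes g. \<forall>e r.
     ((\<lambda>w. act (phi q e i r) w - scale (fps_nth (l_weight g q m e i) r) w) ^^ p) v = 0}"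

text \<open>Only finitely many monomials contribute for a finite-dimensional module when \<open>q\<close> is not a
  root of unity, as distinct monomials then have distinct l-weights.\<close>

definition q_character :: laurent where
  "q_character = (\<Sum>m \<in> {m \<in> monomials g. l_weight_space m \<noteq> {0}}.
     Poly_Mapping.single m (int (dim (l_weight_space m))))"

end


section \<open>Snakes and skew diagrams\<close>

fun snake_points :: "lie_type \<Rightarrow> (nat \<times> int) set" where
  "snake_points (TypeA N) = {(i, k). i \<in> {1..N} \<and> [int i - k = 1] (mod 2)}"
| "snake_points (TypeB N) = {(i, k). i \<in> {1..N} \<and> i < N \<and> [2 * int i - k = 2] (mod 4)}"

text \<open>\<open>snake_position g p p'\<close>: the point \<open>p'\<close> is in snake position with respect to \<open>p\<close>.\<close>

fun snake_position :: "lie_type \<Rightarrow> nat \<times> int \<Rightarrow> nat \<times> int \<Rightarrow> bool" where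
  "snake_position (TypeA N) (i, k) (i', k') \<longleftrightarrow> k' - k \<ge> \<bar>int i' - int i\<bar> + 2"
| "snake_position (TypeB N) (i, k) (i', k') \<longleftrightarrow>
     k' - k \<ge> 2 * \<bar>int i' - int i\<bar> + 4 \<and> [k' - k = 2 * \<bar>int i' - int i\<bar>] (mod 4)"

definition is_snake :: "lie_type \<Rightarrow> nat \<Rightarrow> (nat \<Rightarrow> nat) \<Rightarrow> (nat \<Rightarrow> int) \<Rightarrow> bool" where
  "is_snake g T i k \<longleftrightarrow> T \<ge> 1 \<and> (\<forall>t\<in>{1..T}. (i t, k t) \<in> snake_points g)
     \<and> (\<forall>t\<in>{2..T}. snake_position g (i (t - 1), k (t - 1)) (i t, k t))"

definition skew_diagram ::
    "lie_type \<Rightarrow> nat \<Rightarrow> (nat \<Rightarrow> nat) \<Rightarrow> (nat \<Rightarrow> int) \<Rightarrow> (int \<times> nat) set" where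
  "skew_diagram g T i k = {(s, t). 1 \<le> t \<and> t \<le> T
     \<and> real t - of_int (k t) / (2 * of_int (dual_lacing g)) - (real (i t) - 1) / 2 \<le> of_int s
     \<and> of_int s \<le> real t - of_int (k t) / (2 * of_int (dual_lacing g)) + (real (i t) - 1) / 2}"


section \<open>Tableaux\<close>

datatype letter = Plain nat | Zero | Barred nat

instantiation letter :: linorder
begin

fun less_letter :: "letter \<Rightarrow> letter \<Rightarrow> bool" where
  "Plain i < Plain j \<longleftrightarrow> i < j"
| "Plain i < Zero \<longleftrightarrow> True"
| "Plain i < Barred j \<longleftrightarrow> True"
| "Zero < Plain j \<longleftrightarrow> False"
| "Zero < Zero \<longleftrightarrow> False"
| "Zero < Barred j \<longleftrightarrow> True"
| "Barred i < Plain j \<longleftrightarrow> False"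
| "Barred i < Zero \<longleftrightarrow> False"
| "Barred i < Barred j \<longleftrightarrow> j < i"

definition less_eq_letter :: "letter \<Rightarrow> letter \<Rightarrow> bool" where
  "x \<le> y \<longleftrightarrow> x < y \<or> x = (y :: letter)"

instance
proof
  fix x y z :: letter
  show "x < y \<longleftrightarrow> x \<le> y \<and> \<not> y \<le> x"
    by (cases x; cases y) (auto simp: less_eq_letter_def)
  show "x \<le> x"
    by (simp add: less_eq_letter_def)
  show "x \<le> y \<Longrightarrow> y \<le> z \<Longrightarrow> x \<le> z"
    by (cases x; cases y; cases z) (auto simp: less_eq_letter_def)
  show "x \<le> y \<Longrightarrow> y \<le> x \<Longrightarrow> x = y"
    by (cases x; cases y) (auto simp: less_eq_letter_def)
  show "x \<le> y \<or> y \<le> x"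
    by (cases x; cases y) (auto simp: less_eq_letter_def)
qed

end

fun alphabet :: "lie_type \<Rightarrow> letter set" where
  "alphabet (TypeA N) = Plain ` {1..N + 1}"
| "alphabet (TypeB N) = Plain ` {1..N} \<union> {Zero} \<union> Barred ` {1..N}"

fun row_ok :: "lie_type \<Rightarrow> letter \<Rightarrow> letter \<Rightarrow> bool" where
  "row_ok (TypeA N) x y \<longleftrightarrow> x \<le> y"
| "row_ok (TypeB N) x y \<longleftrightarrow> x \<le> y \<and> (x, y) \<noteq> (Zero, Zero)"

fun col_ok :: "lie_type \<Rightarrow> letter \<Rightarrow> letter \<Rightarrow> bool" where
  "col_ok (TypeA N) x y \<longleftrightarrow> x < y"
| "col_ok (TypeB N) x y \<longleftrightarrow> x < y \<or> (x, y) = (Zero, Zero)"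

definition Tab :: "lie_type \<Rightarrow> (int \<times> nat) set \<Rightarrow> (int \<times> nat \<Rightarrow> letter) set" where
  "Tab g S = {\<T> \<in> S \<rightarrow>\<^sub>E alphabet g.
     (\<forall>i j. (i, j) \<in> S \<and> (i, j + 1) \<in> S \<longrightarrow> row_ok g (\<T> (i, j)) (\<T> (i, j + 1))) \<and>
     (\<forall>i j. (i, j) \<in> S \<and> (i + 1, j) \<in> S \<longrightarrow> col_ok g (\<T> (i, j)) (\<T> (i + 1, j)))}"

text \<open>\<open>Y g q a i k\<close> is the variable \<open>Y\<^sub>i\<^sub>,\<^sub>b\<close> with \<open>b = a q\<^sup>k\<close>, and the monomial \<open>1\<close> for \<open>i = 0\<close> and
  \<open>i = N + 1\<close>.\<close>

definition Y :: "lie_type \<Rightarrow> complex \<Rightarrow> complex \<Rightarrow> nat \<Rightarrow> int \<Rightarrow> monomial" where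
  "Y g q a i k = (if i \<in> nodes g then Poly_Mapping.single (i, a * q powi k) 1 else 0)"

text \<open>Outside the alphabet the value is irrelevant.\<close>

fun box :: "lie_type \<Rightarrow> complex \<Rightarrow> complex \<Rightarrow> letter \<Rightarrow> int \<Rightarrow> monomial" where
  "box (TypeA N) q a x k = (let Y = Y (TypeA N) q a in
     (case x of
        Plain i \<Rightarrow> - Y (i - 1) (int i + k) + Y i (int i - 1 + k)
      | _ \<Rightarrow> 0))"
| "box (TypeB N) q a x k = (let Y = Y (TypeB N) q a; n = int N in
     (case x of
        Plain i \<Rightarrow>
          if i < N then - Y (i - 1) (2 * int i + k) + Y i (2 * int i - 2 + k)
          else - Y (N - 1) (2 * n + k) + Y N (2 * n - 3 + k) + Y N (2 * n - 1 + k)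
      | Zero \<Rightarrow> - Y N (2 * n + 1 + k) + Y N (2 * n - 3 + k)
      | Barred i \<Rightarrow>
          if i < N then - Y i (4 * n - 2 * int i + k) + Y (i - 1) (4 * n - 2 - 2 * int i + k)
          else - Y N (2 * n - 1 + k) - Y N (2 * n + 1 + k) + Y (N - 1) (2 * n - 2 + k)))"

definition tableau_monomial ::
    "lie_type \<Rightarrow> complex \<Rightarrow> complex \<Rightarrow> (int \<times> nat) set \<Rightarrow> (int \<times> nat \<Rightarrow> letter) \<Rightarrow> monomial" where
  "tableau_monomial g q a S \<T> =
     (\<Sum>(i, j)\<in>S. box g q a (\<T> (i, j)) (2 * dual_lacing g * (int j - i)))"

end

theory Submission
  imports Defs
begin

text \<open>
  Only the given module \<open>V\<close> has to be analysed, so no general theory of q-characters is needed.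
  Raising one box of a tableau to the next letter multiplies its monomial by some \<open>A\<^sub>i\<^sub>,\<^sub>b\<^sup>-\<^sup>1\<close>.  On the
  vector space \<open>W\<close> with the tableaux as a basis let \<open>h\<^sub>i\<^sub>,\<^sub>n\<close> and \<open>k\<^sub>i\<close> act diagonally, as prescribed
  by the monomials, and let \<open>x\<^sup>-\<^sub>i\<^sub>,\<^sub>n\<close> and \<open>x\<^sup>+\<^sub>i\<^sub>,\<^sub>n\<close> act by raising and lowering boxes, with
  coefficients \<open>b\<^sup>n\<close> times constants.  The interlacing conditions imply that the l-weight of a tableau
  has only simple poles, one for each possible step; hence \<open>[x\<^sup>+, x\<^sup>-]\<close> has the correct diagonal part
  if the product of the constants of two opposite steps is the residue.  The off-diagonal part
  vanishes for a suitable choice of the constants because the tableaux form a distributive lattice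
  and a step multiplies the residues of all independent steps by factors that do not depend on the
  tableau.

  The pairs obtained from the two highest weight vectors by applying the \<open>x\<^sup>-\<^sub>i\<^sub>,\<^sub>n\<close> simultaneously in
  \<open>V\<close> and \<open>W\<close> form a subspace stable under all generators.  As the highest weight occurs in it only
  once, \<open>V\<close> is irreducible, and every tableau can be lowered to the first one, it is the graph of an
  isomorphism.  The quadratic and the Serre relations play no role, since they are not needed to
  recover an irreducible module from its highest l-weight.
\<close>

section \<open>Exponentials of power series\<close>

text \<open>Why suitable constants exist: a step \<open>p'\<close> multiplies the residue at an
  independent step \<open>p\<close> by \<open>swap p p'\<close>, and the constants of
  \<open>x^-\<close> have to absorb this factor around every square of steps. The condition for this
  is \<open>swap p p' * swap p' p = 1\<close>. It holds as soon as \<open>p'\<close> leaves the pole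
  order at \<open>p\<close> unchanged; this is the case because \<open>p\<close> is possible before
  and after \<open>p'\<close>, so that both orders are 1. Distributing the factors according to a
  fixed total order of the steps then settles all squares at once.

  Why the poles are simple: the pole order at a letter and a diagonal counts boxes on three
  neighbouring diagonals (\<open>excess\<close>), and in the decisive case the boxes on the outer
  two are those that block the move. Only the relation \<open>H\<close> and the contribution of a
  single box depend on the type.

  The pairs form the graph of a bijection for two different reasons: irreducibility of V kills the
  vectors paired with 0, whereas on the side of the tableaux the modes of \<open>x^+\<close> and
  \<open>x^-\<close> isolate single steps, since the spectral parameters are distinct.\<close>

abbreviation fexp :: "complex fps \<Rightarrow> complex fps" where
  "fexp s \<equiv> fps_exp 1 oo s"

lemma fexp_nth_0: "fps_nth (fexp s) 0 = 1"
  by simp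

lemma fexp_deriv: "fps_nth s 0 = 0 \<Longrightarrow> fps_deriv (fexp s) = fps_deriv s * fexp s"
  by (simp add: fps_compose_deriv mult.commute)

lemma fps_const_of_deriv_zero:
  fixes F :: "complex fps"
  assumes "fps_deriv F = 0"
  shows "F = fps_const (fps_nth F 0)"
  using assms by (simp add: fps_deriv_eq_0_iff)

lemma fexp_uminus:
  assumes "fps_nth s 0 = 0"
  shows "fexp s * fexp (- s) = 1"
proof -
  have "fps_deriv (fexp s * fexp (- s)) = 0"
    using assms by (simp add: fexp_deriv algebra_simps)
  from fps_const_of_deriv_zero[OF this] show ?thesis
    by (simp add: fps_const_1_eq_1 del: fps_const_mult)
qed

text \<open>A series with constant term 1 is determined by its logarithmic derivative: the product
  of \<open>F\<close> with \<open>fexp (- s)\<close> has derivative zero.\<close>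

lemma fexp_unique:
  assumes "fps_nth s 0 = 0" "fps_nth F 0 = 1" "fps_deriv F = fps_deriv s * F"
  shows "F = fexp s"
proof -
  have "fps_deriv (F * fexp (- s)) = 0"
    using assms by (simp add: fexp_deriv algebra_simps)
  from fps_const_of_deriv_zero[OF this] have "F * fexp (- s) = 1"
    using assms by simp
  then have "F * (fexp s * fexp (- s)) = fexp s"
    by (metis mult.commute mult.left_commute mult.right_neutral)
  then show ?thesis
    using fexp_uminus[OF assms(1)] by simp
qed

lemma fexp_add:
  assumes "fps_nth s 0 = 0" "fps_nth t 0 = 0"
  shows "fexp (s + t) = fexp s * fexp t"
  by (rule fexp_unique[symmetric]) (use assms in \<open>simp_all add: fexp_deriv algebra_simps\<close>)

lemma fexp_sum:
  assumes "finite A" "\<And>x. x \<in> A \<Longrightarrow> fps_nth (s x) 0 = 0"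
  shows "fexp (\<Sum>x\<in>A. s x) = (\<Prod>x\<in>A. fexp (s x))"
  using assms by (induction A rule: finite_induct) (simp_all add: fexp_add fps_sum_nth)

lemma fexp_of_nat_mult:
  assumes "fps_nth s 0 = 0"
  shows "fexp (of_nat n * s) = fexp s ^ n"
  using assms by (induction n) (simp_all add: fexp_add algebra_simps)

definition lin :: "complex \<Rightarrow> complex poly" where
  "lin c = [:1, - c:]"

text \<open>The expansion of -log(1 - c u). Differences of such series are the logarithms of
  l-weights.\<close>

definition neg_log_lin :: "complex \<Rightarrow> complex fps" where
  "neg_log_lin c = Abs_fps (\<lambda>n. if n = 0 then 0 else c ^ n / of_nat n)"

lemma neg_log_lin_nth [simp]:
  "fps_nth (neg_log_lin c) n = (if n = 0 then 0 else c ^ n / of_nat n)"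
  by (simp add: neg_log_lin_def)

lemma fps_of_poly_lin: "fps_of_poly (lin c) = 1 - fps_const c * fps_X"
  by (simp add: lin_def fps_of_poly_pCons)

lemma fps_of_poly_lin_nth_0 [simp]: "fps_nth (fps_of_poly (lin c)) 0 = 1"
  by (simp add: lin_def)

text \<open>The logarithmic derivative of 1 / (1 - c u) is c / (1 - c u), so the product has
  derivative zero and constant term 1.\<close>

lemma fexp_neg_log_lin: "fexp (neg_log_lin c) * fps_of_poly (lin c) = 1"
proof -
  have z: "fps_nth (neg_log_lin c) 0 = 0"
    by simp
  have d: "fps_deriv (neg_log_lin c) * fps_of_poly (lin c) = fps_const c"
  proof (rule fps_ext)
    fix n
    show "fps_nth (fps_deriv (neg_log_lin c) * fps_of_poly (lin c)) n = fps_nth (fps_const c) n"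
      by (cases n) (simp_all add: fps_of_poly_lin algebra_simps del: of_nat_Suc)
  qed
  have dlin: "fps_deriv (fps_of_poly (lin c)) = fps_const (- c)"
    by (simp add: fps_of_poly_lin)
  have "fps_deriv (fexp (neg_log_lin c) * fps_of_poly (lin c)) =
      fexp (neg_log_lin c) * (fps_deriv (neg_log_lin c) * fps_of_poly (lin c))
        + fexp (neg_log_lin c) * fps_const (- c)"
    by (simp only: fps_deriv_mult dlin fexp_deriv[OF z] mult_ac add_ac)
  also have "\<dots> = fexp (neg_log_lin c) * (fps_const c + fps_const (- c))"
    by (simp only: d distrib_left)
  also have "\<dots> = 0"
    by simp
  finally have "fps_deriv (fexp (neg_log_lin c) * fps_of_poly (lin c)) = 0" .
  from fps_const_of_deriv_zero[OF this] show ?thesis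
    by (simp add: lin_def)
qed

section \<open>Multiplicative and additive functions of monomials\<close>

definition msupp :: "nat \<Rightarrow> monomial \<Rightarrow> complex set" where
  "msupp i m = {c. Poly_Mapping.lookup m (i, c) \<noteq> 0}"

lemma finite_msupp [simp]: "finite (msupp i m)"
proof -
  have "msupp i m \<subseteq> snd ` Poly_Mapping.keys m"
    by (force simp: msupp_def in_keys_iff)
  then show ?thesis
    by (rule finite_subset) simp
qed

text \<open>Extends a function of the spectral parameter to a homomorphism on monomials. The
  eigenvalues of \<open>h\<close> have this form, those of \<open>k\<close> and the residues have
  the form \<open>mprod\<close>; hence the effect of a step is known once both are evaluated on
  \<open>A_mon\<close>.\<close>

definition msum :: "nat \<Rightarrow> (complex \<Rightarrow> complex) \<Rightarrow> monomial \<Rightarrow> complex" where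
  "msum i f m = (\<Sum>c\<in>msupp i m. of_int (Poly_Mapping.lookup m (i, c)) * f c)"

definition mprod :: "nat \<Rightarrow> (complex \<Rightarrow> complex) \<Rightarrow> monomial \<Rightarrow> complex" where
  "mprod i f m = (\<Prod>c\<in>msupp i m. f c powi Poly_Mapping.lookup m (i, c))"

lemma msum_superset:
  "finite K \<Longrightarrow> msupp i m \<subseteq> K \<Longrightarrow> msum i f m = (\<Sum>c\<in>K. of_int (Poly_Mapping.lookup m (i, c)) * f c)"
  unfolding msum_def by (rule sum.mono_neutral_left) (auto simp: msupp_def)

lemma mprod_superset:
  "finite K \<Longrightarrow> msupp i m \<subseteq> K \<Longrightarrow> mprod i f m = (\<Prod>c\<in>K. f c powi Poly_Mapping.lookup m (i, c))"
  unfolding mprod_def by (rule prod.mono_neutral_left) (auto simp: msupp_def)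

lemma msum_add: "msum i f (m + m') = msum i f m + msum i f m'"
proof -
  let ?K = "msupp i m \<union> msupp i m' \<union> msupp i (m + m')"
  have "msum i f (m + m') = (\<Sum>c\<in>?K. of_int (Poly_Mapping.lookup (m + m') (i, c)) * f c)"
    "msum i f m = (\<Sum>c\<in>?K. of_int (Poly_Mapping.lookup m (i, c)) * f c)"
    "msum i f m' = (\<Sum>c\<in>?K. of_int (Poly_Mapping.lookup m' (i, c)) * f c)"
    by (rule msum_superset; auto)+
  then show ?thesis
    by (simp add: lookup_add ring_distribs sum.distrib)
qed

lemma msum_uminus: "msum i f (- m) = - msum i f m"
proof -
  have "msum i f (- m) = (\<Sum>c\<in>msupp i m. of_int (Poly_Mapping.lookup (- m) (i, c)) * f c)"
    by (rule msum_superset[OF finite_msupp]) (auto simp: msupp_def)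
  then show ?thesis
    by (simp add: msum_def sum_negf)
qed

lemma msum_diff: "msum i f (m - m') = msum i f m - msum i f m'"
  using msum_add[of i f m "- m'"] by (simp add: msum_uminus)

lemma msum_0 [simp]: "msum i f 0 = 0"
  by (simp add: msum_def msupp_def)

lemma msum_single: "msum i f (Poly_Mapping.single (j, c) n) = (if i = j then of_int n * f c else 0)"
proof -
  have "msum i f (Poly_Mapping.single (j, c) n) =
      (\<Sum>c'\<in>{c}. of_int (Poly_Mapping.lookup (Poly_Mapping.single (j, c) n) (i, c')) * f c')"
    by (rule msum_superset) (auto simp: msupp_def lookup_single when_def split: if_splits)
  then show ?thesis
    by (simp add: lookup_single when_def)
qed

text \<open>Zero values of \<open>f\<close> are excluded because \<open>0 powi n\<close> does not
  turn sums into products: \<open>0 powi 1 * 0 powi (- 1) = 0\<close>, but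
  \<open>0 powi 0 = 1\<close>. This is why residues are computed with vanishing factors replaced by
  1.\<close>

lemma mprod_add:
  assumes "\<And>c. f c \<noteq> 0"
  shows "mprod i f (m + m') = mprod i f m * mprod i f m'"
proof -
  let ?K = "msupp i m \<union> msupp i m' \<union> msupp i (m + m')"
  have "mprod i f (m + m') = (\<Prod>c\<in>?K. f c powi Poly_Mapping.lookup (m + m') (i, c))"
    "mprod i f m = (\<Prod>c\<in>?K. f c powi Poly_Mapping.lookup m (i, c))"
    "mprod i f m' = (\<Prod>c\<in>?K. f c powi Poly_Mapping.lookup m' (i, c))"
    by (rule mprod_superset; auto)+
  then show ?thesis
    using assms by (simp add: lookup_add power_int_add prod.distrib)
qed

lemma mprod_uminus: "mprod i f (- m) = inverse (mprod i f m)"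
proof -
  have "mprod i f (- m) = (\<Prod>c\<in>msupp i m. f c powi Poly_Mapping.lookup (- m) (i, c))"
    by (rule mprod_superset[OF finite_msupp]) (auto simp: msupp_def)
  also have "\<dots> = (\<Prod>c\<in>msupp i m. inverse (f c powi Poly_Mapping.lookup m (i, c)))"
    by (intro prod.cong) (simp_all add: power_int_minus)
  also have "\<dots> = inverse (mprod i f m)"
    unfolding mprod_def by (rule prod_inversef[unfolded comp_def])
  finally show ?thesis .
qed

lemma mprod_0 [simp]: "mprod i f 0 = 1"
  by (simp add: mprod_def msupp_def)

lemma mprod_diff:
  assumes "\<And>c. f c \<noteq> 0"
  shows "mprod i f (m - m') = mprod i f m / mprod i f m'"
  using mprod_add[of f i m "- m'", OF assms] by (simp add: mprod_uminus divide_inverse)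

lemma mprod_single:
  "mprod i f (Poly_Mapping.single (j, c) n) = (if i = j then f c powi n else 1)"
proof -
  have "mprod i f (Poly_Mapping.single (j, c) n) =
      (\<Prod>c'\<in>{c}. f c' powi Poly_Mapping.lookup (Poly_Mapping.single (j, c) n) (i, c'))"
    by (rule mprod_superset) (auto simp: msupp_def lookup_single when_def split: if_splits)
  then show ?thesis
    by (simp add: lookup_single when_def)
qed

lemma mprod_nonzero: "(\<And>c. f c \<noteq> 0) \<Longrightarrow> mprod i f m \<noteq> 0"
  by (simp add: mprod_def)

lemma msum_Y: "msum i f (Y g q a j k) = (if i = j \<and> j \<in> nodes g then f (a * q powi k) else 0)"
  by (simp add: Y_def msum_single)

lemma mprod_Y: "mprod i f (Y g q a j k) = (if i = j \<and> j \<in> nodes g then f (a * q powi k) else 1)"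
  by (simp add: Y_def mprod_single)

lemma lookup_Y: "Poly_Mapping.lookup (Y g q a j k) (i, c) =
    (if i = j \<and> j \<in> nodes g \<and> c = a * q powi k then 1 else 0)"
  by (auto simp: Y_def lookup_single when_def)

lemma monomials_add: "m \<in> monomials g \<Longrightarrow> m' \<in> monomials g \<Longrightarrow> m + m' \<in> monomials g"
  unfolding monomials_def using keys_add[of m m'] by blast

lemma monomials_uminus: "m \<in> monomials g \<Longrightarrow> - m \<in> monomials g"
  unfolding monomials_def by (simp add: keys_def)

lemma monomials_diff: "m \<in> monomials g \<Longrightarrow> m' \<in> monomials g \<Longrightarrow> m - m' \<in> monomials g"
  using monomials_add[of m g "- m'"] monomials_uminus[of m' g] by simp

lemma monomials_0 [simp]: "0 \<in> monomials g"
  by (simp add: monomials_def)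

lemma monomials_sum: "(\<And>x. x \<in> A \<Longrightarrow> f x \<in> monomials g) \<Longrightarrow> sum f A \<in> monomials g"
  by (induction A rule: infinite_finite_induct) (auto intro: monomials_add)

lemma monomials_Y: "q \<noteq> 0 \<Longrightarrow> a \<noteq> 0 \<Longrightarrow> Y g q a j k \<in> monomials g"
  by (auto simp: Y_def monomials_def)

section \<open>The monomials attached to the simple roots\<close>

text \<open>The factor at node \<open>i\<close> of the affine root monomial \<open>A\<close> of node
  \<open>j\<close> with spectral parameter a q^l. It is isolated because eigenvalues and poles at
  node \<open>i\<close> see no other factor.\<close>

definition A_part :: "lie_type \<Rightarrow> complex \<Rightarrow> complex \<Rightarrow> nat \<Rightarrow> int \<Rightarrow> nat \<Rightarrow> monomial" where
  "A_part g q a j l i =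
     (if i = j then Y g q a j (l - symm g j) + Y g q a j (l + symm g j)
      else if cartan g i j = -1 then - Y g q a i l
      else if cartan g i j = -2 then - Y g q a i (l - 1) - Y g q a i (l + 1)
      else 0)"

definition A_mon :: "lie_type \<Rightarrow> complex \<Rightarrow> complex \<Rightarrow> nat \<Rightarrow> int \<Rightarrow> monomial" where
  "A_mon g q a j l = (\<Sum>i\<in>nodes g. A_part g q a j l i)"

lemma finite_nodes [simp]: "finite (nodes g)"
  by (simp add: nodes_def)

lemma msum_sum: "msum i f (sum h A) = (\<Sum>x\<in>A. msum i f (h x))"
  by (induction A rule: infinite_finite_induct) (auto simp: msum_add)

lemma mprod_sum:
  assumes "\<And>c. f c \<noteq> 0"
  shows "mprod i f (sum h A) = (\<Prod>x\<in>A. mprod i f (h x))"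
  by (induction A rule: infinite_finite_induct) (auto simp: mprod_add assms)

lemma msum_A_mon:
  assumes "i \<in> nodes g"
  shows "msum i f (A_mon g q a j l) = msum i f (A_part g q a j l i)"
proof -
  have "msum i f (A_mon g q a j l) = (\<Sum>i'\<in>nodes g. msum i f (A_part g q a j l i'))"
    by (simp add: A_mon_def msum_sum)
  also have "\<dots> = (\<Sum>i'\<in>nodes g. if i' = i then msum i f (A_part g q a j l i) else 0)"
    by (intro sum.cong) (auto simp: A_part_def msum_add msum_diff msum_uminus msum_Y)
  finally show ?thesis
    using assms by simp
qed

lemma mprod_A_mon:
  assumes "i \<in> nodes g" "\<And>c. f c \<noteq> 0"
  shows "mprod i f (A_mon g q a j l) = mprod i f (A_part g q a j l i)"
proof -
  have "mprod i f (A_mon g q a j l) = (\<Prod>i'\<in>nodes g. mprod i f (A_part g q a j l i'))"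
    by (simp add: A_mon_def mprod_sum assms)
  also have "\<dots> = (\<Prod>i'\<in>nodes g. if i' = i then mprod i f (A_part g q a j l i) else 1)"
    by (intro prod.cong) (auto simp: A_part_def mprod_add mprod_diff mprod_uminus mprod_Y assms)
  finally show ?thesis
    using assms by simp
qed

lemma lookup_A_mon:
  assumes "i \<in> nodes g"
  shows "Poly_Mapping.lookup (A_mon g q a j l) (i, c) = Poly_Mapping.lookup (A_part g q a j l i) (i, c)"
proof -
  have "Poly_Mapping.lookup (A_mon g q a j l) (i, c)
      = (\<Sum>i'\<in>nodes g. Poly_Mapping.lookup (A_part g q a j l i') (i, c))"
    by (simp add: A_mon_def lookup_sum)
  also have "\<dots> = (\<Sum>i'\<in>nodes g. if i' = i then Poly_Mapping.lookup (A_part g q a j l i) (i, c) else 0)"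
    by (intro sum.cong) (auto simp: A_part_def lookup_add lookup_minus lookup_Y)
  finally show ?thesis
    using assms by simp
qed

section \<open>Powers of q, quantum integers and Cartan entries\<close>

lemma powi_add: "(x :: complex) \<noteq> 0 \<Longrightarrow> x powi (m + n) = x powi m * x powi n"
  by (simp add: power_int_add)

lemma powi_diff: "(x :: complex) \<noteq> 0 \<Longrightarrow> x powi (m - n) = x powi m * inverse (x powi n)"
  by (simp add: power_int_diff divide_inverse)

lemma powi_neg: "(x :: complex) powi (- n) = inverse (x powi n)"
  by (rule power_int_minus)

lemmas powi_split = powi_add powi_diff

lemma powi_eq_1_iff:
  assumes "q \<noteq> 0" "not_root_of_unity q"
  shows "q powi n = 1 \<longleftrightarrow> n = 0"
proof
  assume n: "q powi n = 1"
  show "n = 0"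
  proof (rule ccontr)
    assume "n \<noteq> 0"
    have "q ^ nat \<bar>n\<bar> = 1"
    proof (cases "n \<ge> 0")
      case True
      then show ?thesis
        using n by (simp add: power_int_def)
    next
      case False
      then have "inverse q ^ nat (- n) = 1"
        using n by (simp add: power_int_def)
      then show ?thesis
        using False by (simp add: power_inverse)
    qed
    moreover have "nat \<bar>n\<bar> > 0"
      using \<open>n \<noteq> 0\<close> by simp
    ultimately show False
      using assms(2) unfolding not_root_of_unity_def by blast
  qed
qed simp

lemma powi_eq_iff:
  assumes "q \<noteq> 0" "not_root_of_unity q"
  shows "q powi n = q powi m \<longleftrightarrow> n = m"
proof -
  have "q powi n = q powi m \<longleftrightarrow> q powi (n - m) = 1"
    using assms(1) by (simp add: power_int_diff)
  then show ?thesis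
    using powi_eq_1_iff[OF assms] by simp
qed

lemma q_minus_inverse:
  assumes "q \<noteq> 0" "not_root_of_unity q" "n \<noteq> 0"
  shows "q powi n - q powi (- n) \<noteq> 0"
  using powi_eq_iff[OF assms(1,2), of n "- n"] assms(3) by simp

lemma qint_minus: "qint q (- n) = - qint q n"
  by (simp add: qint_def diff_divide_distrib)

lemma qint_double:
  assumes "q \<noteq> 0"
  shows "qint q n * (q powi n + q powi (- n)) = qint q (2 * n)"
proof -
  have "q powi (2 * n) = q powi n * q powi n" "q powi (- (2 * n)) = q powi (- n) * q powi (- n)"
    using assms by (simp_all add: power_int_add[symmetric])
  then show ?thesis
    unfolding qint_def by (simp add: algebra_simps)
qed

lemma cartan_cases:
  assumes "valid_lie_type g"
  obtains "i = j" "cartan g i j = 2"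
  | "i \<noteq> j" "cartan g i j = -1"
  | "i \<noteq> j" "cartan g i j = -2" "symm g i = 1"
  | "i \<noteq> j" "cartan g i j = 0"
proof -
  have "i = j \<and> cartan g i j = 2 \<or> i \<noteq> j \<and> cartan g i j = -1
      \<or> i \<noteq> j \<and> cartan g i j = -2 \<and> symm g i = 1 \<or> i \<noteq> j \<and> cartan g i j = 0"
    using assms by (cases g) auto
  then show thesis
    using that by blast
qed

lemma symm_pos: "symm g i > 0"
  by (cases g) auto

lemma symm_cartan_sym:
  assumes "i \<in> nodes g" "j \<in> nodes g"
  shows "symm_cartan g i j = symm_cartan g j i"
  using assms by (cases g) (auto simp: symm_cartan_def nodes_def)

section \<open>Eigenvalues, pole orders and residues as functions of the monomial\<close>

definition k_eig :: "lie_type \<Rightarrow> complex \<Rightarrow> nat \<Rightarrow> monomial \<Rightarrow> complex" where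
  "k_eig g q i m = mprod i (\<lambda>_. q powi symm g i) m"

text \<open>For a single Y with parameter c, the logarithm of (1 - u c q^-r) / (1 - u c q^r) has the
  coefficients c^n (q^(nr) - q^(-nr)) / n, which is q - 1/q times the value used here.\<close>

definition h_eig :: "lie_type \<Rightarrow> complex \<Rightarrow> nat \<Rightarrow> int \<Rightarrow> monomial \<Rightarrow> complex" where
  "h_eig g q i n m = msum i (\<lambda>c. c powi n * qint q (n * symm g i) / of_int n) m"

text \<open>The order of the pole of the l-weight of \<open>m\<close> at \<open>u = 1/b\<close>.\<close>

definition pole_ord :: "lie_type \<Rightarrow> complex \<Rightarrow> nat \<Rightarrow> complex \<Rightarrow> monomial \<Rightarrow> int" where
  "pole_ord g q i b m = Poly_Mapping.lookup m (i, b * q powi (- symm g i))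
     - Poly_Mapping.lookup m (i, b * q powi symm g i)"

definition nz :: "complex \<Rightarrow> complex" where
  "nz x = (if x = 0 then 1 else x)"

text \<open>With the convention that zero factors are omitted, the value of the l-weight at \<open>u = 1/b\<close>
  becomes multiplicative; at a simple pole it is the residue.\<close>

definition res_fac :: "complex \<Rightarrow> int \<Rightarrow> complex \<Rightarrow> complex \<Rightarrow> complex" where
  "res_fac q r b c = q powi r * nz (1 - c * q powi (- r) / b) / nz (1 - c * q powi r / b)"

definition l_res :: "lie_type \<Rightarrow> complex \<Rightarrow> nat \<Rightarrow> complex \<Rightarrow> monomial \<Rightarrow> complex" where
  "l_res g q i b m = mprod i (res_fac q (symm g i) b) m"

text \<open>The value at u = 1 / b' of the l-weight of \<open>A\<close> with parameter b = b' q^d,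
  where \<open>B\<close> is the symmetrized Cartan entry; vanishing factors are again replaced by
  1.\<close>

definition cross :: "complex \<Rightarrow> int \<Rightarrow> int \<Rightarrow> complex" where
  "cross q B d = q powi B * nz (1 - q powi (d - B)) / nz (1 - q powi (d + B))"

lemma nz_nonzero [simp]: "nz x \<noteq> 0"
  by (simp add: nz_def)

lemma res_fac_nonzero: "q \<noteq> 0 \<Longrightarrow> res_fac q r b c \<noteq> 0"
  by (simp add: res_fac_def)

lemma cross_nonzero: "q \<noteq> 0 \<Longrightarrow> cross q B d \<noteq> 0"
  by (simp add: cross_def)

lemma l_res_nonzero: "q \<noteq> 0 \<Longrightarrow> l_res g q i b m \<noteq> 0"
  by (simp add: l_res_def mprod_nonzero res_fac_nonzero)

lemma k_eig_nonzero: "q \<noteq> 0 \<Longrightarrow> k_eig g q i m \<noteq> 0"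
  by (simp add: k_eig_def mprod_nonzero)

lemma h_eig_diff: "h_eig g q i n (m - m') = h_eig g q i n m - h_eig g q i n m'"
  by (simp add: h_eig_def msum_diff)

lemma k_eig_diff: "q \<noteq> 0 \<Longrightarrow> k_eig g q i (m - m') = k_eig g q i m / k_eig g q i m'"
  by (simp add: k_eig_def mprod_diff)

lemma l_res_diff: "q \<noteq> 0 \<Longrightarrow> l_res g q i b (m - m') = l_res g q i b m / l_res g q i b m'"
  by (simp add: l_res_def mprod_diff res_fac_nonzero)

lemma pole_ord_add: "pole_ord g q i b (m + m') = pole_ord g q i b m + pole_ord g q i b m'"
  by (simp add: pole_ord_def lookup_add)

lemma pole_ord_0 [simp]: "pole_ord g q i b 0 = 0"
  by (simp add: pole_ord_def)

lemma pole_ord_diff: "pole_ord g q i b (m - m') = pole_ord g q i b m - pole_ord g q i b m'"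
  by (simp add: pole_ord_def lookup_minus)

lemma k_eig_A_mon:
  assumes "valid_lie_type g" "q \<noteq> 0" "i \<in> nodes g" "j \<in> nodes g"
  shows "k_eig g q i (A_mon g q a j l) = q powi symm_cartan g i j"
proof -
  have "k_eig g q i (A_mon g q a j l) = mprod i (\<lambda>_. q powi symm g i) (A_part g q a j l i)"
    unfolding k_eig_def using assms by (intro mprod_A_mon) auto
  then show ?thesis
    using assms
    by (cases rule: cartan_cases[OF assms(1), of i j])
      (auto simp: A_part_def mprod_add mprod_diff mprod_uminus mprod_Y symm_cartan_def
        power_int_minus field_simps power2_eq_square simp flip: power_int_add)
qed

text \<open>The identity [m]_q (q^m + q^-m) = [2m]_q merges the two shifted factors, both for
  \<open>i = j\<close> and for the Cartan entry -2. The outcome is the structure constant of the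
  relation between \<open>h\<close> and \<open>x\<close>.\<close>

lemma h_eig_A_mon:
  assumes "valid_lie_type g" "q \<noteq> 0" "a \<noteq> 0" "i \<in> nodes g" "j \<in> nodes g"
  shows "h_eig g q i n (A_mon g q a j l) =
    (a * q powi l) powi n * qint q (n * symm_cartan g i j) / of_int n"
proof -
  let ?f = "\<lambda>c. c powi n * qint q (n * symm g i) / of_int n"
  have A: "h_eig g q i n (A_mon g q a j l) = msum i ?f (A_part g q a j l i)"
    unfolding h_eig_def using assms by (intro msum_A_mon)
  have f: "?f (a * q powi (l + s)) = (a * q powi l) powi n * q powi (n * s) * qint q (n * symm g i) / of_int n" for s
    using assms by (simp add: power_int_mult_distrib power_int_add power_int_mult[symmetric] mult_ac)
  have sum: "?f (a * q powi (l + s)) + ?f (a * q powi (l + - s))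
      = (a * q powi l) powi n * (qint q (n * symm g i) * (q powi (n * s) + q powi (- (n * s)))) / of_int n" for s
    unfolding f by (simp add: algebra_simps add_divide_distrib)
  show ?thesis
  proof (cases rule: cartan_cases[OF assms(1), of i j])
    case 1
    then have "h_eig g q i n (A_mon g q a j l) = ?f (a * q powi (l + symm g j)) + ?f (a * q powi (l + - symm g j))"
      unfolding A using assms by (simp add: A_part_def msum_add msum_Y)
    also have "\<dots> = (a * q powi l) powi n * qint q (2 * (n * symm g i)) / of_int n"
      unfolding sum using 1 qint_double[OF assms(2)] by simp
    finally show ?thesis
      using 1 by (simp add: symm_cartan_def mult_ac)
  next
    case 2
    then show ?thesis
      unfolding A using assms by (simp add: A_part_def msum_uminus msum_Y symm_cartan_def qint_minus)
  next
    case 3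
    then have "h_eig g q i n (A_mon g q a j l) = - (?f (a * q powi (l + 1)) + ?f (a * q powi (l + - 1)))"
      unfolding A using assms by (simp add: A_part_def msum_diff msum_uminus msum_Y)
    also have "\<dots> = - ((a * q powi l) powi n * qint q (2 * (n * symm g i)) / of_int n)"
      unfolding sum using 3 qint_double[OF assms(2), of n] by simp
    finally show ?thesis
      using 3 by (simp add: symm_cartan_def mult_ac qint_minus)
  next
    case 4
    then show ?thesis
      unfolding A using assms by (simp add: A_part_def symm_cartan_def qint_def)
  qed
qed

lemma a_powi_inj:
  assumes "q \<noteq> 0" "not_root_of_unity q" "a \<noteq> 0"
  shows "a * q powi n = a * q powi m \<longleftrightarrow> n = m"
  using powi_eq_iff[OF assms(1,2)] assms(3) by simp

lemma pole_ord_Y: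
  assumes "q \<noteq> 0" "not_root_of_unity q" "a \<noteq> 0"
  shows "pole_ord g q i (a * q powi l) (Y g q a j k) =
    (if i = j \<and> j \<in> nodes g then (if k = l - symm g i then 1 else 0) - (if k = l + symm g i then 1 else 0) else 0)"
proof -
  have e: "a * q powi l * q powi (- symm g i) = a * q powi (l - symm g i)"
    "a * q powi l * q powi symm g i = a * q powi (l + symm g i)"
    using assms by (simp_all add: mult.assoc flip: power_int_add)
  show ?thesis
    unfolding pole_ord_def e lookup_Y a_powi_inj[OF assms] by auto
qed

text \<open>One formula covers all signs of the Cartan entry: for a negative entry pole and zero
  change places, for the entry 0 they cancel.\<close>

lemma pole_ord_A_mon:
  assumes "valid_lie_type g" "q \<noteq> 0" "not_root_of_unity q" "a \<noteq> 0" "i \<in> nodes g" "j \<in> nodes g"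
  shows "pole_ord g q i (a * q powi l') (A_mon g q a j l) =
    (if l' = l + symm_cartan g i j then 1 else 0) - (if l' = l - symm_cartan g i j then 1 else 0)"
proof -
  have uminus: "pole_ord g q i b (- m) = - pole_ord g q i b m" for b m
    by (simp add: pole_ord_def)
  have "pole_ord g q i (a * q powi l') (A_mon g q a j l) = pole_ord g q i (a * q powi l') (A_part g q a j l i)"
    unfolding pole_ord_def using assms by (simp add: lookup_A_mon)
  then show ?thesis
    using assms symm_pos[of g i]
    by (cases rule: cartan_cases[OF assms(1), of i j])
      (auto simp: A_part_def uminus pole_ord_add pole_ord_diff pole_ord_Y symm_cartan_def)
qed

lemma res_fac_shift:
  assumes "q \<noteq> 0" "a \<noteq> 0"
  shows "res_fac q r (a * q powi l') (a * q powi l) = q powi r * nz (1 - q powi (l - l' - r)) / nz (1 - q powi (l - l' + r))"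
proof -
  have "a * q powi l * q powi (- r) / (a * q powi l') = q powi (l - l' - r)"
    "a * q powi l * q powi r / (a * q powi l') = q powi (l - l' + r)"
    by (simp_all only: powi_split[OF assms(1)] powi_neg) (use assms in \<open>simp_all add: divide_inverse\<close>)
  then show ?thesis
    by (simp add: res_fac_def)
qed

text \<open>Two neighbouring factors telescope, so that only the symmetrized Cartan entry and the
  relative shift survive. In particular a step changes a residue by a factor that does not depend on
  the tableau.\<close>

lemma l_res_A_mon:
  assumes "valid_lie_type g" "q \<noteq> 0" "a \<noteq> 0" "i \<in> nodes g" "j \<in> nodes g"
  shows "l_res g q i (a * q powi l') (A_mon g q a j l) = cross q (symm_cartan g i j) (l - l')"
proof -
  let ?r = "symm g i"
  have A: "l_res g q i (a * q powi l') (A_mon g q a j l)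
      = mprod i (res_fac q ?r (a * q powi l')) (A_part g q a j l i)"
    unfolding l_res_def using assms by (intro mprod_A_mon) (auto simp: res_fac_nonzero)
  have two: "res_fac q r (a * q powi l') (a * q powi (l - r)) * res_fac q r (a * q powi l') (a * q powi (l + r))
      = cross q (2 * r) (l - l')" for r
  proof -
    have e: "l - r - l' - r = l - l' - 2 * r" "l - r - l' + r = l - l'" "l + r - l' - r = l - l'"
      "l + r - l' + r = l - l' + 2 * r"
      by auto
    have "q powi (2 * r) = q powi r * q powi r"
      using assms by (simp flip: power_int_add)
    then show ?thesis
      unfolding res_fac_shift[OF assms(2,3)] cross_def e by (simp add: field_simps)
  qed
  have inv: "inverse (cross q r d) = cross q (- r) d" for r d
    using assms by (simp add: cross_def power_int_minus field_simps)
  have one: "res_fac q r (a * q powi l') (a * q powi l) = cross q r (l - l')" for r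
    unfolding res_fac_shift[OF assms(2,3)] cross_def by simp
  show ?thesis
  proof (cases rule: cartan_cases[OF assms(1), of i j])
    case 1
    then show ?thesis
      unfolding A using assms two[of ?r]
      by (simp add: A_part_def mprod_add mprod_Y res_fac_nonzero symm_cartan_def mult_ac)
  next
    case 2
    then show ?thesis
      unfolding A using assms
      by (simp add: A_part_def mprod_uminus mprod_Y symm_cartan_def one inv)
  next
    case 3
    have "mprod i (res_fac q ?r (a * q powi l')) (A_part g q a j l i)
        = inverse (res_fac q 1 (a * q powi l') (a * q powi (l - 1)) * res_fac q 1 (a * q powi l') (a * q powi (l + 1)))"
      using 3 assms
      by (simp add: A_part_def mprod_diff mprod_uminus mprod_Y res_fac_nonzero field_simps)
    then show ?thesis
      unfolding A two inv using 3 by (simp add: symm_cartan_def)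
  next
    case 4
    then show ?thesis
      unfolding A by (simp add: A_part_def symm_cartan_def cross_def)
  qed
qed

text \<open>At shift 0 no factor vanishes, and q^B (1 - q^-B) = -(1 - q^B). By this sign the
  residues before and after a step are opposite, as a commutator demands.\<close>

lemma cross_same:
  assumes "q \<noteq> 0" "not_root_of_unity q" "B \<noteq> 0"
  shows "cross q B 0 = -1"
proof -
  have "1 - q powi B \<noteq> 0" "1 - q powi (- B) \<noteq> 0"
    using powi_eq_1_iff[OF assms(1,2)] assms(3) by (simp_all add: eq_commute[of 1])
  then have "cross q B 0 = q powi B * (1 - q powi (- B)) / (1 - q powi B)"
    by (simp add: cross_def nz_def)
  also have "q powi B * (1 - q powi (- B)) = - (1 - q powi B)"
    using assms(1) by (simp add: power_int_minus field_simps)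
  finally show ?thesis
    using \<open>1 - q powi B \<noteq> 0\<close> by (metis divide_self minus_divide_left)
qed

text \<open>The identity 1 - x = -x (1 - 1/x), applied to both factors of the denominator, produces
  the numerator. At \<open>d = B\<close> or \<open>d = - B\<close> with \<open>B\<close> nonzero
  vanishing factors are replaced by 1, and the product would be -1.\<close>

lemma cross_inverse:
  assumes "q \<noteq> 0" "not_root_of_unity q" "(d \<noteq> B \<and> d \<noteq> - B) \<or> B = 0"
  shows "cross q B d * cross q B (- d) = 1"
proof (cases "B = 0")
  case True
  then show ?thesis
    by (simp add: cross_def)
next
  case False
  have ne1: "1 - q powi n \<noteq> 0" if "n \<noteq> 0" for n
    using powi_eq_1_iff[OF assms(1,2), of n] that by auto
  have ne: "1 - q powi (d - B) \<noteq> 0" "1 - q powi (d + B) \<noteq> 0" "1 - q powi (- d - B) \<noteq> 0" "1 - q powi (- d + B) \<noteq> 0"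
    by (rule ne1; use assms(3) False in linarith)+
  have qn: "q powi d \<noteq> 0" "q powi B \<noteq> 0"
    using assms(1) by simp_all
  have "cross q B d * cross q B (- d) = (q powi B * q powi B * (1 - q powi (d - B)) * (1 - q powi (- d - B)))
      / ((1 - q powi (d + B)) * (1 - q powi (- d + B)))"
    using ne by (simp add: cross_def nz_def)
  moreover have "(1 - q powi (d + B)) * (1 - q powi (- d + B))
      = q powi B * q powi B * (1 - q powi (d - B)) * (1 - q powi (- d - B))"
    using qn by (simp only: powi_split[OF assms(1)] powi_neg) (simp add: field_simps)
  ultimately show ?thesis
    using ne assms(1) by simp
qed

section \<open>The series of an l-weight\<close>

lemma pcompose_lin: "pcompose (lin c) [:0, x:] = lin (c * x)"
  by (simp add: lin_def pcompose_pCons mult.commute)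

lemma pcompose_power: "pcompose (p ^ n) r = pcompose p r ^ n" for p :: "complex poly"
  by (induction n) (simp_all add: pcompose_mult pcompose_1)

lemma lin_nonzero [simp]: "lin c \<noteq> 0"
  by (simp add: lin_def)

lemma degree_lin [simp]: "c \<noteq> 0 \<Longrightarrow> degree (lin c) = 1"
  by (simp add: lin_def)

lemma poly_lin: "poly (lin c) x = 1 - c * x"
  by (simp add: lin_def)

lemma reflect_lin: "c \<noteq> 0 \<Longrightarrow> reflect_poly (lin c) = smult (- c) (lin (inverse c))"
  by (simp add: lin_def reflect_poly_pCons)

lemma Q_poly_eq: "Q_poly m i = (\<Prod>c\<in>msupp i m. lin c ^ nat (Poly_Mapping.lookup m (i, c)))"
  unfolding Q_poly_def lin_def by (rule prod.mono_neutral_left[OF finite_msupp]) (auto simp: msupp_def)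

lemma R_poly_eq: "R_poly m i = (\<Prod>c\<in>msupp i m. lin c ^ nat (- Poly_Mapping.lookup m (i, c)))"
  unfolding R_poly_def lin_def by (rule prod.mono_neutral_left[OF finite_msupp]) (auto simp: msupp_def)

lemma lw_num_eq:
  "lw_num g q m i = (\<Prod>c\<in>msupp i m. lin (c * q powi (- symm g i)) ^ nat (Poly_Mapping.lookup m (i, c))
     * lin (c * q powi symm g i) ^ nat (- Poly_Mapping.lookup m (i, c)))"
  by (simp only: lw_num_def Q_poly_eq R_poly_eq pcompose_prod pcompose_power pcompose_lin prod.distrib)

lemma lw_den_eq:
  "lw_den g q m i = (\<Prod>c\<in>msupp i m. lin (c * q powi symm g i) ^ nat (Poly_Mapping.lookup m (i, c))
     * lin (c * q powi (- symm g i)) ^ nat (- Poly_Mapping.lookup m (i, c)))"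
  by (simp only: lw_den_def Q_poly_eq R_poly_eq pcompose_prod pcompose_power pcompose_lin prod.distrib)

lemma msupp_nonzero: "m \<in> monomials g \<Longrightarrow> c \<in> msupp i m \<Longrightarrow> c \<noteq> 0"
  by (force simp: monomials_def msupp_def in_keys_iff)

lemma powi_sum: "q \<noteq> 0 \<Longrightarrow> (q :: complex) powi (sum f A) = (\<Prod>x\<in>A. q powi f x)"
  by (induction A rule: infinite_finite_induct) (simp_all add: power_int_add)

text \<open>A factor \<open>lin c\<close> has degree 1 only for nonzero \<open>c\<close>, which is
  guaranteed on \<open>monomials g\<close>.\<close>

lemma lw_const_eq:
  assumes "m \<in> monomials g" "q \<noteq> 0"
  shows "lw_const g q m i = k_eig g q i m"
proof -
  have Q: "int (degree (Q_poly m i)) = (\<Sum>c\<in>msupp i m. int (nat (Poly_Mapping.lookup m (i, c))))"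
    unfolding Q_poly_eq using msupp_nonzero[OF assms(1)]
    by (subst degree_prod_eq_sum_degree) (auto simp: degree_power_eq)
  have R: "int (degree (R_poly m i)) = (\<Sum>c\<in>msupp i m. int (nat (- Poly_Mapping.lookup m (i, c))))"
    unfolding R_poly_eq using msupp_nonzero[OF assms(1)]
    by (subst degree_prod_eq_sum_degree) (auto simp: degree_power_eq)
  have "int (degree (Q_poly m i)) - int (degree (R_poly m i)) = (\<Sum>c\<in>msupp i m. Poly_Mapping.lookup m (i, c))"
    unfolding Q R sum_subtractf[symmetric] by (intro sum.cong) auto
  then show ?thesis
    unfolding lw_const_def k_eig_def mprod_def
    by (simp add: sum_distrib_left powi_sum[OF assms(2)] power_int_mult)
qed

text \<open>The eigenvalues of the coefficients of \<open>h_series\<close> at l-weight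
  \<open>m\<close>, that is, the logarithm of the l-weight after division by its constant
  term.\<close>

definition h_series_val :: "lie_type \<Rightarrow> complex \<Rightarrow> sign \<Rightarrow> nat \<Rightarrow> monomial \<Rightarrow> complex fps" where
  "h_series_val g q e i m = Abs_fps (\<lambda>n. if n = 0 then 0
     else of_int (sgn_int e) * (q - inverse q) * h_eig g q i (sgn_int e * int n) m)"

lemma h_series_val_0: "fps_nth (h_series_val g q e i m) 0 = 0"
  by (simp add: h_series_val_def)

text \<open>\<open>nat y\<close> and \<open>nat (- y)\<close> separate positive from negative
  exponents in the same way as \<open>Q_poly\<close> and \<open>R_poly\<close>; the equation is
  multiplied out so that no quotient of power series occurs.\<close>

lemma fexp_log_ratio:
  fixes y :: int
  shows "fexp (of_int y * (neg_log_lin \<alpha> - neg_log_lin \<beta>)) *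
      fps_of_poly (lin \<alpha> ^ nat y * lin \<beta> ^ nat (- y)) = fps_of_poly (lin \<beta> ^ nat y * lin \<alpha> ^ nat (- y))"
proof -
  have base: "fexp (neg_log_lin \<alpha> - neg_log_lin \<beta>) * fps_of_poly (lin \<alpha>) = fps_of_poly (lin \<beta>)" for \<alpha> \<beta>
  proof -
    have "fexp (neg_log_lin \<alpha> - neg_log_lin \<beta>) = fexp (neg_log_lin \<alpha>) * fexp (- neg_log_lin \<beta>)"
      using fexp_add[of "neg_log_lin \<alpha>" "- neg_log_lin \<beta>"] by simp
    moreover have "fexp (- neg_log_lin \<beta>) = fps_of_poly (lin \<beta>)"
      using fexp_neg_log_lin[of \<beta>] fexp_uminus[of "neg_log_lin \<beta>"]
      by (metis mult.left_commute mult.right_neutral neg_log_lin_nth)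
    ultimately show ?thesis
      using fexp_neg_log_lin[of \<alpha>] by (simp add: mult_ac)
  qed
  have pow: "fexp (of_nat n * (neg_log_lin \<alpha> - neg_log_lin \<beta>)) * fps_of_poly (lin \<alpha>) ^ n = fps_of_poly (lin \<beta>) ^ n"
    for \<alpha> \<beta> n
    by (subst fexp_of_nat_mult) (simp_all add: base flip: power_mult_distrib)
  show ?thesis
  proof (cases "y \<ge> 0")
    case True
    then show ?thesis
      using pow[of "nat y" \<alpha> \<beta>] by (simp add: fps_of_poly_power)
  next
    case False
    have "of_int y * (neg_log_lin \<alpha> - neg_log_lin \<beta>) = of_nat (nat (- y)) * (neg_log_lin \<beta> - neg_log_lin \<alpha>)"
      using False by (simp add: algebra_simps)
    then show ?thesis
      using pow[of "nat (- y)" \<beta> \<alpha>] False by (simp add: fps_of_poly_power)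
  qed
qed

lemma fexp_log_prod:
  assumes "finite K"
  shows "fexp (\<Sum>c\<in>K. of_int (y c) * (neg_log_lin (\<alpha> c) - neg_log_lin (\<beta> c))) *
      fps_of_poly (\<Prod>c\<in>K. lin (\<alpha> c) ^ nat (y c) * lin (\<beta> c) ^ nat (- y c))
    = fps_of_poly (\<Prod>c\<in>K. lin (\<beta> c) ^ nat (y c) * lin (\<alpha> c) ^ nat (- y c))"
  using assms
  by (subst fexp_sum) (simp_all add: fps_of_poly_prod fexp_log_ratio flip: prod.distrib)

lemma qint_mult_q: "q \<noteq> 0 \<Longrightarrow> not_root_of_unity q \<Longrightarrow> (q - inverse q) * qint q n = q powi n - q powi (- n)"
  using q_minus_inverse[of q 1] by (simp add: qint_def)

lemma of_int_fps_nth: "fps_nth (of_int y * f) n = of_int y * fps_nth f n" for f :: "complex fps"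
  by (simp add: fps_of_int[symmetric])

text \<open>The quantum integer [n r]_q splits each coefficient into the power sums of c q^r and of
  c q^-r. For \<open>Minus\<close> the variable is 1/u, whence the inverted parameters.\<close>

lemma h_series_val_eq:
  assumes q: "q \<noteq> 0" "not_root_of_unity q" and "m \<in> monomials g"
  shows "h_series_val g q Plus i m = (\<Sum>c\<in>msupp i m. of_int (Poly_Mapping.lookup m (i, c)) *
      (neg_log_lin (c * q powi symm g i) - neg_log_lin (c * q powi (- symm g i))))"
    and "h_series_val g q Minus i m = (\<Sum>c\<in>msupp i m. of_int (Poly_Mapping.lookup m (i, c)) *
      (neg_log_lin (inverse (c * q powi symm g i)) - neg_log_lin (inverse (c * q powi (- symm g i)))))"
proof -
  let ?r = "symm g i"
  have pw: "(q powi r) ^ n = q powi (int n * r)" for r n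
    by (metis mult.commute power_int_mult power_int_of_nat)
  show "h_series_val g q Plus i m = (\<Sum>c\<in>msupp i m. of_int (Poly_Mapping.lookup m (i, c)) *
      (neg_log_lin (c * q powi symm g i) - neg_log_lin (c * q powi (- symm g i))))"
  proof (rule fps_ext)
    fix n
    show "fps_nth (h_series_val g q Plus i m) n = fps_nth (\<Sum>c\<in>msupp i m. of_int (Poly_Mapping.lookup m (i, c)) *
      (neg_log_lin (c * q powi symm g i) - neg_log_lin (c * q powi (- symm g i)))) n"
    proof (cases "n = 0")
      case False
      have "(q - inverse q) * (of_int y * (c powi int n * qint q (int n * ?r) / of_nat n))
        = of_int y * ((c * q powi ?r) ^ n / of_nat n - (c * q powi (- ?r)) ^ n / of_nat n)" for c y
      proof -
        have "(q - inverse q) * (of_int y * (c powi int n * qint q (int n * ?r) / of_nat n))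
          = of_int y * (c ^ n * ((q - inverse q) * qint q (int n * ?r)) / of_nat n)"
          by simp
        also have "\<dots> = of_int y * (c ^ n * (q powi (int n * ?r) - q powi (- (int n * ?r))) / of_nat n)"
          by (simp only: qint_mult_q[OF q])
        also have "\<dots> = of_int y * ((c * q powi ?r) ^ n / of_nat n - (c * q powi (- ?r)) ^ n / of_nat n)"
          by (simp add: power_mult_distrib pw algebra_simps diff_divide_distrib)
        finally show ?thesis .
      qed
      then show ?thesis
        using False
        by (simp add: h_series_val_def h_eig_def msum_def fps_sum_nth sum_distrib_left of_int_fps_nth)
    qed (simp add: h_series_val_def fps_sum_nth of_int_fps_nth)
  qed
  show "h_series_val g q Minus i m = (\<Sum>c\<in>msupp i m. of_int (Poly_Mapping.lookup m (i, c)) *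
      (neg_log_lin (inverse (c * q powi symm g i)) - neg_log_lin (inverse (c * q powi (- symm g i)))))"
  proof (rule fps_ext)
    fix n
    show "fps_nth (h_series_val g q Minus i m) n = fps_nth (\<Sum>c\<in>msupp i m. of_int (Poly_Mapping.lookup m (i, c)) *
      (neg_log_lin (inverse (c * q powi symm g i)) - neg_log_lin (inverse (c * q powi (- symm g i))))) n"
    proof (cases "n = 0")
      case False
      have t: "- ((q - inverse q) * (of_int y * (c powi (- int n) * qint q (- (int n * ?r)) / - of_nat n)))
        = of_int y * (inverse (c * q powi ?r) ^ n / of_nat n - inverse (c * q powi (- ?r)) ^ n / of_nat n)" for c y
      proof -
        have "- ((q - inverse q) * (of_int y * (c powi (- int n) * qint q (- (int n * ?r)) / - of_nat n)))
          = of_int y * (inverse c ^ n * ((q - inverse q) * qint q (- (int n * ?r))) / of_nat n)"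
          by (simp add: power_int_minus power_inverse)
        also have "\<dots> = of_int y * (inverse c ^ n * (q powi (- (int n * ?r)) - q powi (- (- (int n * ?r)))) / of_nat n)"
          by (simp only: qint_mult_q[OF q])
        also have "\<dots> = of_int y * (inverse (c * q powi ?r) ^ n / of_nat n - inverse (c * q powi (- ?r)) ^ n / of_nat n)"
        proof -
          have "inverse (c * q powi s) ^ n = inverse c ^ n * q powi (- (int n * s))" for s
            by (simp add: power_mult_distrib power_int_minus power_inverse pw)
          from this[of ?r] this[of "- ?r"] show ?thesis
            by (simp only: mult_minus_right right_diff_distrib diff_divide_distrib)
        qed
        finally show ?thesis .
      qed
      have "fps_nth (h_series_val g q Minus i m) n = - ((q - inverse q) * h_eig g q i (- int n) m)"
        using False by (simp add: h_series_val_def algebra_simps)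
      also have "\<dots> = (\<Sum>c\<in>msupp i m. - ((q - inverse q) * (of_int (Poly_Mapping.lookup m (i, c))
          * (c powi (- int n) * qint q (- (int n * ?r)) / - of_nat n))))"
        by (simp add: h_eig_def msum_def sum_distrib_left sum_negf)
      also have "\<dots> = (\<Sum>c\<in>msupp i m. of_int (Poly_Mapping.lookup m (i, c))
          * (inverse (c * q powi ?r) ^ n / of_nat n - inverse (c * q powi (- ?r)) ^ n / of_nat n))"
        by (simp only: t)
      finally show ?thesis
        using False by (simp add: fps_sum_nth of_int_fps_nth)
    qed (simp add: h_series_val_def fps_sum_nth of_int_fps_nth)
  qed
qed

lemma fps_div_eqI:
  fixes F A B :: "complex fps"
  assumes "F * B = A" "B \<noteq> 0"
  shows "A / B = F"
  using assms by auto

lemma l_weight_Plus_eq_exp: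
  assumes "q \<noteq> 0" "not_root_of_unity q" "m \<in> monomials g"
  shows "l_weight g q m Plus i = fps_const (k_eig g q i m) * fexp (h_series_val g q Plus i m)"
proof -
  have "fexp (h_series_val g q Plus i m) * fps_of_poly (lw_den g q m i) = fps_of_poly (lw_num g q m i)"
    unfolding h_series_val_eq[OF assms] lw_num_eq lw_den_eq by (rule fexp_log_prod) simp
  moreover have "fps_of_poly (lw_den g q m i) \<noteq> 0"
    by (simp add: lw_den_eq)
  ultimately show ?thesis
    by (simp add: fps_div_eqI lw_const_eq assms)
qed

text \<open>Reflecting the linear factors produces scalars, and the quotient \<open>cn / cd\<close>
  of their products is the inverse square of \<open>k_eig\<close>. It turns the leading constant
  \<open>k_eig\<close> into its inverse, the eigenvalue of \<open>gk Minus i\<close>.\<close>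

lemma l_weight_Minus_eq_exp:
  assumes "q \<noteq> 0" "not_root_of_unity q" "m \<in> monomials g"
  shows "l_weight g q m Minus i = fps_const (inverse (k_eig g q i m)) * fexp (h_series_val g q Minus i m)"
proof -
  let ?K = "msupp i m"
  define y where "y = (\<lambda>c. Poly_Mapping.lookup m (i, c))"
  define \<alpha> where "\<alpha> = (\<lambda>c. c * q powi symm g i)"
  define \<beta> where "\<beta> = (\<lambda>c. c * q powi (- symm g i))"
  have nz: "\<alpha> c \<noteq> 0" "\<beta> c \<noteq> 0" if "c \<in> ?K" for c
    using msupp_nonzero[OF assms(3) that] assms(1) by (simp_all add: \<alpha>_def \<beta>_def)
  have num: "reflect_poly (lw_num g q m i) = (\<Prod>c\<in>?K. smult (- \<beta> c) (lin (inverse (\<beta> c))) ^ nat (y c)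
      * smult (- \<alpha> c) (lin (inverse (\<alpha> c))) ^ nat (- y c))"
    unfolding lw_num_eq reflect_poly_prod reflect_poly_mult reflect_poly_power
    by (intro prod.cong) (use nz in \<open>simp_all add: reflect_lin y_def \<alpha>_def \<beta>_def\<close>)
  have den: "reflect_poly (lw_den g q m i) = (\<Prod>c\<in>?K. smult (- \<alpha> c) (lin (inverse (\<alpha> c))) ^ nat (y c)
      * smult (- \<beta> c) (lin (inverse (\<beta> c))) ^ nat (- y c))"
    unfolding lw_den_eq reflect_poly_prod reflect_poly_mult reflect_poly_power
    by (intro prod.cong) (use nz in \<open>simp_all add: reflect_lin y_def \<alpha>_def \<beta>_def\<close>)
  define cn where "cn = (\<Prod>c\<in>?K. (- \<beta> c) ^ nat (y c) * (- \<alpha> c) ^ nat (- y c))"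
  define cd where "cd = (\<Prod>c\<in>?K. (- \<alpha> c) ^ nat (y c) * (- \<beta> c) ^ nat (- y c))"
  define N where "N = (\<Prod>c\<in>?K. lin (inverse (\<beta> c)) ^ nat (y c) * lin (inverse (\<alpha> c)) ^ nat (- y c))"
  define D where "D = (\<Prod>c\<in>?K. lin (inverse (\<alpha> c)) ^ nat (y c) * lin (inverse (\<beta> c)) ^ nat (- y c))"
  have smult_prod: "(\<Prod>c\<in>?K. smult (a c) (p c)) = smult (\<Prod>c\<in>?K. a c) (\<Prod>c\<in>?K. p c)"
    for a and p :: "complex \<Rightarrow> complex poly"
    by (rule prod_smult)
  have num': "reflect_poly (lw_num g q m i) = smult cn N"
    unfolding num cn_def N_def smult_prod[symmetric]
    by (intro prod.cong) (simp_all only: smult_power mult_smult_left mult_smult_right smult_smult mult.commute)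
  have den': "reflect_poly (lw_den g q m i) = smult cd D"
    unfolding den cd_def D_def smult_prod[symmetric]
    by (intro prod.cong) (simp_all only: smult_power mult_smult_left mult_smult_right smult_smult mult.commute)
  have "cd \<noteq> 0"
    using nz by (auto simp: cd_def)
  have k: "cn * k_eig g q i m = inverse (k_eig g q i m) * cd"
  proof -
    have "cn * (k_eig g q i m * k_eig g q i m) = cd"
      unfolding cn_def cd_def k_eig_def mprod_def prod.distrib[symmetric]
    proof (intro prod.cong refl)
      fix c assume c: "c \<in> ?K"
      have ab: "\<alpha> c = \<beta> c * (q powi symm g i * q powi symm g i)"
        using assms(1) by (simp add: \<alpha>_def \<beta>_def power_int_minus)
      have "q powi symm g i \<noteq> 0"
        using assms(1) by simp
      then show "(- \<beta> c) ^ nat (y c) * (- \<alpha> c) ^ nat (- y c) *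
          ((q powi symm g i) powi Poly_Mapping.lookup m (i, c) * (q powi symm g i) powi Poly_Mapping.lookup m (i, c))
        = (- \<alpha> c) ^ nat (y c) * (- \<beta> c) ^ nat (- y c)"
        unfolding y_def[symmetric] using fun_cong[OF y_def, of c]
        by (cases "y c \<ge> 0")
          (simp_all add: ab power_int_def power_mult_distrib power_minus' field_simps)
    qed
    then show ?thesis
      using k_eig_nonzero[OF assms(1), of g i m] by (simp add: field_simps)
  qed
  have "fexp (h_series_val g q Minus i m) * fps_of_poly D = fps_of_poly N"
    unfolding h_series_val_eq[OF assms] D_def N_def y_def \<alpha>_def \<beta>_def by (rule fexp_log_prod) simp
  then have "fps_const (cn / cd) * fexp (h_series_val g q Minus i m) * fps_of_poly (reflect_poly (lw_den g q m i))
      = fps_of_poly (reflect_poly (lw_num g q m i))"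
    unfolding num' den' fps_of_poly_smult using \<open>cd \<noteq> 0\<close>
    by (simp add: mult_ac)
  moreover have "fps_of_poly (reflect_poly (lw_den g q m i)) \<noteq> 0"
    by (simp add: lw_den_eq)
  ultimately have "fps_of_poly (reflect_poly (lw_num g q m i)) / fps_of_poly (reflect_poly (lw_den g q m i))
      = fps_const (cn / cd) * fexp (h_series_val g q Minus i m)"
    by (rule fps_div_eqI)
  then have "l_weight g q m Minus i = fps_const (k_eig g q i m) * (fps_const (cn / cd) * fexp (h_series_val g q Minus i m))"
    by (simp only: l_weight.simps lw_const_eq[OF assms(3,1)])
  then have "l_weight g q m Minus i = fps_const (k_eig g q i m * (cn / cd)) * fexp (h_series_val g q Minus i m)"
    by (simp only: mult.assoc[symmetric] fps_const_mult)
  moreover have "k_eig g q i m * (cn / cd) = inverse (k_eig g q i m)"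
    using k \<open>cd \<noteq> 0\<close> by (simp add: field_simps)
  ultimately show ?thesis
    by simp
qed

section \<open>Partial fractions\<close>

lemma degree_prod_lin: "finite B \<Longrightarrow> 0 \<notin> B \<Longrightarrow> degree (\<Prod>b\<in>B. lin b) = card B"
  by (induction B rule: finite_induct) (simp_all add: degree_mult_eq)

lemma fps_div_cross:
  fixes A B P D :: "complex fps"
  assumes "A * D = B * P" "B \<noteq> 0" "fps_nth D 0 \<noteq> 0"
  shows "A / B = P / D"
proof -
  have "D \<noteq> 0"
    using assms(3) by auto
  have F: "(P * inverse D) * D = P"
    using assms(3) by (simp add: inverse_mult_eq_1 mult.assoc)
  then have "P / D = P * inverse D"
    using \<open>D \<noteq> 0\<close> by (rule fps_div_eqI)
  moreover have "(P * inverse D * B) * D = A * D"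
    using F assms(1) by (simp add: mult_ac)
  then have "P * inverse D * B = A"
    using \<open>D \<noteq> 0\<close> by simp
  then have "A / B = P * inverse D"
    using assms(2) by (rule fps_div_eqI)
  ultimately show ?thesis
    by simp
qed

text \<open>The numbers \<open>\<rho> b\<close> interpolate \<open>p\<close> at the points 1/b, and
  \<open>C\<close> matches the coefficient in degree \<open>card D\<close>. If nonzero, the
  difference would have degree below \<open>card D\<close> and yet \<open>card D\<close> distinct
  zeros.\<close>

lemma partial_fraction_poly:
  fixes p :: "complex poly"
  assumes D: "finite D" "0 \<notin> D" and deg: "degree p \<le> card D"
  defines "\<rho> \<equiv> \<lambda>b. poly p (1 / b) / (\<Prod>b'\<in>D - {b}. 1 - b' / b)"
  obtains C where "p = smult C (\<Prod>b\<in>D. lin b) + (\<Sum>b\<in>D. smult (\<rho> b) (\<Prod>b'\<in>D - {b}. lin b'))"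
proof -
  let ?P = "\<Prod>b\<in>D. lin b"
  let ?S = "\<Sum>b\<in>D. smult (\<rho> b) (\<Prod>b'\<in>D - {b}. lin b')"
  have degP: "degree (\<Prod>b\<in>B. lin b) = card B" if "B \<subseteq> D" for B
    using that D finite_subset[OF that] by (intro degree_prod_lin) auto
  define r where "r = p - ?S"
  define C where "C = coeff r (card D) / coeff ?P (card D)"
  define w where "w = r - smult C ?P"
  have lc: "coeff ?P (card D) \<noteq> 0"
    using degP[of D] by (metis leading_coeff_0_iff lin_nonzero D(1) order_refl prod_zero_iff)
  have "degree (smult (\<rho> b) (\<Prod>b'\<in>D - {b}. lin b')) \<le> card D" for b
    using degP[of "D - {b}"] card_mono[OF D(1), of "D - {b}"] degree_smult_le[of "\<rho> b"]
    by (metis Diff_subset order_trans)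
  then have degS: "degree ?S \<le> card D"
    by (intro degree_sum_le D(1))
  then have degr: "degree r \<le> card D"
    unfolding r_def using deg by (intro degree_diff_le)
  have degw: "degree w \<le> card D"
    unfolding w_def using degr degP[of D] degree_smult_le[of C ?P] by (intro degree_diff_le) auto
  have roots: "poly w (1 / b) = 0" if b: "b \<in> D" for b
  proof -
    have b0: "b \<noteq> 0"
      using that D(2) by auto
    have "poly ?P (1 / b) = 0"
      using D(1) b b0 by (auto simp: poly_prod poly_lin)
    moreover have "poly ?S (1 / b) = poly p (1 / b)"
    proof -
      have "poly ?S (1 / b) = (\<Sum>b''\<in>D. \<rho> b'' * (\<Prod>b'\<in>D - {b''}. 1 - b' / b))"
        by (simp add: poly_sum poly_prod poly_lin)
      also have "\<dots> = (\<Sum>b''\<in>D. if b'' = b then \<rho> b * (\<Prod>b'\<in>D - {b}. 1 - b' / b) else 0)"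
        using D(1) b b0 by (intro sum.cong) (auto intro!: bexI[of _ b])
      also have "\<dots> = \<rho> b * (\<Prod>b'\<in>D - {b}. 1 - b' / b)"
        using D(1) b by simp
      also have "(\<Prod>b'\<in>D - {b}. 1 - b' / b) \<noteq> 0"
        using D(1) b0 by auto
      then have "\<rho> b * (\<Prod>b'\<in>D - {b}. 1 - b' / b) = poly p (1 / b)"
        by (simp add: \<rho>_def)
      finally show ?thesis .
    qed
    ultimately show ?thesis
      by (simp add: w_def r_def)
  qed
  have "w = 0"
  proof (rule ccontr)
    assume w: "w \<noteq> 0"
    have "coeff w (card D) = 0"
      using lc by (simp add: w_def C_def)
    then have "degree w \<noteq> card D"
      using w by (metis leading_coeff_0_iff)
    then have "degree w < card D"
      using degw by simp
    moreover have "card ((\<lambda>b. 1 / b) ` D) = card D"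
      by (intro card_image inj_onI) auto
    moreover have "card ((\<lambda>b. 1 / b) ` D) \<le> card {x. poly w x = 0}"
      using roots w by (intro card_mono poly_roots_finite) auto
    ultimately show False
      using card_poly_roots_bound[OF w] by linarith
  qed
  then have "p = smult C ?P + ?S"
    by (simp add: w_def r_def algebra_simps)
  then show thesis
    using that by blast
qed

text \<open>Expansion of \<open>1 / (1 - u b)\<close> at \<open>u = 0\<close> and of \<open>1 / (1 - u b) = - v b\<^sup>-\<^sup>1 / (1 - v b\<^sup>-\<^sup>1)\<close>,
  \<open>v = 1 / u\<close>, at infinity: the difference of the two is the formal delta function at \<open>1 / b\<close>.\<close>

lemma partial_fraction_coeffs:
  fixes p :: "complex poly" and n :: int
  assumes D: "finite D" "0 \<notin> D" and deg: "degree p = card D" and p: "p \<noteq> 0"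
  defines "\<rho> \<equiv> \<lambda>b. poly p (1 / b) / (\<Prod>b'\<in>D - {b}. 1 - b' / b)"
  shows "(if n \<ge> 0 then fps_nth (fps_of_poly p / fps_of_poly (\<Prod>b\<in>D. lin b)) (nat n) else 0)
    - (if n \<le> 0 then fps_nth (fps_of_poly (reflect_poly p) / fps_of_poly (reflect_poly (\<Prod>b\<in>D. lin b))) (nat (- n)) else 0)
    = (\<Sum>b\<in>D. \<rho> b * b powi n)"
proof -
  let ?P = "\<Prod>b\<in>D. lin b"
  let ?R = "\<lambda>b. \<Prod>b'\<in>D - {b}. lin b'"
  obtain C where C: "p = smult C ?P + (\<Sum>b\<in>D. smult (\<rho> b) (?R b))"
    using partial_fraction_poly[OF D, of p] deg unfolding \<rho>_def by auto
  have degP: "degree (\<Prod>b\<in>B. lin b) = card B" if "B \<subseteq> D" for B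
    using that D finite_subset[OF that] by (intro degree_prod_lin) auto
  have P0: "?P \<noteq> 0"
    using D by simp
  have split: "?P = lin b * ?R b" if "b \<in> D" for b
    using D that by (simp add: prod.remove)
  define G where "G = (\<lambda>b :: complex. Abs_fps (\<lambda>n. b ^ n))"
  \<comment> \<open>The expansion of 1 / (1 - u b) = v / (v - b) in v = 1/u, written as 1 minus a
    geometric series.\<close>
  define H where "H = (\<lambda>b :: complex. 1 - Abs_fps (\<lambda>n. inverse b ^ n))"
  have G: "G b * fps_of_poly (lin b) = 1" for b
  proof -
    have "G b * fps_of_poly (lin b) = G b - fps_const b * G b * fps_X"
      by (simp add: fps_of_poly_lin algebra_simps)
    also have "\<dots> = 1"
    proof (rule fps_ext)
      show "fps_nth (G b - fps_const b * G b * fps_X) n = fps_nth 1 n" for n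
        by (cases n) (simp_all add: G_def)
    qed
    finally show ?thesis .
  qed
  have H: "H b * fps_of_poly (reflect_poly (lin b)) = fps_X" if "b \<noteq> 0" for b
  proof -
    have "fps_of_poly (reflect_poly (lin b)) = fps_X - fps_const b"
      using that by (simp add: lin_def reflect_poly_pCons fps_of_poly_pCons)
    moreover have "Abs_fps (\<lambda>n. inverse b ^ n) * (fps_X - fps_const b) = - fps_const b"
    proof (rule fps_ext)
      show "fps_nth (Abs_fps (\<lambda>n. inverse b ^ n) * (fps_X - fps_const b)) n = fps_nth (- fps_const b) n" for n
        using that by (cases n) (simp_all add: right_diff_distrib)
    qed
    ultimately have "H b * fps_of_poly (reflect_poly (lin b)) = fps_X - fps_const b - (- fps_const b)"
      by (simp only: H_def left_diff_distrib mult_1_left)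
    then show ?thesis
      by (simp del: fps_const_neg)
  qed
  have plus: "fps_of_poly p / fps_of_poly ?P = fps_const C + (\<Sum>b\<in>D. fps_const (\<rho> b) * G b)"
  proof (rule fps_div_eqI)
    have "fps_of_poly (?R b) = G b * fps_of_poly ?P" if "b \<in> D" for b
      using G[of b] by (simp add: split[OF that] fps_of_poly_mult mult.assoc[symmetric])
    then have "fps_of_poly p = fps_const C * fps_of_poly ?P + (\<Sum>b\<in>D. fps_const (\<rho> b) * (G b * fps_of_poly ?P))"
      by (subst C) (simp add: fps_of_poly_add fps_of_poly_smult fps_of_poly_sum)
    then show "(fps_const C + (\<Sum>b\<in>D. fps_const (\<rho> b) * G b)) * fps_of_poly ?P = fps_of_poly p"
      by (simp add: distrib_right sum_distrib_right mult.assoc)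
    show "fps_of_poly ?P \<noteq> 0"
      using P0 by simp
  qed
  \<comment> \<open>Reversal with respect to the fixed degree \<open>card D\<close> is linear, in
    contrast to \<open>reflect_poly\<close>; a summand of degree one less acquires the factor
    v.\<close>
  define rv where "rv = (\<lambda>x :: complex poly. Abs_fps (\<lambda>k. if k \<le> card D then coeff x (card D - k) else 0))"
  have rv_add: "rv (x + y) = rv x + rv y" for x y
    by (rule fps_ext) (simp add: rv_def)
  have rv_smult: "rv (smult c x) = fps_const c * rv x" for c x
    by (rule fps_ext) (simp add: rv_def)
  have rv_sum: "rv (sum f B) = (\<Sum>b\<in>B. rv (f b))" if "finite B" for f :: "complex \<Rightarrow> _" and B
    using that by (induction rule: finite_induct) (simp_all add: rv_add, simp add: rv_def fps_eq_iff)
  have rv0: "rv x = fps_of_poly (reflect_poly x)" if "degree x = card D" for x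
    using that by (intro fps_ext) (simp add: rv_def coeff_reflect_poly)
  have rv1: "rv x = fps_X * fps_of_poly (reflect_poly x)" if "Suc (degree x) = card D" for x
  proof (rule fps_ext)
    show "fps_nth (rv x) n = fps_nth (fps_X * fps_of_poly (reflect_poly x)) n" for n
      using that by (cases n) (auto simp: rv_def coeff_reflect_poly coeff_eq_0 not_less intro!: arg_cong[of _ _ "coeff x"])
  qed
  have minus: "fps_of_poly (reflect_poly p) / fps_of_poly (reflect_poly ?P)
      = fps_const C + (\<Sum>b\<in>D. fps_const (\<rho> b) * H b)"
  proof (rule fps_div_eqI)
    have R: "rv (?R b) = H b * fps_of_poly (reflect_poly ?P)" if "b \<in> D" for b
    proof -
      have "b \<noteq> 0"
        using that D(2) by auto
      have "Suc (degree (?R b)) = card D"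
        using degP[of "D - {b}"] that D(1) card_Suc_Diff1[OF D(1) that] by auto
      then have "rv (?R b) = fps_X * fps_of_poly (reflect_poly (?R b))"
        by (rule rv1)
      also have "\<dots> = H b * fps_of_poly (reflect_poly ?P)"
        using H[OF \<open>b \<noteq> 0\<close>] by (simp add: split[OF that] reflect_poly_mult fps_of_poly_mult mult.assoc[symmetric])
      finally show ?thesis .
    qed
    have "fps_of_poly (reflect_poly p) = rv p"
      using rv0[of p] deg by simp
    also have "\<dots> = fps_const C * rv ?P + (\<Sum>b\<in>D. fps_const (\<rho> b) * rv (?R b))"
      by (subst C) (simp add: rv_add rv_smult rv_sum D(1))
    also have "\<dots> = fps_const C * fps_of_poly (reflect_poly ?P) + (\<Sum>b\<in>D. fps_const (\<rho> b) * (H b * fps_of_poly (reflect_poly ?P)))"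
      using rv0[of ?P] degP[of D] R by simp
    finally show "(fps_const C + (\<Sum>b\<in>D. fps_const (\<rho> b) * H b)) * fps_of_poly (reflect_poly ?P) = fps_of_poly (reflect_poly p)"
      by (simp add: distrib_right sum_distrib_right mult.assoc)
    show "fps_of_poly (reflect_poly ?P) \<noteq> 0"
      using P0 by simp
  qed
  have nG: "fps_nth (fps_const C + (\<Sum>b\<in>D. fps_const (\<rho> b) * G b)) k = (if k = 0 then C else 0) + (\<Sum>b\<in>D. \<rho> b * b ^ k)" for k
    by (simp add: fps_sum_nth G_def)
  \<comment> \<open>Both expansions share the constant \<open>C\<close>, and in degree 0 only the
    expansion at u = 0 contains the sum of the \<rho>. The difference therefore has the same form
    for n = 0 as for all other n.\<close>
  have nH: "fps_nth (fps_const C + (\<Sum>b\<in>D. fps_const (\<rho> b) * H b)) k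
      = (if k = 0 then C else 0) - (if k = 0 then 0 else \<Sum>b\<in>D. \<rho> b * inverse b ^ k)" for k
    by (simp add: fps_sum_nth H_def sum_negf)
  show ?thesis
    unfolding plus minus nG nH by (simp add: power_int_def)
qed

lemma prod_shift_exponents:
  fixes f :: "complex \<Rightarrow> 'a::comm_monoid_mult" and h :: "complex \<Rightarrow> nat"
  assumes "finite K'" "(\<lambda>c. c * x) ` K \<subseteq> K'" "x \<noteq> 0" "\<And>c. c \<notin> K \<Longrightarrow> h c = 0"
  shows "(\<Prod>c\<in>K. f (c * x) ^ h c) = (\<Prod>b\<in>K'. f b ^ h (b / x))"
proof -
  have "(\<Prod>c\<in>K. f (c * x) ^ h c) = (\<Prod>b\<in>(\<lambda>c. c * x) ` K. f b ^ h (b / x))"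
    using assms(3) by (subst prod.reindex) (auto simp: inj_on_def)
  also have "\<dots> = (\<Prod>b\<in>K'. f b ^ h (b / x))"
  proof (rule prod.mono_neutral_left[OF assms(1,2)], intro ballI)
    fix b assume "b \<in> K' - (\<lambda>c. c * x) ` K"
    then have "b / x \<notin> K"
      using assms(3) by (force simp: image_iff)
    then show "f b ^ h (b / x) = 1"
      using assms(4) by simp
  qed
  finally show ?thesis .
qed

text \<open>The exponents of each \<open>f b\<close> agree on both sides. The values lie in an
  arbitrary commutative monoid because the identity is used twice: for the polynomials
  \<open>lin b\<close>, and for their values at one point with zeros replaced by 1.\<close>

lemma pole_cancellation:
  fixes f :: "complex \<Rightarrow> 'a::comm_monoid_mult"
  assumes q: "q \<noteq> 0"
    and K': "finite K'" "(\<lambda>c. c * q powi symm g i) ` msupp i m \<subseteq> K'" "(\<lambda>c. c * q powi (- symm g i)) ` msupp i m \<subseteq> K'"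
    and le: "\<And>b. b \<in> K' \<Longrightarrow> pole_ord g q i b m \<le> 1"
  shows "(\<Prod>c\<in>msupp i m. f (c * q powi (- symm g i)) ^ nat (Poly_Mapping.lookup m (i, c))
      * f (c * q powi symm g i) ^ nat (- Poly_Mapping.lookup m (i, c))) * (\<Prod>b | b \<in> K' \<and> pole_ord g q i b m = 1. f b)
    = (\<Prod>c\<in>msupp i m. f (c * q powi symm g i) ^ nat (Poly_Mapping.lookup m (i, c))
      * f (c * q powi (- symm g i)) ^ nat (- Poly_Mapping.lookup m (i, c))) * (\<Prod>b\<in>K'. f b ^ nat (- pole_ord g q i b m))"
proof -
  let ?r = "symm g i" and ?y = "\<lambda>c. Poly_Mapping.lookup m (i, c)"
  have z: "nat (?y c) = 0" "nat (- ?y c) = 0" if "c \<notin> msupp i m" for c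
    using that by (simp_all add: msupp_def)
  have x: "q powi ?r \<noteq> 0" "q powi (- ?r) \<noteq> 0" "b / q powi ?r = b * q powi (- ?r)" "b / q powi (- ?r) = b * q powi ?r" for b
    using q by (simp_all add: power_int_minus divide_inverse)
  have shift: "(\<Prod>c\<in>msupp i m. f (c * q powi ?r) ^ nat (?y c)) = (\<Prod>b\<in>K'. f b ^ nat (?y (b * q powi (- ?r))))"
      "(\<Prod>c\<in>msupp i m. f (c * q powi ?r) ^ nat (- ?y c)) = (\<Prod>b\<in>K'. f b ^ nat (- ?y (b * q powi (- ?r))))"
      "(\<Prod>c\<in>msupp i m. f (c * q powi (- ?r)) ^ nat (?y c)) = (\<Prod>b\<in>K'. f b ^ nat (?y (b * q powi ?r)))"
      "(\<Prod>c\<in>msupp i m. f (c * q powi (- ?r)) ^ nat (- ?y c)) = (\<Prod>b\<in>K'. f b ^ nat (- ?y (b * q powi ?r)))"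
    using prod_shift_exponents[OF K'(1,2) x(1), of "\<lambda>c. nat (?y c)" f] prod_shift_exponents[OF K'(1,2) x(1), of "\<lambda>c. nat (- ?y c)" f]
      prod_shift_exponents[OF K'(1,3) x(2), of "\<lambda>c. nat (?y c)" f] prod_shift_exponents[OF K'(1,3) x(2), of "\<lambda>c. nat (- ?y c)" f] z
    unfolding x(3,4) by auto
  have one: "(\<Prod>b | b \<in> K' \<and> pole_ord g q i b m = 1. f b) = (\<Prod>b\<in>K'. f b ^ (if pole_ord g q i b m = 1 then 1 else 0))"
    using K'(1) by (intro prod.mono_neutral_cong_left) auto
  show ?thesis
    unfolding prod.distrib shift one unfolding prod.distrib[symmetric] power_add[symmetric]
  proof (intro prod.cong refl arg_cong[of _ _ "\<lambda>n. f _ ^ n"])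
    fix b assume "b \<in> K'"
    from le[OF this] show "nat (?y (b * q powi ?r)) + nat (- ?y (b * q powi (- ?r))) + (if pole_ord g q i b m = 1 then 1 else 0)
        = nat (?y (b * q powi (- ?r))) + nat (- ?y (b * q powi ?r)) + nat (- pole_ord g q i b m)"
      by (auto simp: pole_ord_def)
  qed
qed

lemma pole_ord_support:
  assumes "q \<noteq> 0" "pole_ord g q i b m \<noteq> 0"
  shows "b \<in> (\<lambda>c. c * q powi symm g i) ` msupp i m \<union> (\<lambda>c. c * q powi (- symm g i)) ` msupp i m"
proof -
  have "b * q powi (- symm g i) \<in> msupp i m \<or> b * q powi symm g i \<in> msupp i m"
    using assms(2) by (auto simp: pole_ord_def msupp_def)
  moreover have "b = (b * q powi (- symm g i)) * q powi symm g i" "b = (b * q powi symm g i) * q powi (- symm g i)"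
    using assms(1) by (simp_all add: power_int_minus)
  ultimately show ?thesis
    by blast
qed

text \<open>The difference of the expansions at 0 and at infinity is a sum of delta functions at the
  poles. As the poles are simple, their weights are the residues, and \<open>l_res\<close> computes
  these by leaving out the vanishing factor.\<close>

theorem l_weight_residues:
  assumes q: "q \<noteq> 0" and m: "m \<in> monomials g"
    and le: "\<And>b. pole_ord g q i b m \<le> 1"
  shows "(if n \<ge> 0 then fps_nth (l_weight g q m Plus i) (nat n) else 0)
     - (if n \<le> 0 then fps_nth (l_weight g q m Minus i) (nat (- n)) else 0)
     = (\<Sum>b | pole_ord g q i b m = 1. l_res g q i b m * b powi n)"
proof -
  let ?r = "symm g i" and ?y = "\<lambda>c. Poly_Mapping.lookup m (i, c)"
  let ?k = "k_eig g q i m"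
  define K' where "K' = (\<lambda>c. c * q powi ?r) ` msupp i m \<union> (\<lambda>c. c * q powi (- ?r)) ` msupp i m"
  define D where "D = {b. pole_ord g q i b m = 1}"
  have finK: "finite K'" and K0: "0 \<notin> K'"
    using msupp_nonzero[OF m, of _ i] q by (auto simp: K'_def)
  have "D \<subseteq> K'"
    using pole_ord_support[OF q, of g i _ m] unfolding D_def K'_def by force
  then have Deq: "{b. b \<in> K' \<and> pole_ord g q i b m = 1} = D"
    by (auto simp: D_def)
  have finD: "finite D" and D0: "0 \<notin> D"
    using \<open>D \<subseteq> K'\<close> finK K0 by (auto intro: finite_subset)
  \<comment> \<open>The numerator in lowest terms; the reduced denominator is the product of
    \<open>lin b\<close> over the simple poles in \<open>D\<close>.\<close>
  define p where "p = (\<Prod>b\<in>K'. lin b ^ nat (- pole_ord g q i b m))"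
  have cancel: "(\<Prod>c\<in>msupp i m. f (c * q powi (- ?r)) ^ nat (?y c) * f (c * q powi ?r) ^ nat (- ?y c)) * prod f D
    = (\<Prod>c\<in>msupp i m. f (c * q powi ?r) ^ nat (?y c) * f (c * q powi (- ?r)) ^ nat (- ?y c))
      * (\<Prod>b\<in>K'. f b ^ nat (- pole_ord g q i b m))" for f :: "complex \<Rightarrow> 'a::comm_monoid_mult"
    using pole_cancellation[OF q finK, of g i m f] le unfolding Deq by (simp add: K'_def)
  have nd: "lw_num g q m i * (\<Prod>b\<in>D. lin b) = lw_den g q m i * p"
    unfolding lw_num_eq lw_den_eq p_def by (rule cancel)
  have p0: "p \<noteq> 0" and den0: "lw_den g q m i \<noteq> 0" and P0: "(\<Prod>b\<in>D. lin b) \<noteq> 0" and num0: "lw_num g q m i \<noteq> 0"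
    using finK finD by (simp_all add: p_def lw_den_eq lw_num_eq)
  have nz: "c * q powi ?r \<noteq> 0 \<and> c * q powi (- ?r) \<noteq> 0" if "c \<in> msupp i m" for c
    using msupp_nonzero[OF m that] q by simp
  have degeq: "degree (lw_num g q m i) = degree (lw_den g q m i)"
    unfolding lw_num_eq lw_den_eq using nz
    by (subst (1 2) degree_prod_eq_sum_degree) (simp_all add: degree_mult_eq degree_power_eq)
  have "degree (\<Prod>b\<in>D. lin b) = card D"
    using finD D0 by (rule degree_prod_lin)
  moreover have "degree (lw_num g q m i) + degree (\<Prod>b\<in>D. lin b) = degree (lw_den g q m i) + degree p"
    using nd p0 den0 P0 num0 by (metis degree_mult_eq)
  ultimately have degp: "degree p = card D"
    using degeq by simp
  have plus: "fps_of_poly (lw_num g q m i) / fps_of_poly (lw_den g q m i) = fps_of_poly p / fps_of_poly (\<Prod>b\<in>D. lin b)"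
  proof (rule fps_div_cross)
    show "fps_of_poly (lw_num g q m i) * fps_of_poly (\<Prod>b\<in>D. lin b) = fps_of_poly (lw_den g q m i) * fps_of_poly p"
      by (simp only: fps_of_poly_mult[symmetric] nd)
    have "poly (\<Prod>b\<in>D. lin b) 0 = 1"
      by (simp add: poly_prod poly_lin)
    then show "fps_nth (fps_of_poly (\<Prod>b\<in>D. lin b)) 0 \<noteq> 0"
      by (simp add: poly_0_coeff_0)
  qed (use den0 in simp)
  have minus: "fps_of_poly (reflect_poly (lw_num g q m i)) / fps_of_poly (reflect_poly (lw_den g q m i))
     = fps_of_poly (reflect_poly p) / fps_of_poly (reflect_poly (\<Prod>b\<in>D. lin b))"
  proof (rule fps_div_cross)
    show "fps_of_poly (reflect_poly (lw_num g q m i)) * fps_of_poly (reflect_poly (\<Prod>b\<in>D. lin b))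
       = fps_of_poly (reflect_poly (lw_den g q m i)) * fps_of_poly (reflect_poly p)"
      by (simp only: fps_of_poly_mult[symmetric] reflect_poly_mult[symmetric] nd)
    show "fps_nth (fps_of_poly (reflect_poly (\<Prod>b\<in>D. lin b))) 0 \<noteq> 0"
      using P0 by (simp add: coeff_reflect_poly)
  qed (use den0 in simp)
  have res: "?k * (poly p (1 / b) / (\<Prod>b'\<in>D - {b}. 1 - b' / b)) = l_res g q i b m" if b: "b \<in> D" for b
  proof -
    \<comment> \<open>The cancellation identity is now applied to values at 1/b. Replacing the zero
      at \<open>b\<close> by 1 does not disturb the value of \<open>p\<close>, because
      \<open>p\<close> does not contain the factor \<open>lin b\<close>.\<close>
    define f where "f = (\<lambda>b'. nz (1 - b' / b))"
    have f0: "f c \<noteq> 0" for c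
      by (simp add: f_def)
    have b0: "b \<noteq> 0" "pole_ord g q i b m = 1"
      using b D0 by (auto simp: D_def)
    have f1: "f b' = 1 - b' / b" if "b' \<noteq> b" for b'
      using that b0 by (simp add: f_def nz_def)
    have fb: "f b = 1"
      using b0 by (simp add: f_def nz_def)
    define num where "num = (\<Prod>c\<in>msupp i m. f (c * q powi (- ?r)) ^ nat (?y c) * f (c * q powi ?r) ^ nat (- ?y c))"
    define den where "den = (\<Prod>c\<in>msupp i m. f (c * q powi ?r) ^ nat (?y c) * f (c * q powi (- ?r)) ^ nat (- ?y c))"
    have den: "den \<noteq> 0"
      by (simp add: den_def f0)
    have "l_res g q i b m = (\<Prod>c\<in>msupp i m. (q powi ?r) powi ?y c * ((f (c * q powi (- ?r)) ^ nat (?y c) * f (c * q powi ?r) ^ nat (- ?y c))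
       / (f (c * q powi ?r) ^ nat (?y c) * f (c * q powi (- ?r)) ^ nat (- ?y c))))"
      unfolding l_res_def mprod_def
    proof (intro prod.cong refl)
      fix c
      have "res_fac q ?r b c = q powi ?r * (f (c * q powi (- ?r)) / f (c * q powi ?r))"
        by (simp add: res_fac_def f_def)
      moreover have "(f (c * q powi (- ?r)) / f (c * q powi ?r)) powi ?y c
        = (f (c * q powi (- ?r)) ^ nat (?y c) * f (c * q powi ?r) ^ nat (- ?y c))
       / (f (c * q powi ?r) ^ nat (?y c) * f (c * q powi (- ?r)) ^ nat (- ?y c))"
        by (cases "?y c \<ge> 0") (simp_all add: power_int_def power_divide)
      ultimately show "res_fac q ?r b c powi ?y c = (q powi ?r) powi ?y c * ((f (c * q powi (- ?r)) ^ nat (?y c) * f (c * q powi ?r) ^ nat (- ?y c))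
       / (f (c * q powi ?r) ^ nat (?y c) * f (c * q powi (- ?r)) ^ nat (- ?y c)))"
        by (simp only: power_int_mult_distrib)
    qed
    also have "\<dots> = ?k * (num / den)"
      by (simp add: prod.distrib prod_dividef k_eig_def mprod_def num_def den_def)
    finally have l: "l_res g q i b m = ?k * (num / den)" .
    have "num * prod f D = den * (\<Prod>b\<in>K'. f b ^ nat (- pole_ord g q i b m))"
      unfolding num_def den_def by (rule cancel)
    moreover have "prod f D = (\<Prod>b'\<in>D - {b}. 1 - b' / b)"
      using finD b f1 fb by (subst prod.remove[of _ b]) auto
    moreover have "(\<Prod>b'\<in>K'. f b' ^ nat (- pole_ord g q i b' m)) = poly p (1 / b)"
      unfolding p_def poly_prod
    proof (intro prod.cong refl)
      fix b' assume "b' \<in> K'"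
      show "f b' ^ nat (- pole_ord g q i b' m) = poly (lin b' ^ nat (- pole_ord g q i b' m)) (1 / b)"
        using f1[of b'] b0 by (cases "b' = b") (simp_all add: poly_lin poly_power)
    qed
    ultimately have "num * (\<Prod>b'\<in>D - {b}. 1 - b' / b) = den * poly p (1 / b)"
      by simp
    moreover have "(\<Prod>b'\<in>D - {b}. 1 - b' / b) \<noteq> 0"
      using finD b0 by auto
    ultimately show ?thesis
      unfolding l using den by (simp add: field_simps)
  qed
  have "(if n \<ge> 0 then fps_nth (l_weight g q m Plus i) (nat n) else 0)
     - (if n \<le> 0 then fps_nth (l_weight g q m Minus i) (nat (- n)) else 0)
     = ?k * ((if n \<ge> 0 then fps_nth (fps_of_poly p / fps_of_poly (\<Prod>b\<in>D. lin b)) (nat n) else 0)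
    - (if n \<le> 0 then fps_nth (fps_of_poly (reflect_poly p) / fps_of_poly (reflect_poly (\<Prod>b\<in>D. lin b))) (nat (- n)) else 0))"
    by (simp only: l_weight.simps lw_const_eq[OF m q] plus minus fps_mult_left_const_nth) (simp add: algebra_simps)
  also have "\<dots> = ?k * (\<Sum>b\<in>D. poly p (1 / b) / (\<Prod>b'\<in>D - {b}. 1 - b' / b) * b powi n)"
    by (simp only: partial_fraction_coeffs[OF finD D0 degp p0])
  also have "\<dots> = (\<Sum>b\<in>D. l_res g q i b m * b powi n)"
    unfolding sum_distrib_left
  proof (intro sum.cong refl)
    fix b assume "b \<in> D"
    then show "?k * (poly p (1 / b) / (\<Prod>b'\<in>D - {b}. 1 - b' / b) * b powi n) = l_res g q i b m * b powi n"
      by (simp only: res[symmetric] mult.assoc)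
  qed
  finally show ?thesis
    by (simp only: D_def)
qed

section \<open>Separating l-weights\<close>

lemma interpolation:
  fixes B :: "complex set"
  assumes "finite B" "b0 \<in> B"
  obtains p where "poly p b0 = 1" "\<And>b. b \<in> B \<Longrightarrow> b \<noteq> b0 \<Longrightarrow> poly p b = 0"
proof
  let ?p = "\<Prod>b\<in>B - {b0}. smult (1 / (b0 - b)) [:- b, 1:]"
  show "poly ?p b0 = 1"
    unfolding poly_prod by (rule prod.neutral) (auto simp flip: diff_divide_distrib)
  show "poly ?p b = 0" if "b \<in> B" "b \<noteq> b0" for b
    using assms(1) that by (auto simp: poly_prod)
qed

text \<open>The Vandermonde argument: combining the power sums with the coefficients of a Lagrange
  polynomial isolates the term at \<open>b\<close>.\<close>

lemma power_sums_zero: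
  fixes B :: "complex set" and z :: "complex \<Rightarrow> complex"
  assumes "finite B" "b \<in> B" "\<And>n. (\<Sum>b\<in>B. z b * b ^ n) = 0"
  shows "z b = 0"
proof -
  obtain p where p: "poly p b = 1" "\<And>b'. b' \<in> B \<Longrightarrow> b' \<noteq> b \<Longrightarrow> poly p b' = 0"
    using interpolation[OF assms(1,2)] by blast
  have "0 = (\<Sum>n\<le>degree p. coeff p n * (\<Sum>b\<in>B. z b * b ^ n))"
    by (simp add: assms(3))
  also have "\<dots> = (\<Sum>n\<le>degree p. \<Sum>b\<in>B. z b * (coeff p n * b ^ n))"
    by (simp add: sum_distrib_left mult_ac)
  also have "\<dots> = (\<Sum>b\<in>B. z b * poly p b)"
    by (subst sum.swap) (simp add: poly_altdef sum_distrib_left)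
  also have "\<dots> = (\<Sum>b'\<in>B. if b' = b then z b else 0)"
    using p by (intro sum.cong) auto
  also have "\<dots> = z b"
    using assms(1,2) by simp
  finally show ?thesis
    by simp
qed

lemma fexp_inj:
  assumes "fps_nth s 0 = 0" "fps_nth t 0 = 0" "fexp s = fexp t"
  shows "s = t"
proof -
  have "fps_deriv s * fexp s = fps_deriv (fexp t)"
    unfolding assms(3)[symmetric] by (rule fexp_deriv[OF assms(1), symmetric])
  then have "fps_deriv s * fexp s = fps_deriv t * fexp s"
    unfolding assms(3) by (simp only: fexp_deriv[OF assms(2)])
  moreover have "fexp s \<noteq> 0"
    using fexp_nth_0[of s] by (metis fps_zero_nth zero_neq_one)
  ultimately have "fps_deriv s = fps_deriv t"
    by (metis mult_right_cancel)
  then show ?thesis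
    using assms(1,2) by (simp add: fps_deriv_eq_iff)
qed

lemma qint_nonzero:
  assumes "q \<noteq> 0" "not_root_of_unity q" "n \<noteq> 0"
  shows "qint q n \<noteq> 0"
  using q_minus_inverse[OF assms] qint_mult_q[OF assms(1,2), of n] by force

text \<open>The logarithms of the series for \<open>Plus\<close> contain the power sums weighted by
  the exponents, up to quantum integers that do not vanish since q is not a root of unity. Power
  sums determine the exponents.\<close>

theorem l_weight_inj:
  assumes q: "q \<noteq> 0" "not_root_of_unity q" and m: "m \<in> monomials g" "m' \<in> monomials g"
    and eq: "\<And>i. i \<in> nodes g \<Longrightarrow> l_weight g q m Plus i = l_weight g q m' Plus i"
  shows "m = m'"
proof (rule poly_mapping_eqI)
  fix ic :: "nat \<times> complex"
  obtain i c where ic: "ic = (i, c)"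
    by (cases ic)
  show "Poly_Mapping.lookup m ic = Poly_Mapping.lookup m' ic"
  proof (cases "i \<in> nodes g \<and> c \<in> msupp i m \<union> msupp i m'")
    case False
    then have "(i, c) \<notin> Poly_Mapping.keys m" "(i, c) \<notin> Poly_Mapping.keys m'"
      using m by (auto simp: monomials_def msupp_def in_keys_iff)
    then show ?thesis
      by (simp add: ic in_keys_iff)
  next
    case True
    let ?K = "msupp i m \<union> msupp i m'"
    have e: "fps_const (k_eig g q i m) * fexp (h_series_val g q Plus i m)
        = fps_const (k_eig g q i m') * fexp (h_series_val g q Plus i m')"
      using eq[OF conjunct1[OF True]]
      by (simp only: l_weight_Plus_eq_exp[OF q m(1)] l_weight_Plus_eq_exp[OF q m(2)])
    from arg_cong[OF e, of "\<lambda>f. fps_nth f 0"] have k: "k_eig g q i m = k_eig g q i m'"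
      by (simp only: fps_mult_left_const_nth fexp_nth_0 mult_1_right)
    have "fps_const (k_eig g q i m') \<noteq> 0"
      using k_eig_nonzero[OF q(1), of g i m'] by simp
    from e[unfolded k mult_left_cancel[OF this]]
    have h: "h_series_val g q Plus i m = h_series_val g q Plus i m'"
      by (rule fexp_inj[OF h_series_val_0 h_series_val_0])
    have "(\<Sum>c\<in>?K. (of_int (Poly_Mapping.lookup m (i, c) - Poly_Mapping.lookup m' (i, c)) * c) * c ^ n) = 0" for n
    proof -
      \<comment> \<open>The logarithm has no coefficient of degree 0, so only the exponents
        \<open>Suc n\<close> are available. The surplus factor \<open>c\<close> is harmless, being
        nonzero.\<close>
      define s where "s = int (Suc n)"
      have s: "s \<noteq> 0" "nat s = Suc n" "s \<ge> 0"
        by (simp_all add: s_def)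
      have "fps_nth (h_series_val g q Plus i m) (Suc n) = (q - inverse q) * h_eig g q i s m" for m
        by (simp add: h_series_val_def s_def)
      then have "(q - inverse q) * h_eig g q i s m = (q - inverse q) * h_eig g q i s m'"
        using h by (metis (no_types))
      moreover have "q - inverse q \<noteq> 0"
        using q_minus_inverse[OF q, of 1] by simp
      ultimately have "h_eig g q i s m = h_eig g q i s m'"
        by (metis mult_left_cancel)
      then have z: "h_eig g q i s (m - m') = 0"
        by (simp add: h_eig_diff)
      let ?z = "qint q (s * symm g i) / of_int s"
      have "h_eig g q i s (m - m') = (\<Sum>c\<in>?K. of_int (Poly_Mapping.lookup (m - m') (i, c))
          * (c powi s * qint q (s * symm g i) / of_int s))"
        unfolding h_eig_def
        by (rule msum_superset, simp) (auto simp: msupp_def lookup_minus)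
      also have "\<dots> = (\<Sum>c\<in>?K. of_int (Poly_Mapping.lookup m (i, c) - Poly_Mapping.lookup m' (i, c)) * c * c ^ n) * ?z"
        unfolding sum_distrib_right
      proof (intro sum.cong refl)
        fix c :: complex
        have "c powi s = c * c ^ n"
          using s by (simp add: power_int_def)
        then show "of_int (Poly_Mapping.lookup (m - m') (i, c)) * (c powi s * qint q (s * symm g i) / of_int s)
          = of_int (Poly_Mapping.lookup m (i, c) - Poly_Mapping.lookup m' (i, c)) * c * c ^ n * ?z"
          by (simp only: lookup_minus times_divide_eq_right mult.assoc)
      qed
      finally have fin: "(\<Sum>c\<in>?K. of_int (Poly_Mapping.lookup m (i, c) - Poly_Mapping.lookup m' (i, c)) * c * c ^ n) * ?z = 0"
        using z by (simp only:)
      have "?z \<noteq> 0"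
        using qint_nonzero[OF q, of "s * symm g i"] symm_pos[of g i] s(1) by simp
      with iffD1[OF mult_eq_0_iff fin] show ?thesis
        by blast
    qed
    from power_sums_zero[OF _ _ this, of c] have "of_int (Poly_Mapping.lookup m (i, c) - Poly_Mapping.lookup m' (i, c)) * c = 0"
      using True by simp
    moreover have "c \<noteq> 0"
      using True msupp_nonzero[OF m(1), of c i] msupp_nonzero[OF m(2), of c i] by blast
    ultimately show ?thesis
      by (simp add: ic)
  qed
qed

section \<open>Thin representations on distributive lattices\<close>

text \<open>Collects what the construction needs from tableaux. Node and spectral parameter of a
  step depend on the box and its letter alone, so the factor between two steps is the same in every
  tableau; closure under minimum and maximum completes squares of steps.\<close>

locale thin_lattice =
  fixes g :: lie_type and q a :: complex
    and X :: "('b \<Rightarrow> int) set" and bot :: "'b \<Rightarrow> int" and P :: "'b set"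
    and par :: "'b \<Rightarrow> int \<Rightarrow> nat \<times> int" and M :: "('b \<Rightarrow> int) \<Rightarrow> monomial"
  assumes valid: "valid_lie_type g"
    and q0: "q \<noteq> 0" and q_nru: "not_root_of_unity q" and a0: "a \<noteq> 0"
    and finite_X: "finite X" and finite_P: "finite P"
    and bot_in: "bot \<in> X"
    and bot_le: "\<And>\<tau> \<beta>. \<tau> \<in> X \<Longrightarrow> bot \<beta> \<le> \<tau> \<beta>"
    and min_in: "\<And>\<sigma> \<tau>. \<sigma> \<in> X \<Longrightarrow> \<tau> \<in> X \<Longrightarrow> (\<lambda>\<beta>. min (\<sigma> \<beta>) (\<tau> \<beta>)) \<in> X"
    and max_in: "\<And>\<sigma> \<tau>. \<sigma> \<in> X \<Longrightarrow> \<tau> \<in> X \<Longrightarrow> (\<lambda>\<beta>. max (\<sigma> \<beta>) (\<tau> \<beta>)) \<in> X"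
    and lowerable: "\<And>\<tau>. \<tau> \<in> X \<Longrightarrow> \<tau> \<noteq> bot \<Longrightarrow> \<exists>\<beta>\<in>P. \<tau>(\<beta> := \<tau> \<beta> - 1) \<in> X"
    and par_node: "\<And>\<tau> \<beta>. \<tau> \<in> X \<Longrightarrow> \<beta> \<in> P \<Longrightarrow> \<tau>(\<beta> := \<tau> \<beta> + 1) \<in> X \<Longrightarrow> fst (par \<beta> (\<tau> \<beta>)) \<in> nodes g"
    and M_step: "\<And>\<tau> \<beta>. \<tau> \<in> X \<Longrightarrow> \<beta> \<in> P \<Longrightarrow> \<tau>(\<beta> := \<tau> \<beta> + 1) \<in> X \<Longrightarrow>
      M (\<tau>(\<beta> := \<tau> \<beta> + 1)) = M \<tau> - A_mon g q a (fst (par \<beta> (\<tau> \<beta>))) (snd (par \<beta> (\<tau> \<beta>)))"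
    and M_monomial: "\<And>\<tau>. \<tau> \<in> X \<Longrightarrow> M \<tau> \<in> monomials g"
    and pole_le: "\<And>\<tau> i b. \<tau> \<in> X \<Longrightarrow> i \<in> nodes g \<Longrightarrow> pole_ord g q i b (M \<tau>) \<le> 1"
    and pole_iff: "\<And>\<tau> i b. \<tau> \<in> X \<Longrightarrow> i \<in> nodes g \<Longrightarrow> pole_ord g q i b (M \<tau>) = 1 \<longleftrightarrow>
      (\<exists>\<beta>\<in>P. \<exists>l. b = a * q powi l \<and> (\<tau>(\<beta> := \<tau> \<beta> + 1) \<in> X \<and> par \<beta> (\<tau> \<beta>) = (i, l)
         \<or> \<tau>(\<beta> := \<tau> \<beta> - 1) \<in> X \<and> par \<beta> (\<tau> \<beta> - 1) = (i, l)))"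
    and out_unique: "\<And>\<tau> \<beta> \<beta>'. \<tau> \<in> X \<Longrightarrow> \<beta> \<in> P \<Longrightarrow> \<beta>' \<in> P \<Longrightarrow> \<tau>(\<beta> := \<tau> \<beta> + 1) \<in> X \<Longrightarrow>
      \<tau>(\<beta>' := \<tau> \<beta>' + 1) \<in> X \<Longrightarrow> par \<beta> (\<tau> \<beta>) = par \<beta>' (\<tau> \<beta>') \<Longrightarrow> \<beta> = \<beta>'"
    and in_unique: "\<And>\<tau> \<beta> \<beta>'. \<tau> \<in> X \<Longrightarrow> \<beta> \<in> P \<Longrightarrow> \<beta>' \<in> P \<Longrightarrow> \<tau>(\<beta> := \<tau> \<beta> - 1) \<in> X \<Longrightarrow>
      \<tau>(\<beta>' := \<tau> \<beta>' - 1) \<in> X \<Longrightarrow> par \<beta> (\<tau> \<beta> - 1) = par \<beta>' (\<tau> \<beta>' - 1) \<Longrightarrow> \<beta> = \<beta>'"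
    and out_in_disjoint: "\<And>\<tau> \<beta> \<beta>'. \<tau> \<in> X \<Longrightarrow> \<beta> \<in> P \<Longrightarrow> \<beta>' \<in> P \<Longrightarrow> \<tau>(\<beta> := \<tau> \<beta> + 1) \<in> X \<Longrightarrow>
      \<tau>(\<beta>' := \<tau> \<beta>' - 1) \<in> X \<Longrightarrow> par \<beta> (\<tau> \<beta>) \<noteq> par \<beta>' (\<tau> \<beta>' - 1)"
begin

definition up :: "('b \<Rightarrow> int) \<Rightarrow> 'b \<Rightarrow> ('b \<Rightarrow> int)" where
  "up \<tau> \<beta> = \<tau>(\<beta> := \<tau> \<beta> + 1)"

definition dn :: "('b \<Rightarrow> int) \<Rightarrow> 'b \<Rightarrow> ('b \<Rightarrow> int)" where
  "dn \<tau> \<beta> = \<tau>(\<beta> := \<tau> \<beta> - 1)"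

definition outs :: "nat \<Rightarrow> ('b \<Rightarrow> int) \<Rightarrow> 'b set" where
  "outs i \<tau> = {\<beta> \<in> P. up \<tau> \<beta> \<in> X \<and> fst (par \<beta> (\<tau> \<beta>)) = i}"

definition ins :: "nat \<Rightarrow> ('b \<Rightarrow> int) \<Rightarrow> 'b set" where
  "ins i \<tau> = {\<beta> \<in> P. dn \<tau> \<beta> \<in> X \<and> fst (par \<beta> (\<tau> \<beta> - 1)) = i}"

definition spec :: "nat \<times> int \<Rightarrow> complex" where
  "spec p = a * q powi snd p"

definition pout :: "('b \<Rightarrow> int) \<Rightarrow> 'b \<Rightarrow> complex" where
  "pout \<tau> \<beta> = spec (par \<beta> (\<tau> \<beta>))"

definition pin :: "('b \<Rightarrow> int) \<Rightarrow> 'b \<Rightarrow> complex" where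
  "pin \<tau> \<beta> = spec (par \<beta> (\<tau> \<beta> - 1))"

text \<open>The factor by which the residue at \<open>p1\<close> changes when a step \<open>p2\<close> is made.\<close>

definition swap :: "nat \<times> int \<Rightarrow> nat \<times> int \<Rightarrow> complex" where
  "swap p1 p2 = inverse (cross q (symm_cartan g (fst p1) (fst p2)) (snd p2 - snd p1))"

text \<open>Only the quotients \<open>sfac p2 p1 / sfac p1 p2\<close> matter; they have to equal \<open>swap p1 p2\<close>.\<close>

definition sfac :: "nat \<times> int \<Rightarrow> nat \<times> int \<Rightarrow> complex" where
  "sfac p2 p1 = (if fst p2 < fst p1 \<or> fst p2 = fst p1 \<and> snd p2 < snd p1 then swap p1 p2 else 1)"

text \<open>One factor for each step that leads from \<open>bot\<close> to \<open>\<tau>\<close>.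
  The product runs over the set of pairs of a box and a letter passed by it, so it does not depend
  on the order in which the steps are made.\<close>

definition cm :: "('b \<Rightarrow> int) \<Rightarrow> 'b \<Rightarrow> complex" where
  "cm \<tau> \<beta> = (\<Prod>\<beta>'\<in>P. \<Prod>x\<in>{bot \<beta>'..<\<tau> \<beta>'}. sfac (par \<beta>' x) (par \<beta> (\<tau> \<beta>)))"

definition qden :: "nat \<Rightarrow> complex" where
  "qden i = q powi symm g i - q powi (- symm g i)"

definition cp :: "('b \<Rightarrow> int) \<Rightarrow> 'b \<Rightarrow> complex" where
  "cp \<tau> \<beta> = l_res g q (fst (par \<beta> (\<tau> \<beta>))) (pout \<tau> \<beta>) (M \<tau>) / qden (fst (par \<beta> (\<tau> \<beta>))) / cm \<tau> \<beta>"

text \<open>The operators act on coefficient functions, so the value at \<open>\<tau>\<close> is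
  collected from the tableaux one step below. For this reason \<open>wm\<close>, which raises boxes,
  is written with \<open>ins\<close> and \<open>dn\<close>.\<close>

definition wm :: "nat \<Rightarrow> int \<Rightarrow> (('b \<Rightarrow> int) \<Rightarrow> complex) \<Rightarrow> (('b \<Rightarrow> int) \<Rightarrow> complex)" where
  "wm i n w \<tau> = (if \<tau> \<in> X then \<Sum>\<beta>\<in>ins i \<tau>. cm (dn \<tau> \<beta>) \<beta> * pin \<tau> \<beta> powi n * w (dn \<tau> \<beta>) else 0)"

definition wp :: "nat \<Rightarrow> int \<Rightarrow> (('b \<Rightarrow> int) \<Rightarrow> complex) \<Rightarrow> (('b \<Rightarrow> int) \<Rightarrow> complex)" where
  "wp i n w \<tau> = (if \<tau> \<in> X then \<Sum>\<beta>\<in>outs i \<tau>. cp \<tau> \<beta> * pout \<tau> \<beta> powi n * w (up \<tau> \<beta>) else 0)"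

lemma finite_outs [simp]: "finite (outs i \<tau>)" and finite_ins [simp]: "finite (ins i \<tau>)"
  using finite_P by (auto simp: outs_def ins_def)

lemma up_dn [simp]: "up (dn \<tau> \<beta>) \<beta> = \<tau>" and dn_up [simp]: "dn (up \<tau> \<beta>) \<beta> = \<tau>"
  by (auto simp: up_def dn_def)

lemma up_same [simp]: "up \<tau> \<beta> \<beta> = \<tau> \<beta> + 1" and dn_same [simp]: "dn \<tau> \<beta> \<beta> = \<tau> \<beta> - 1"
  by (auto simp: up_def dn_def)

lemma up_other [simp]: "\<beta>' \<noteq> \<beta> \<Longrightarrow> up \<tau> \<beta> \<beta>' = \<tau> \<beta>'"
  and dn_other [simp]: "\<beta>' \<noteq> \<beta> \<Longrightarrow> dn \<tau> \<beta> \<beta>' = \<tau> \<beta>'"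
  by (auto simp: up_def dn_def)

lemma pin_up [simp]: "pin (up \<tau> \<beta>) \<beta> = pout \<tau> \<beta>" and pout_dn [simp]: "pout (dn \<tau> \<beta>) \<beta> = pin \<tau> \<beta>"
  by (auto simp: pin_def pout_def)

lemma spec_nonzero [simp]: "spec p \<noteq> 0"
  using a0 q0 by (simp add: spec_def)

lemma pout_nonzero [simp]: "pout \<tau> \<beta> \<noteq> 0" and pin_nonzero [simp]: "pin \<tau> \<beta> \<noteq> 0"
  by (simp_all add: pout_def pin_def)

lemma qden_nonzero [simp]: "qden i \<noteq> 0"
  using q_minus_inverse[OF q0 q_nru, of "symm g i"] symm_pos[of g i] by (simp add: qden_def)

lemma sfac_nonzero [simp]: "sfac p2 p1 \<noteq> 0"
  using q0 by (simp add: sfac_def swap_def cross_nonzero)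

lemma cm_nonzero [simp]: "cm \<tau> \<beta> \<noteq> 0"
  by (simp add: cm_def finite_P)

lemma cp_nonzero [simp]: "cp \<tau> \<beta> \<noteq> 0"
  using q0 by (simp add: cp_def l_res_nonzero)

lemma M_up:
  assumes "\<tau> \<in> X" "\<beta> \<in> P" "up \<tau> \<beta> \<in> X" "par \<beta> (\<tau> \<beta>) = (i, l)"
  shows "M (up \<tau> \<beta>) = M \<tau> - A_mon g q a i l" "i \<in> nodes g"
  using M_step[of \<tau> \<beta>] par_node[of \<tau> \<beta>] assms by (simp_all add: up_def)

lemma outs_node: "\<tau> \<in> X \<Longrightarrow> \<beta> \<in> outs i \<tau> \<Longrightarrow> i \<in> nodes g"
  using par_node[of \<tau> \<beta>] by (auto simp: outs_def up_def)

lemma ins_outs: "\<beta> \<in> ins i \<tau> \<Longrightarrow> \<tau> \<in> X \<Longrightarrow> dn \<tau> \<beta> \<in> X \<and> \<beta> \<in> outs i (dn \<tau> \<beta>)"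
  by (auto simp: ins_def outs_def)

lemma outs_ins: "\<beta> \<in> outs i \<tau> \<Longrightarrow> \<tau> \<in> X \<Longrightarrow> up \<tau> \<beta> \<in> X \<and> \<beta> \<in> ins i (up \<tau> \<beta>)"
  by (auto simp: ins_def outs_def)

lemma outs_par: "\<beta> \<in> outs i \<tau> \<Longrightarrow> par \<beta> (\<tau> \<beta>) = (i, snd (par \<beta> (\<tau> \<beta>)))"
  by (auto simp: outs_def prod_eq_iff)

lemma outs_M_up:
  assumes "\<tau> \<in> X" "\<beta> \<in> outs i \<tau>"
  shows "M (up \<tau> \<beta>) = M \<tau> - A_mon g q a i (snd (par \<beta> (\<tau> \<beta>)))"
  using M_up(1)[OF assms(1) _ _ outs_par[OF assms(2)]] assms(2) by (auto simp: outs_def)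

lemma spec_inj: "spec p = spec p' \<longleftrightarrow> snd p = snd p'"
  using a_powi_inj[OF q0 q_nru a0] by (simp add: spec_def)

lemma pout_inj: "\<tau> \<in> X \<Longrightarrow> \<beta> \<in> outs i \<tau> \<Longrightarrow> \<beta>' \<in> outs i \<tau> \<Longrightarrow> pout \<tau> \<beta> = pout \<tau> \<beta>' \<Longrightarrow> \<beta> = \<beta>'"
  using out_unique[of \<tau> \<beta> \<beta>'] by (auto simp: outs_def up_def pout_def spec_inj prod_eq_iff)

lemma pin_inj: "\<tau> \<in> X \<Longrightarrow> \<beta> \<in> ins i \<tau> \<Longrightarrow> \<beta>' \<in> ins i \<tau> \<Longrightarrow> pin \<tau> \<beta> = pin \<tau> \<beta>' \<Longrightarrow> \<beta> = \<beta>'"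
  using in_unique[of \<tau> \<beta> \<beta>'] by (auto simp: ins_def dn_def pin_def spec_inj prod_eq_iff)

lemma pout_neq_pin: "\<tau> \<in> X \<Longrightarrow> \<beta> \<in> outs i \<tau> \<Longrightarrow> \<beta>' \<in> ins i \<tau> \<Longrightarrow> pout \<tau> \<beta> \<noteq> pin \<tau> \<beta>'"
  using out_in_disjoint[of \<tau> \<beta> \<beta>'] by (auto simp: outs_def ins_def up_def dn_def pin_def pout_def spec_inj prod_eq_iff)

lemma poles_eq:
  assumes "\<tau> \<in> X" "i \<in> nodes g"
  shows "{b. pole_ord g q i b (M \<tau>) = 1} = pout \<tau> ` outs i \<tau> \<union> pin \<tau> ` ins i \<tau>"
proof -
  have "pole_ord g q i b (M \<tau>) = 1 \<longleftrightarrow> b \<in> pout \<tau> ` outs i \<tau> \<union> pin \<tau> ` ins i \<tau>" for b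
    unfolding pole_iff[OF assms] outs_def ins_def up_def dn_def pout_def pin_def spec_def image_iff Un_iff
    by (auto simp: prod_eq_iff)
  then show ?thesis
    by blast
qed

lemma pole_out: "\<tau> \<in> X \<Longrightarrow> \<beta> \<in> outs i \<tau> \<Longrightarrow> pole_ord g q i (pout \<tau> \<beta>) (M \<tau>) = 1"
  using poles_eq[of \<tau> i] outs_node by blast

lemma l_res_up:
  assumes "\<tau> \<in> X" "\<beta> \<in> outs i \<tau>"
  shows "l_res g q i (pout \<tau> \<beta>) (M (up \<tau> \<beta>)) = - l_res g q i (pout \<tau> \<beta>) (M \<tau>)"
proof -
  have i: "i \<in> nodes g"
    using outs_node assms by blast
  have "l_res g q i (pout \<tau> \<beta>) (A_mon g q a i (snd (par \<beta> (\<tau> \<beta>)))) = cross q (symm_cartan g i i) 0"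
    unfolding pout_def spec_def by (subst l_res_A_mon) (simp_all add: valid q0 a0 i)
  also have "\<dots> = -1"
  proof (rule cross_same[OF q0 q_nru])
    have "cartan g i i = 2"
      by (cases g) auto
    then show "symm_cartan g i i \<noteq> 0"
      using symm_pos[of g i] by (simp add: symm_cartan_def)
  qed
  finally show ?thesis
    unfolding outs_M_up[OF assms] by (simp add: l_res_diff q0)
qed

text \<open>At the pole of a backward step the residue is expressed through the tableau before that
  step, which reverses its sign. Up to the factor \<open>qden i\<close>, the two sums are then the
  diagonal parts of the two products of operators.\<close>

lemma sum_residues:
  assumes "\<tau> \<in> X" "i \<in> nodes g"
  shows "(\<Sum>b | pole_ord g q i b (M \<tau>) = 1. l_res g q i b (M \<tau>) * b powi n) =
    (\<Sum>\<beta>\<in>outs i \<tau>. l_res g q i (pout \<tau> \<beta>) (M \<tau>) * pout \<tau> \<beta> powi n)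
    - (\<Sum>\<beta>\<in>ins i \<tau>. l_res g q i (pin \<tau> \<beta>) (M (dn \<tau> \<beta>)) * pin \<tau> \<beta> powi n)"
proof -
  have "(\<Sum>b | pole_ord g q i b (M \<tau>) = 1. l_res g q i b (M \<tau>) * b powi n)
    = (\<Sum>b\<in>pout \<tau> ` outs i \<tau>. l_res g q i b (M \<tau>) * b powi n) + (\<Sum>b\<in>pin \<tau> ` ins i \<tau>. l_res g q i b (M \<tau>) * b powi n)"
    unfolding poles_eq[OF assms] using pout_neq_pin[OF assms(1), of _ i]
    by (intro sum.union_disjoint finite_imageI finite_outs finite_ins) blast
  also have "(\<Sum>b\<in>pout \<tau> ` outs i \<tau>. l_res g q i b (M \<tau>) * b powi n)
    = (\<Sum>\<beta>\<in>outs i \<tau>. l_res g q i (pout \<tau> \<beta>) (M \<tau>) * pout \<tau> \<beta> powi n)"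
    using pout_inj[OF assms(1)] by (subst sum.reindex) (auto simp: inj_on_def)
  also have "(\<Sum>b\<in>pin \<tau> ` ins i \<tau>. l_res g q i b (M \<tau>) * b powi n)
    = (\<Sum>\<beta>\<in>ins i \<tau>. l_res g q i (pin \<tau> \<beta>) (M \<tau>) * pin \<tau> \<beta> powi n)"
    using pin_inj[OF assms(1)] by (subst sum.reindex) (auto simp: inj_on_def)
  also have "\<dots> = (\<Sum>\<beta>\<in>ins i \<tau>. - (l_res g q i (pin \<tau> \<beta>) (M (dn \<tau> \<beta>)) * pin \<tau> \<beta> powi n))"
  proof (intro sum.cong refl)
    fix \<beta> assume "\<beta> \<in> ins i \<tau>"
    from ins_outs[OF this assms(1)] l_res_up[of "dn \<tau> \<beta>" \<beta> i]
    show "l_res g q i (pin \<tau> \<beta>) (M \<tau>) * pin \<tau> \<beta> powi n = - (l_res g q i (pin \<tau> \<beta>) (M (dn \<tau> \<beta>)) * pin \<tau> \<beta> powi n)"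
      by simp
  qed
  finally show ?thesis
    by (simp add: sum_negf)
qed

section \<open>Compatibility of the constants around squares of steps\<close>

lemma swap_inverse:
  assumes "fst p1 \<in> nodes g" "fst p2 \<in> nodes g" "pole_ord g q (fst p1) (spec p1) (A_mon g q a (fst p2) (snd p2)) = 0"
  shows "swap p1 p2 * swap p2 p1 = 1"
proof -
  let ?B = "symm_cartan g (fst p1) (fst p2)" and ?d = "snd p2 - snd p1"
  have "(?d \<noteq> ?B \<and> ?d \<noteq> - ?B) \<or> ?B = 0"
    using assms(3) unfolding spec_def pole_ord_A_mon[OF valid q0 q_nru a0 assms(1,2)] by (auto split: if_splits)
  from cross_inverse[OF q0 q_nru this] show ?thesis
    by (simp add: swap_def symm_cartan_sym[OF assms(2,1)] flip: inverse_mult_distrib)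
qed

lemma sfac_swap:
  assumes "p1 \<noteq> p2" "swap p1 p2 * swap p2 p1 = 1"
  shows "sfac p2 p1 = swap p1 p2 * sfac p1 p2"
  using assms by (cases p1; cases p2) (auto simp: sfac_def mult.commute)

lemma cm_up:
  assumes "\<beta>' \<noteq> \<beta>" "\<beta>' \<in> P" "\<sigma> \<in> X"
  shows "cm (up \<sigma> \<beta>') \<beta> = cm \<sigma> \<beta> * sfac (par \<beta>' (\<sigma> \<beta>')) (par \<beta> (\<sigma> \<beta>))"
proof -
  let ?s = "\<lambda>\<beta>' x. sfac (par \<beta>' x) (par \<beta> (\<sigma> \<beta>))"
  have "{bot \<beta>'..<\<sigma> \<beta>' + 1} = insert (\<sigma> \<beta>') {bot \<beta>'..<\<sigma> \<beta>'}"
    using bot_le[OF assms(3), of \<beta>'] by auto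
  then have "(\<Prod>x\<in>{bot \<beta>'..<\<sigma> \<beta>' + 1}. ?s \<beta>' x) = (\<Prod>x\<in>{bot \<beta>'..<\<sigma> \<beta>'}. ?s \<beta>' x) * ?s \<beta>' (\<sigma> \<beta>')"
    by (simp add: mult.commute)
  moreover have "(\<Prod>\<beta>''\<in>P - {\<beta>'}. \<Prod>x\<in>{bot \<beta>''..<up \<sigma> \<beta>' \<beta>''}. ?s \<beta>'' x) = (\<Prod>\<beta>''\<in>P - {\<beta>'}. \<Prod>x\<in>{bot \<beta>''..<\<sigma> \<beta>''}. ?s \<beta>'' x)"
    by (intro prod.cong) auto
  ultimately show ?thesis
    using assms unfolding cm_def
    by (simp add: prod.remove[OF finite_P assms(2)] mult_ac)
qed

text \<open>\<open>\<beta>\<close> can be raised before and after \<open>\<beta>'\<close>, so the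
  pole at \<open>p\<close> is simple both times and the step \<open>p'\<close> leaves its order
  unchanged. Hence \<open>swap p p'\<close> and \<open>swap p' p\<close> are inverse to each other,
  and the factors \<open>sfac\<close> absorb the change of the residue.\<close>

lemma square:
  assumes "\<sigma> \<in> X" "\<beta> \<noteq> \<beta>'" "\<beta> \<in> outs i \<sigma>" "\<beta>' \<in> outs j \<sigma>" "up (up \<sigma> \<beta>) \<beta>' \<in> X"
  shows "cp (up \<sigma> \<beta>') \<beta> * cm (up \<sigma> \<beta>) \<beta>' = cm \<sigma> \<beta>' * cp \<sigma> \<beta>"
proof -
  define p p' where "p = par \<beta> (\<sigma> \<beta>)" and "p' = par \<beta>' (\<sigma> \<beta>')"
  have P: "\<beta> \<in> P" "\<beta>' \<in> P" and X: "up \<sigma> \<beta> \<in> X" "up \<sigma> \<beta>' \<in> X" and f: "fst p = i" "fst p' = j"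
    using assms by (auto simp: outs_def p_def p'_def)
  have ij: "i \<in> nodes g" "j \<in> nodes g"
    using outs_node assms by blast+
  have comm: "up (up \<sigma> \<beta>') \<beta> = up (up \<sigma> \<beta>) \<beta>'"
    using assms(2) by (auto simp: up_def fun_upd_twist)
  have out': "\<beta> \<in> outs i (up \<sigma> \<beta>')"
    using assms comm P by (auto simp: outs_def)
  have b: "pout (up \<sigma> \<beta>') \<beta> = spec p" "pout \<sigma> \<beta> = spec p"
    using assms(2) by (simp_all add: pout_def p_def)
  have M': "M (up \<sigma> \<beta>') = M \<sigma> - A_mon g q a j (snd p')"
    using outs_M_up[OF assms(1,4)] by (simp add: p'_def)
  have "pole_ord g q i (spec p) (M \<sigma>) = 1" "pole_ord g q i (spec p) (M (up \<sigma> \<beta>')) = 1"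
    using pole_out[OF assms(1,3)] pole_out[OF X(2) out'] b by simp_all
  then have "pole_ord g q i (spec p) (A_mon g q a j (snd p')) = 0"
    by (simp add: M' pole_ord_diff)
  then have sw: "swap p p' * swap p' p = 1"
    using swap_inverse[of p p'] ij f by simp
  have "p \<noteq> p'"
    using out_unique[OF assms(1) P] X assms(2) by (auto simp: p_def p'_def up_def)
  from sfac_swap[OF this sw] have s: "sfac p' p = swap p p' * sfac p p'" .
  have l: "l_res g q i (spec p) (M (up \<sigma> \<beta>')) = l_res g q i (spec p) (M \<sigma>) * swap p p'"
    unfolding M' l_res_diff[OF q0] using l_res_A_mon[OF valid q0 a0 ij] f
    by (simp add: spec_def swap_def divide_inverse)
  have c1: "cm (up \<sigma> \<beta>') \<beta> = cm \<sigma> \<beta> * sfac p' p"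
    unfolding p_def p'_def using assms P by (intro cm_up) auto
  have c2: "cm (up \<sigma> \<beta>) \<beta>' = cm \<sigma> \<beta>' * sfac p p'"
    unfolding p_def p'_def using assms P by (intro cm_up) auto
  have e: "cp (up \<sigma> \<beta>') \<beta> = l_res g q i (spec p) (M \<sigma>) * swap p p' / qden i / (cm \<sigma> \<beta> * (swap p p' * sfac p p'))"
    unfolding cp_def b using assms(2) by (simp add: p_def[symmetric] f l c1 s)
  have e': "cp \<sigma> \<beta> = l_res g q i (spec p) (M \<sigma>) / qden i / cm \<sigma> \<beta>"
    unfolding cp_def b by (simp add: p_def[symmetric] f)
  have "swap p p' \<noteq> 0"
    using sw by auto
  then show ?thesis
    unfolding e e' c2 by (simp add: field_simps)
qed

text \<open>The minimum of two opposite corners of a square of steps is its lowest corner; dually,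
  \<open>exchange_up\<close> obtains the highest one as a maximum.\<close>

lemma exchange_down:
  assumes "\<tau> \<in> X" "\<beta> \<noteq> \<beta>'" "up \<tau> \<beta> \<in> X" "dn (up \<tau> \<beta>) \<beta>' \<in> X"
  shows "dn \<tau> \<beta>' \<in> X"
proof -
  have "(\<lambda>x. min (\<tau> x) (dn (up \<tau> \<beta>) \<beta>' x)) = dn \<tau> \<beta>'"
    using assms(2) by (auto simp: up_def dn_def)
  then show ?thesis
    using min_in[OF assms(1,4)] by simp
qed

lemma exchange_up:
  assumes "\<tau> \<in> X" "\<beta> \<noteq> \<beta>'" "dn \<tau> \<beta>' \<in> X" "up (dn \<tau> \<beta>') \<beta> \<in> X"
  shows "up \<tau> \<beta> \<in> X"
proof -
  have "(\<lambda>x. max (\<tau> x) (up (dn \<tau> \<beta>') \<beta> x)) = up \<tau> \<beta>"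
    using assms(2) by (auto simp: up_def dn_def)
  then show ?thesis
    using max_in[OF assms(1,4)] by simp
qed

lemma up_dn_commute: "\<beta> \<noteq> \<beta>' \<Longrightarrow> dn (up \<tau> \<beta>) \<beta>' = up (dn \<tau> \<beta>') \<beta>"
  by (auto simp: up_def dn_def fun_upd_twist)

text \<open>Both products are sums over pairs of boxes. Pairs of distinct boxes occur in both by the
  exchange lemmas and cancel by \<open>square\<close>; pairs of equal boxes leave the
  residues.\<close>

theorem wp_wm_commutator:
  assumes \<tau>: "\<tau> \<in> X" and ij: "i \<in> nodes g" "j \<in> nodes g"
  shows "wp i n (wm j m w) \<tau> - wm j m (wp i n w) \<tau> =
    (if i = j then (\<Sum>b | pole_ord g q i b (M \<tau>) = 1. l_res g q i b (M \<tau>) * b powi (n + m)) / qden i * w \<tau> else 0)"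
proof -
  define F where "F = (\<lambda>\<beta> \<beta>'. cp \<tau> \<beta> * pout \<tau> \<beta> powi n * (cm (dn (up \<tau> \<beta>) \<beta>') \<beta>' * pin (up \<tau> \<beta>) \<beta>' powi m * w (dn (up \<tau> \<beta>) \<beta>')))"
  define G where "G = (\<lambda>\<beta> \<beta>'. cm (dn \<tau> \<beta>') \<beta>' * pin \<tau> \<beta>' powi m * (cp (dn \<tau> \<beta>') \<beta> * pout (dn \<tau> \<beta>') \<beta> powi n * w (up (dn \<tau> \<beta>') \<beta>)))"
  define S1 where "S1 = (SIGMA \<beta>:outs i \<tau>. ins j (up \<tau> \<beta>))"
  \<comment> \<open>The components are interchanged so that in both index sets the first box belongs
    to \<open>wp\<close> and the second to \<open>wm\<close>.\<close>
  define S2 where "S2 = prod.swap ` (SIGMA \<beta>':ins j \<tau>. outs i (dn \<tau> \<beta>'))"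
  let ?D = "{(\<beta>, \<beta>'). \<beta> = \<beta>'}"
  have fin: "finite S1" "finite S2"
    by (auto simp: S1_def S2_def)
  have L: "wp i n (wm j m w) \<tau> = (\<Sum>(\<beta>, \<beta>')\<in>S1. F \<beta> \<beta>')"
  proof -
    have "wp i n (wm j m w) \<tau> = (\<Sum>\<beta>\<in>outs i \<tau>. \<Sum>\<beta>'\<in>ins j (up \<tau> \<beta>). F \<beta> \<beta>')"
      using \<tau> outs_ins by (simp add: wp_def wm_def F_def sum_distrib_left)
    then show ?thesis
      by (simp add: S1_def sum.Sigma)
  qed
  have R: "wm j m (wp i n w) \<tau> = (\<Sum>(\<beta>, \<beta>')\<in>S2. G \<beta> \<beta>')"
  proof -
    have "wm j m (wp i n w) \<tau> = (\<Sum>\<beta>'\<in>ins j \<tau>. \<Sum>\<beta>\<in>outs i (dn \<tau> \<beta>'). G \<beta> \<beta>')"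
      using \<tau> ins_outs by (simp add: wp_def wm_def G_def sum_distrib_left)
    also have "\<dots> = (\<Sum>(\<beta>', \<beta>)\<in>(SIGMA \<beta>':ins j \<tau>. outs i (dn \<tau> \<beta>')). G \<beta> \<beta>')"
      by (simp add: sum.Sigma)
    also have "\<dots> = (\<Sum>(\<beta>, \<beta>')\<in>S2. G \<beta> \<beta>')"
      unfolding S2_def by (subst sum.reindex) (auto simp: case_prod_unfold)
    finally show ?thesis .
  qed
  have sets: "S1 - ?D = S2 - ?D"
  proof (rule set_eqI)
    fix x :: "'b \<times> 'b"
    obtain \<beta> \<beta>' where x: "x = (\<beta>, \<beta>')"
      by (cases x)
    show "x \<in> S1 - ?D \<longleftrightarrow> x \<in> S2 - ?D"
    proof (cases "\<beta> = \<beta>'")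
      case False
      have "\<beta> \<in> outs i \<tau> \<and> \<beta>' \<in> ins j (up \<tau> \<beta>) \<longleftrightarrow> \<beta>' \<in> ins j \<tau> \<and> \<beta> \<in> outs i (dn \<tau> \<beta>')"
        using exchange_down[OF \<tau> False] exchange_up[OF \<tau> False] False \<tau> up_dn_commute[OF False, of \<tau>]
        by (auto simp: outs_def ins_def)
      then show ?thesis
        using False by (auto simp: x S1_def S2_def)
    qed (simp add: x)
  qed
  have FG: "F \<beta> \<beta>' = G \<beta> \<beta>'" if "(\<beta>, \<beta>') \<in> S1 - ?D" for \<beta> \<beta>'
  proof -
    have ne: "\<beta> \<noteq> \<beta>'" and o: "\<beta> \<in> outs i \<tau>" "\<beta>' \<in> ins j (up \<tau> \<beta>)"
      using that by (auto simp: S1_def)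
    have "(\<beta>, \<beta>') \<in> S2"
      using that sets by auto
    then have o': "\<beta>' \<in> ins j \<tau>" "\<beta> \<in> outs i (dn \<tau> \<beta>')"
      by (auto simp: S2_def)
    have "cp (up (dn \<tau> \<beta>') \<beta>') \<beta> * cm (up (dn \<tau> \<beta>') \<beta>) \<beta>' = cm (dn \<tau> \<beta>') \<beta>' * cp (dn \<tau> \<beta>') \<beta>"
    proof (rule square[OF _ ne o'(2)])
      show "dn \<tau> \<beta>' \<in> X" "\<beta>' \<in> outs j (dn \<tau> \<beta>')"
        using ins_outs[OF o'(1) \<tau>] by auto
      show "up (up (dn \<tau> \<beta>') \<beta>) \<beta>' \<in> X"
        using o(1) up_dn_commute[OF ne, of \<tau>] by (metis (no_types, lifting) outs_def mem_Collect_eq up_dn)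
    qed
    then have "cp \<tau> \<beta> * cm (dn (up \<tau> \<beta>) \<beta>') \<beta>' = cm (dn \<tau> \<beta>') \<beta>' * cp (dn \<tau> \<beta>') \<beta>"
      using up_dn_commute[OF ne, of \<tau>] by simp
    moreover have "pin (up \<tau> \<beta>) \<beta>' = pin \<tau> \<beta>'" "pout (dn \<tau> \<beta>') \<beta> = pout \<tau> \<beta>"
      using ne by (simp_all add: pin_def pout_def)
    ultimately show ?thesis
      unfolding F_def G_def up_dn_commute[OF ne] by (simp add: mult_ac)
  qed
  have "(\<Sum>(\<beta>, \<beta>')\<in>S1. F \<beta> \<beta>') = (\<Sum>(\<beta>, \<beta>')\<in>S1 - ?D. F \<beta> \<beta>') + (\<Sum>(\<beta>, \<beta>')\<in>S1 \<inter> ?D. F \<beta> \<beta>')"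
    using fin by (subst sum.Int_Diff[of _ _ ?D]) (simp_all add: add.commute)
  moreover have "(\<Sum>(\<beta>, \<beta>')\<in>S2. G \<beta> \<beta>') = (\<Sum>(\<beta>, \<beta>')\<in>S2 - ?D. G \<beta> \<beta>') + (\<Sum>(\<beta>, \<beta>')\<in>S2 \<inter> ?D. G \<beta> \<beta>')"
    using fin by (subst sum.Int_Diff[of _ _ ?D]) (simp_all add: add.commute)
  moreover have "(\<Sum>(\<beta>, \<beta>')\<in>S1 - ?D. F \<beta> \<beta>') = (\<Sum>(\<beta>, \<beta>')\<in>S2 - ?D. G \<beta> \<beta>')"
    unfolding sets[symmetric] using FG by (intro sum.cong) auto
  moreover have "(\<Sum>(\<beta>, \<beta>')\<in>S1 \<inter> ?D. F \<beta> \<beta>')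
    = (if i = j then \<Sum>\<beta>\<in>outs i \<tau>. l_res g q i (pout \<tau> \<beta>) (M \<tau>) * pout \<tau> \<beta> powi (n + m) / qden i * w \<tau> else 0)"
  proof (cases "i = j")
    case True
    have "S1 \<inter> ?D = (\<lambda>\<beta>. (\<beta>, \<beta>)) ` outs i \<tau>"
      using outs_ins \<tau> True by (auto simp: S1_def)
    then have "(\<Sum>(\<beta>, \<beta>')\<in>S1 \<inter> ?D. F \<beta> \<beta>') = (\<Sum>\<beta>\<in>outs i \<tau>. F \<beta> \<beta>)"
      by (simp add: sum.reindex inj_on_def)
    also have "\<dots> = (\<Sum>\<beta>\<in>outs i \<tau>. l_res g q i (pout \<tau> \<beta>) (M \<tau>) * pout \<tau> \<beta> powi (n + m) / qden i * w \<tau>)"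
    proof (intro sum.cong refl)
      fix \<beta> assume "\<beta> \<in> outs i \<tau>"
      then have "fst (par \<beta> (\<tau> \<beta>)) = i"
        by (simp add: outs_def)
      then show "F \<beta> \<beta> = l_res g q i (pout \<tau> \<beta>) (M \<tau>) * pout \<tau> \<beta> powi (n + m) / qden i * w \<tau>"
        by (simp add: F_def cp_def power_int_add)
    qed
    finally show ?thesis
      using True by simp
  next
    case False
    have "S1 \<inter> ?D = {}"
      using False by (auto simp: S1_def outs_def ins_def)
    then show ?thesis
      using False by simp
  qed
  moreover have "(\<Sum>(\<beta>, \<beta>')\<in>S2 \<inter> ?D. G \<beta> \<beta>')
    = (if i = j then \<Sum>\<beta>\<in>ins i \<tau>. l_res g q i (pin \<tau> \<beta>) (M (dn \<tau> \<beta>)) * pin \<tau> \<beta> powi (n + m) / qden i * w \<tau> else 0)"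
  proof (cases "i = j")
    case True
    have "S2 \<inter> ?D = (\<lambda>\<beta>. (\<beta>, \<beta>)) ` ins i \<tau>"
      using ins_outs \<tau> True by (force simp: S2_def)
    then have "(\<Sum>(\<beta>, \<beta>')\<in>S2 \<inter> ?D. G \<beta> \<beta>') = (\<Sum>\<beta>\<in>ins i \<tau>. G \<beta> \<beta>)"
      by (simp add: sum.reindex inj_on_def)
    also have "\<dots> = (\<Sum>\<beta>\<in>ins i \<tau>. l_res g q i (pin \<tau> \<beta>) (M (dn \<tau> \<beta>)) * pin \<tau> \<beta> powi (n + m) / qden i * w \<tau>)"
    proof (intro sum.cong refl)
      fix \<beta> assume "\<beta> \<in> ins i \<tau>"
      then have "fst (par \<beta> (\<tau> \<beta> - 1)) = i"
        by (simp add: ins_def)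
      then show "G \<beta> \<beta> = l_res g q i (pin \<tau> \<beta>) (M (dn \<tau> \<beta>)) * pin \<tau> \<beta> powi (n + m) / qden i * w \<tau>"
        by (simp add: G_def cp_def power_int_add)
    qed
    finally show ?thesis
      using True by simp
  next
    case False
    have "S2 \<inter> ?D = {}"
      using False by (auto simp: S2_def outs_def ins_def)
    then show ?thesis
      using False by simp
  qed
  ultimately show ?thesis
    unfolding L R sum_residues[OF \<tau> ij(1)]
    by (simp add: diff_divide_distrib left_diff_distrib sum_divide_distrib sum_distrib_right)
qed

text \<open>A step divides the monomial by \<open>A\<close>, so \<open>h_eig\<close> changes by a
  multiple of the n-th power of the spectral parameter. This power merges with the one in
  \<open>wm\<close> and shifts the mode from \<open>m\<close> to \<open>n + m\<close>.\<close>

lemma wh_wm: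
  assumes "i \<in> nodes g"
  shows "h_eig g q i n (M \<tau>) * wm j m w \<tau> =
    wm j m (\<lambda>\<tau>. h_eig g q i n (M \<tau>) * w \<tau>) \<tau> - qint q (n * symm_cartan g i j) / of_int n * wm j (n + m) w \<tau>"
proof (cases "\<tau> \<in> X")
  case True
  have key: "h_eig g q i n (M \<tau>) * (cm (dn \<tau> \<beta>) \<beta> * pin \<tau> \<beta> powi m * w (dn \<tau> \<beta>))
    = cm (dn \<tau> \<beta>) \<beta> * pin \<tau> \<beta> powi m * (h_eig g q i n (M (dn \<tau> \<beta>)) * w (dn \<tau> \<beta>))
      - qint q (n * symm_cartan g i j) / of_int n * (cm (dn \<tau> \<beta>) \<beta> * pin \<tau> \<beta> powi (n + m) * w (dn \<tau> \<beta>))"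
    if b: "\<beta> \<in> ins j \<tau>" for \<beta>
  proof -
    have o: "dn \<tau> \<beta> \<in> X" "\<beta> \<in> outs j (dn \<tau> \<beta>)"
      using ins_outs[OF b True] by auto
    have j: "j \<in> nodes g"
      using outs_node o by blast
    have "M \<tau> = M (dn \<tau> \<beta>) - A_mon g q a j (snd (par \<beta> (\<tau> \<beta> - 1)))"
      using outs_M_up[OF o] by simp
    then have "h_eig g q i n (M \<tau>) = h_eig g q i n (M (dn \<tau> \<beta>)) - pin \<tau> \<beta> powi n * qint q (n * symm_cartan g i j) / of_int n"
      by (simp add: h_eig_diff h_eig_A_mon valid q0 a0 assms j pin_def spec_def)
    then show ?thesis
      by (simp only: power_int_add[OF disjI1[OF pin_nonzero]]) (simp add: algebra_simps)
  qed
  show ?thesis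
    unfolding wm_def if_P[OF True] sum_distrib_left sum_subtractf[symmetric]
    by (intro sum.cong refl key)
qed (simp add: wm_def)

lemma wk_wm:
  assumes "i \<in> nodes g"
  shows "k_eig g q i (M \<tau>) * wm j m w \<tau> =
    q powi (- symm_cartan g i j) * wm j m (\<lambda>\<tau>. k_eig g q i (M \<tau>) * w \<tau>) \<tau>"
proof (cases "\<tau> \<in> X")
  case True
  have key: "k_eig g q i (M \<tau>) * (cm (dn \<tau> \<beta>) \<beta> * pin \<tau> \<beta> powi m * w (dn \<tau> \<beta>))
    = q powi (- symm_cartan g i j) * (cm (dn \<tau> \<beta>) \<beta> * pin \<tau> \<beta> powi m * (k_eig g q i (M (dn \<tau> \<beta>)) * w (dn \<tau> \<beta>)))"
    if b: "\<beta> \<in> ins j \<tau>" for \<beta>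
  proof -
    have o: "dn \<tau> \<beta> \<in> X" "\<beta> \<in> outs j (dn \<tau> \<beta>)"
      using ins_outs[OF b True] by auto
    have j: "j \<in> nodes g"
      using outs_node o by blast
    have "M \<tau> = M (dn \<tau> \<beta>) - A_mon g q a j (snd (par \<beta> (\<tau> \<beta> - 1)))"
      using outs_M_up[OF o] by simp
    then have "k_eig g q i (M \<tau>) = k_eig g q i (M (dn \<tau> \<beta>)) * q powi (- symm_cartan g i j)"
      by (simp add: k_eig_diff k_eig_A_mon valid q0 assms j power_int_minus divide_inverse)
    then show ?thesis
      by (simp add: mult_ac)
  qed
  show ?thesis
    unfolding wm_def if_P[OF True] sum_distrib_left
    by (intro sum.cong refl key)
qed (simp add: wm_def)

end

section \<open>Modules over the quantum affine algebra\<close>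

lemma poly_mapping_eq_sum_single:
  "y = (\<Sum>k\<in>Poly_Mapping.keys y. Poly_Mapping.single k (Poly_Mapping.lookup y k))"
proof (rule poly_mapping_eqI)
  fix k
  show "Poly_Mapping.lookup y k = Poly_Mapping.lookup (\<Sum>k\<in>Poly_Mapping.keys y. Poly_Mapping.single k (Poly_Mapping.lookup y k)) k"
    by (simp add: lookup_sum lookup_single when_def in_keys_iff)
qed

lemma free_const_central: "free_const c * y = y * free_const c" for y :: "'g free_alg"
proof -
  have "free_const c * Poly_Mapping.single k b = Poly_Mapping.single k b * free_const c" for k :: "'g free_word" and b
    by (simp add: free_const_def mult_single mult.commute)
  then have "free_const c * (\<Sum>k\<in>Poly_Mapping.keys y. Poly_Mapping.single k (Poly_Mapping.lookup y k))
      = (\<Sum>k\<in>Poly_Mapping.keys y. Poly_Mapping.single k (Poly_Mapping.lookup y k)) * free_const c"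
    by (simp add: sum_distrib_left sum_distrib_right)
  then show ?thesis
    by (simp flip: poly_mapping_eq_sum_single)
qed

lemma free_const_0 [simp]: "free_const 0 = 0" and free_const_1 [simp]: "free_const 1 = 1"
  by (simp_all add: free_const_def)

context quantum_affine_module
begin

lemma act_zero_left [simp]: "act 0 v = 0"
  using act_const[of 0 v] by simp

lemma act_one [simp]: "act 1 v = v"
  using act_const[of 1 v] by simp

lemma act_zero_right [simp]: "act y 0 = 0"
  using act_add_right[of y 0 0] by simp

lemma act_scale: "act y (scale c v) = scale c (act y v)"
proof -
  have "act y (scale c v) = act (y * free_const c) v"
    by (simp only: act_mult act_const)
  then show ?thesis
    by (simp only: free_const_central[symmetric] act_mult act_const)
qed

lemma act_const_mult: "act (free_const c * y) v = scale c (act y v)"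
  by (simp only: act_mult act_const)

lemma act_uminus_right: "act y (- v) = - act y v"
  using act_add_right[of y v "- v"] by (simp add: eq_neg_iff_add_eq_0 add.commute)

lemma act_diff_right: "act y (v - w) = act y v - act y w"
  using act_add_right[of y v "- w"] by (simp add: act_uminus_right)

lemma act_uminus_left: "act (- y) v = - act y v"
  using act_add_left[of y "- y" v] by (simp add: eq_neg_iff_add_eq_0 add.commute)

lemma act_diff_left: "act (y - z) v = act y v - act z v"
  using act_add_left[of y "- z" v] by (simp add: act_uminus_left)

lemma act_sum_left: "act (sum f B) v = (\<Sum>x\<in>B. act (f x) v)"
  by (induction B rule: infinite_finite_induct) (simp_all add: act_add_left)

text \<open>Every element of the free algebra is a combination of words, so stability has to be
  tested on generators only.\<close>

lemma act_closed:
  assumes W: "subspace W" and gen: "\<And>z v. v \<in> W \<Longrightarrow> act (free_gen z) v \<in> W" and v: "v \<in> W"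
  shows "act y v \<in> W"
proof -
  have word: "act (Poly_Mapping.single (Word xs) c) v \<in> W" for xs c
  proof (induction xs)
    case Nil
    have "act (Poly_Mapping.single (Word []) c) v = scale c v"
      using act_const[of c v] by (simp add: free_const_def zero_free_word_def)
    then show ?case
      using subspace_scale[OF W v] by simp
  next
    case (Cons x xs)
    have "act (Poly_Mapping.single (Word (x # xs)) c) v = act (free_gen x) (act (Poly_Mapping.single (Word xs) c) v)"
      by (simp add: free_gen_def mult_single flip: act_mult)
    then show ?case
      using gen[OF Cons] by simp
  qed
  have "act (\<Sum>k\<in>Poly_Mapping.keys y. Poly_Mapping.single k (Poly_Mapping.lookup y k)) v \<in> W"
    unfolding act_sum_left by (intro subspace_sum[OF W]) (metis word free_word.exhaust)
  then show ?thesis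
    by (simp flip: poly_mapping_eq_sum_single)
qed

lemma act_free_gen_outside:
  assumes "i \<notin> nodes g"
  shows "act (gx e i n) v = 0" "act (gk e i) v = 0" "act (gh i n) v = 0"
  using act_rel[OF drinfeld_rel.no_x[OF assms]] act_rel[OF drinfeld_rel.no_k[OF assms]]
    act_rel[OF drinfeld_rel.no_h] assms by auto

lemma act_h_zero: "act (gh i 0) v = 0"
  using act_rel[OF drinfeld_rel.no_h[of i g 0 q]] by simp

lemma act_k_kinv:
  assumes "i \<in> nodes g"
  shows "act (gk Plus i) (act (gk Minus i) v) = v" "act (gk Minus i) (act (gk Plus i) v) = v"
  using act_rel[OF drinfeld_rel.k_inv[OF assms], of v] act_rel[OF drinfeld_rel.k_inv'[OF assms], of v]
  by (simp_all only: act_mult act_one)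

lemma act_k_x:
  assumes "i \<in> nodes g" "j \<in> nodes g"
  shows "act (gk Plus i) (act (gx Minus j n) v) = scale (q powi (- symm_cartan g i j)) (act (gx Minus j n) (act (gk Plus i) v))"
proof -
  have "act (gk Plus i) (act (gx Minus j n) (act (gk Minus i) (act (gk Plus i) v)))
      = scale (q powi (- symm_cartan g i j)) (act (gx Minus j n) (act (gk Plus i) v))"
    using act_rel[OF drinfeld_rel.k_x[OF assms, of q Minus n], of "act (gk Plus i) v"]
    by (simp only: act_mult act_const sgn_int.simps mult_minus1)
  then show ?thesis
    by (simp only: act_k_kinv[OF assms(1)])
qed

lemma act_kinv_x:
  assumes "i \<in> nodes g" "j \<in> nodes g" "q \<noteq> 0"
  shows "act (gk Minus i) (act (gx Minus j n) v) = scale (q powi symm_cartan g i j) (act (gx Minus j n) (act (gk Minus i) v))"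
proof -
  let ?B = "symm_cartan g i j"
  have "act (gk Plus i) (act (gx Minus j n) (act (gk Minus i) v)) = scale (q powi (- ?B)) (act (gx Minus j n) v)"
    by (simp only: act_k_x[OF assms(1,2)] act_k_kinv[OF assms(1)])
  then have "act (gk Minus i) (scale (q powi (- ?B)) (act (gx Minus j n) v)) = act (gx Minus j n) (act (gk Minus i) v)"
    by (metis act_k_kinv(2) assms(1))
  then have "scale (q powi ?B) (scale (q powi (- ?B)) (act (gk Minus i) (act (gx Minus j n) v)))
     = scale (q powi ?B) (act (gx Minus j n) (act (gk Minus i) v))"
    by (simp only: act_scale)
  then show ?thesis
    using assms(3) by (simp add: power_int_minus)
qed

end

locale type_one_module = quantum_affine_module +
  assumes type1: type_one and qn0: "q \<noteq> 0"
begin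

lemma act_C [simp]: "act (free_gen GC) v = v" "act (free_gen GCinv) v = v"
  using type1 by (auto simp: type_one_def)

lemma act_c_half [simp]: "act (c_half n) v = v"
proof -
  have "act (free_gen GC ^ m) v = v" "act (free_gen GCinv ^ m) v = v" for m
    by (induction m) (simp_all add: act_mult)
  then show ?thesis
    by (simp add: c_half_def)
qed

lemma act_h_x:
  assumes "i \<in> nodes g" "j \<in> nodes g" "n \<noteq> 0"
  shows "act (gh i n) (act (gx Minus j m) v) = act (gx Minus j m) (act (gh i n) v)
     - scale (qint q (n * symm_cartan g i j) / of_int n) (act (gx Minus j (n + m)) v)"
proof -
  have "act (gh i n * gx Minus j m - gx Minus j m * gh i n) v
     = act (free_const (- (qint q (n * symm_cartan g i j) / of_int n)) * c_half (- sgn_int Minus * \<bar>n\<bar>) * gx Minus j (n + m)) v"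
    using act_rel[OF drinfeld_rel.h_x[OF assms, of q Minus m], of v] by simp
  then show ?thesis
    by (simp only: act_diff_left act_mult act_const act_c_half scale_minus_left) (simp add: algebra_simps)
qed

lemma act_xp_xm:
  assumes "i \<in> nodes g" "j \<in> nodes g"
  shows "act (gx Plus i n) (act (gx Minus j m) v) = act (gx Minus j m) (act (gx Plus i n) v)
    + (if i = j then scale (1 / (q powi symm g i - q powi (- symm g i)))
         (act (phi_int q Plus i (n + m)) v - act (phi_int q Minus i (n + m)) v) else 0)"
proof -
  have "act (gx Plus i n * gx Minus j m - gx Minus j m * gx Plus i n) v = (if i = j then scale (1 / (q powi symm g i - q powi (- symm g i)))
         (act (phi_int q Plus i (n + m)) v - act (phi_int q Minus i (n + m)) v) else 0)"
    using act_rel[OF drinfeld_rel.xp_xm[OF assms, of q n m], of v]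
    by (cases "i = j") (simp_all only: if_True if_False act_const act_diff_left act_mult act_c_half act_zero_left refl)
  then show ?thesis
    by (simp only: act_diff_left act_mult) (simp add: algebra_simps)
qed

lemma act_phi: "act (phi q e i r) v =
    act (gk e i) (\<Sum>p\<le>r. scale (1 / fact p) (act (fps_nth (h_series q e i ^ p) r) v))"
  by (simp add: phi_def nc_exp_def act_mult act_sum_left act_const)

lemma h_series_nth: "act (fps_nth (h_series q e i) m) v =
   (if m = 0 then 0 else scale (of_int (sgn_int e) * (q - inverse q)) (act (gh i (sgn_int e * int m)) v))"
  by (simp add: h_series_def act_const_mult)

lemma act_h_series_Suc: "act (fps_nth (h_series q e i ^ Suc p) n) v =
   (\<Sum>k=0..n. act (fps_nth (h_series q e i) k) (act (fps_nth (h_series q e i ^ p) (n - k)) v))"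
  by (simp add: fps_mult_nth act_sum_left act_mult)

text \<open>The l-weight of an eigenvector of all \<open>\<phi>\<close> determines the eigenvalues of the \<open>h\<close>, since
  \<open>h\<^sub>i\<^sub>,\<^sub>n\<close> enters \<open>\<phi>\<^sub>i\<^sub>,\<^sub>n\<close> linearly and all other terms involve \<open>h\<^sub>i\<^sub>,\<^sub>m\<close> with \<open>m < n\<close>.\<close>

lemma eigenvector_h_series:
  assumes i: "i \<in> nodes g" and \<kappa>: "\<kappa> \<noteq> 0" and s0: "fps_nth s 0 = 0"
    and phi: "\<And>r. act (phi q e i r) v = scale (\<kappa> * fps_nth (fexp s) r) v"
  shows "act (gk e i) v = scale \<kappa> v" and "act (fps_nth (h_series q e i) n) v = scale (fps_nth s n) v"
proof -
  let ?S = "h_series q e i"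
  show k: "act (gk e i) v = scale \<kappa> v"
    using phi[of 0] by (simp add: act_phi)
  have kinj: "x = y" if "act (gk e i) x = act (gk e i) y" for x y
    using act_k_kinv[OF i] that by (cases e) metis+
  show "act (fps_nth ?S n) v = scale (fps_nth s n) v"
  proof (induction n rule: less_induct)
    case (less n)
    have pow: "act (fps_nth (?S ^ p) m) v = scale (fps_nth (s ^ p) m) v" if "m < n" for p m
      using that
    proof (induction p arbitrary: m)
      case (Suc p)
      have "act (fps_nth (?S ^ Suc p) m) v = (\<Sum>k=0..m. scale (fps_nth s k * fps_nth (s ^ p) (m - k)) v)"
        unfolding act_h_series_Suc using Suc less.IH
        by (intro sum.cong) (auto simp: act_scale mult.commute)
      then show ?case
        by (simp add: fps_mult_nth scale_sum_left)
    qed simp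
    \<comment> \<open>For \<open>p \<ge> 2\<close> the extreme terms \<open>k = 0\<close> and
      \<open>k = n\<close> vanish together with the constant terms, so that only coefficients below
      \<open>n\<close> enter; \<open>p = 0\<close> is immediate. Comparing the exponentials then
      isolates the linear term \<open>p = 1\<close>.\<close>
    have pow2: "act (fps_nth (?S ^ p) n) v = scale (fps_nth (s ^ p) n) v" if p1: "p \<noteq> 1" for p
    proof (cases p)
      case (Suc p')
      then obtain p'' where p': "p' = Suc p''"
        using p1 Suc by (cases p') auto
      have S00: "fps_nth (?S ^ p') 0 = 0" "fps_nth (s ^ p') 0 = 0"
        by (simp_all add: p' h_series_def s0)
      have "act (fps_nth (?S ^ Suc p') n) v = (\<Sum>k=0..n. scale (fps_nth s k * fps_nth (s ^ p') (n - k)) v)"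
        unfolding act_h_series_Suc
      proof (intro sum.cong refl)
        fix k assume "k \<in> {0..n}"
        consider "k = 0" | "k = n" | "0 < k" "k < n"
          using \<open>k \<in> {0..n}\<close> by fastforce
        then show "act (fps_nth ?S k) (act (fps_nth (?S ^ p') (n - k)) v) = scale (fps_nth s k * fps_nth (s ^ p') (n - k)) v"
        proof cases
          case 1
          then show ?thesis
            by (simp add: h_series_nth s0)
        next
          case 2
          then show ?thesis
            by (simp add: S00)
        next
          case 3
          then show ?thesis
            using less.IH pow by (simp add: act_scale mult.commute)
        qed
      qed
      then show ?thesis
        by (simp add: Suc fps_mult_nth scale_sum_left)
    qed simp
    show ?case
    proof (cases "n = 0")
      case False
      have "act (gk e i) (\<Sum>p\<le>n. scale (1 / fact p) (act (fps_nth (?S ^ p) n) v)) = act (gk e i) (scale (fps_nth (fexp s) n) v)"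
        using phi[of n] by (simp add: act_phi act_scale k mult.commute)
      then have "(\<Sum>p\<le>n. scale (1 / fact p) (act (fps_nth (?S ^ p) n) v)) = scale (fps_nth (fexp s) n) v"
        by (rule kinj)
      also have "fps_nth (fexp s) n = (\<Sum>p\<le>n. 1 / fact p * fps_nth (s ^ p) n)"
        by (simp add: fps_compose_nth atMost_atLeast0)
      also have "scale \<dots> v = (\<Sum>p\<le>n. scale (1 / fact p) (scale (fps_nth (s ^ p) n) v))"
        by (simp add: scale_sum_left)
      finally have eq: "(\<Sum>p\<le>n. scale (1 / fact p) (act (fps_nth (?S ^ p) n) v)) = (\<Sum>p\<le>n. scale (1 / fact p) (scale (fps_nth (s ^ p) n) v))" .
      have "1 \<in> {..n}"
        using False by auto
      moreover have "(\<Sum>p\<in>{..n} - {1}. scale (1 / fact p) (act (fps_nth (?S ^ p) n) v)) = (\<Sum>p\<in>{..n} - {1}. scale (1 / fact p) (scale (fps_nth (s ^ p) n) v))"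
        using pow2 by (intro sum.cong) auto
      ultimately show ?thesis
        using eq by (simp add: sum.remove[of "{..n}" 1])
    qed (simp add: h_series_nth s0)
  qed
qed

lemma h_from_series:
  assumes "not_root_of_unity q" "n \<noteq> 0" "sgn_int e * n > 0"
    and "\<And>m. act (fps_nth (h_series q e i) m) v = scale (fps_nth (h_series_val g q e i mon) m) v"
  shows "act (gh i n) v = scale (h_eig g q i n mon) v"
proof -
  have m: "sgn_int e * int (nat (sgn_int e * n)) = n"
    using assms(3) by (cases e) auto
  have m': "sgn_int e * (sgn_int e * n) = n"
    by (cases e) auto
  have c: "of_int (sgn_int e) * (q - inverse q) \<noteq> 0"
    using q_minus_inverse[OF qn0 assms(1), of 1] by (cases e) auto
  have "scale (of_int (sgn_int e) * (q - inverse q)) (act (gh i n) v)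
     = scale (of_int (sgn_int e) * (q - inverse q)) (scale (h_eig g q i n mon) v)"
    using assms(4)[of "nat (sgn_int e * n)"] assms(2,3)
    by (simp only: h_series_nth m) (simp add: h_series_val_def m m')
  then show ?thesis
    using c by (simp only: scale_left_imp_eq)
qed

end

section \<open>Comparing an irreducible module with a thin representation\<close>

text \<open>The coefficients \<open>weight_coeff g i\<close> pair positively with all simple roots, so that
  \<open>\<Prod>\<^sub>i k\<^sub>i\<close> to these powers separates the highest weight from all lower ones.\<close>

fun weight_coeff :: "lie_type \<Rightarrow> nat \<Rightarrow> nat" where
  "weight_coeff (TypeA N) i = i * (N + 1 - i)"
| "weight_coeff (TypeB N) i = i * (2 * N - i)"

definition grade :: "lie_type \<Rightarrow> nat \<Rightarrow> int" where
  "grade g j = (\<Sum>i\<in>nodes g. int (weight_coeff g i) * symm_cartan g i j)"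

text \<open>The Dynkin diagram is a path, so a sum over the nodes weighted by Cartan entries has at
  most three terms.\<close>

lemma sum_neighbours:
  fixes f :: "nat \<Rightarrow> 'a::ab_group_add"
  assumes "j \<in> {1..N}" "\<And>i. i \<in> {1..N} \<Longrightarrow> i \<noteq> j \<Longrightarrow> i \<noteq> Suc j \<Longrightarrow> j \<noteq> Suc i \<Longrightarrow> f i = 0"
  shows "(\<Sum>i\<in>{1..N}. f i) = (if j > 1 then f (j - 1) else 0) + f j + (if j < N then f (Suc j) else 0)"
proof -
  let ?S = "(if j > 1 then {j - 1} else {}) \<union> {j} \<union> (if j < N then {Suc j} else {})"
  have "(\<Sum>i\<in>{1..N}. f i) = (\<Sum>i\<in>?S. f i)"
  proof (rule sum.mono_neutral_right)
    show "?S \<subseteq> {1..N}"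
      using assms(1) by auto
    show "\<forall>i\<in>{1..N} - ?S. f i = 0"
    proof
      fix i assume i: "i \<in> {1..N} - ?S"
      then have "i \<noteq> j" "i \<noteq> Suc j" "j \<noteq> Suc i"
        by (auto split: if_splits)
      then show "f i = 0"
        using assms(2) i by blast
    qed
  qed simp
  then show ?thesis
    using assms(1) by (auto simp: add_ac split: if_splits)
qed

text \<open>The numbers \<open>weight_coeff g i\<close> are the coefficients of the sum of all
  positive roots in terms of the simple roots. That sum pairs with the j-th simple root to the
  square length of this root, so \<open>grade g j\<close> is 2 r_j.\<close>

lemma grade_pos:
  assumes "valid_lie_type g" "j \<in> nodes g"
  shows "grade g j > 0"
proof (cases g)
  case (TypeA N)
  have j: "j \<in> {1..N}"
    using assms TypeA by (auto simp: nodes_def)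
  have w: "int (weight_coeff g i) = int i * (int N + 1 - int i)" if "i \<le> N + 1" for i
    using that by (simp add: TypeA of_nat_diff)
  have "grade g j = (if j > 1 then - int (weight_coeff g (j - 1)) else 0) + 2 * int (weight_coeff g j)
     + (if j < N then - int (weight_coeff g (Suc j)) else 0)"
    unfolding grade_def nodes_def using j
    by (simp only: TypeA lie_rank.simps, subst sum_neighbours[OF j]) (auto simp: symm_cartan_def)
  moreover have "int (weight_coeff g (j - 1)) = (int j - 1) * (int N + 2 - int j)"
  proof -
    have le: "j - 1 \<le> N + 1" and e: "int (j - 1) = int j - 1"
      using j by auto
    show ?thesis
      unfolding w[OF le] e by (simp add: algebra_simps)
  qed
  ultimately show ?thesis
    using j w[of j] w[of "Suc j"]
    by (cases "j > 1"; cases "j < N") (auto simp: algebra_simps)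
next
  case (TypeB N)
  have N: "N \<ge> 2"
    using assms TypeB by simp
  have j: "j \<in> {1..N}"
    using assms TypeB by (auto simp: nodes_def)
  have w: "int (weight_coeff g i) = int i * (2 * int N - int i)" if "i \<le> 2 * N" for i
    using that by (simp add: TypeB of_nat_diff)
  have "grade g j = (if j > 1 then - 2 * int (weight_coeff g (j - 1)) else 0) + (if j < N then 4 else 2) * int (weight_coeff g j)
     + (if j < N then - 2 * int (weight_coeff g (Suc j)) else 0)"
    unfolding grade_def nodes_def using j N
    by (simp only: TypeB lie_rank.simps, subst sum_neighbours[OF j]) (auto simp: symm_cartan_def)
  moreover have "int (weight_coeff g (j - 1)) = (int j - 1) * (2 * int N + 1 - int j)"
  proof -
    have le: "j - 1 \<le> 2 * N" and e: "int (j - 1) = int j - 1"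
      using j by auto
    show ?thesis
      unfolding w[OF le] e by (simp add: algebra_simps)
  qed
  ultimately show ?thesis
    using j N w[of j] w[of "Suc j"]
    by (cases "j > 1"; cases "j < N") (auto simp: algebra_simps)
qed

definition grading_elt :: "lie_type \<Rightarrow> dalg" where
  "grading_elt g = prod_list (map (\<lambda>i. gk Plus i ^ weight_coeff g i) [1..<Suc (lie_rank g)])"

declare gk.simps [simp del] l_weight.simps [simp del]

context quantum_affine_module
begin

lemma act_power_scalar:
  assumes "act y v = scale c v"
  shows "act (y ^ n) v = scale (c ^ n) v"
  by (induction n) (simp_all add: act_mult assms act_scale mult.commute)

lemma act_power_qcomm:
  assumes "\<And>u. act y (act x u) = scale c (act x (act y u))"
  shows "act (y ^ n) (act x u) = scale (c ^ n) (act x (act (y ^ n) u))"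
  by (induction n) (simp_all add: act_mult assms act_scale mult.commute)

lemma grading_elt_qcomm:
  assumes j: "j \<in> nodes g" and q: "q \<noteq> 0"
  shows "act (grading_elt g) (act (gx Minus j n) u) = scale (q powi (- grade g j)) (act (gx Minus j n) (act (grading_elt g) u))"
proof -
  let ?f = "\<lambda>i. gk Plus i ^ weight_coeff g i"
  have one: "act (?f i) (act (gx Minus j n) u) = scale (q powi (- (int (weight_coeff g i) * symm_cartan g i j))) (act (gx Minus j n) (act (?f i) u))"
    if "i \<in> nodes g" for i u
  proof -
    have "act (?f i) (act (gx Minus j n) u) = scale ((q powi (- symm_cartan g i j)) ^ weight_coeff g i) (act (gx Minus j n) (act (?f i) u))"
      by (rule act_power_qcomm) (rule act_k_x[OF that j])
    moreover have "(q powi (- symm_cartan g i j)) ^ weight_coeff g i = q powi (- (int (weight_coeff g i) * symm_cartan g i j))"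
      by (metis mult.commute mult_minus_right power_int_mult power_int_of_nat)
    ultimately show ?thesis
      by simp
  qed
  have A: "act (prod_list (map ?f xs)) (act (gx Minus j n) u)
     = scale (q powi (- (\<Sum>i\<leftarrow>xs. int (weight_coeff g i) * symm_cartan g i j))) (act (gx Minus j n) (act (prod_list (map ?f xs)) u))"
    if "set xs \<subseteq> nodes g" for xs
    using that
  proof (induction xs)
    case (Cons i xs)
    then show ?case
      using q by (simp add: act_mult one act_scale power_int_diff power_int_minus divide_inverse mult_ac)
  qed simp
  have S: "set [1..<Suc (lie_rank g)] \<subseteq> nodes g"
    by (auto simp: nodes_def)
  have E: "(\<Sum>i\<leftarrow>[1..<Suc (lie_rank g)]. f i) = (\<Sum>i\<in>nodes g. f i)" for f :: "nat \<Rightarrow> int"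
    by (simp only: interv_sum_list_conv_sum_set_nat nodes_def set_upt atLeastLessThanSuc_atLeastAtMost)
  show ?thesis
    unfolding grading_elt_def grade_def E[symmetric] by (rule A[OF S])
qed

lemma grading_elt_scalar:
  assumes "\<And>i. i \<in> nodes g \<Longrightarrow> act (gk Plus i) v = scale (k i) v" "\<And>i. k i \<noteq> 0"
  obtains \<omega> where "act (grading_elt g) v = scale \<omega> v" "\<omega> \<noteq> 0"
proof -
  let ?f = "\<lambda>i. gk Plus i ^ weight_coeff g i"
  have A: "act (prod_list (map ?f xs)) v = scale (prod_list (map (\<lambda>i. k i ^ weight_coeff g i) xs)) v" if "set xs \<subseteq> nodes g" for xs
    using that
  proof (induction xs)
    case (Cons i xs)
    then show ?case
      using act_power_scalar[OF assms(1), of i] by (simp add: act_mult act_scale mult.commute)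
  qed simp
  have S: "set [1..<Suc (lie_rank g)] \<subseteq> nodes g"
    by (auto simp: nodes_def)
  have "act (grading_elt g) v = scale (prod_list (map (\<lambda>i. k i ^ weight_coeff g i) [1..<Suc (lie_rank g)])) v"
    unfolding grading_elt_def by (rule A[OF S])
  moreover have "prod_list (map (\<lambda>i. k i ^ weight_coeff g i) [1..<Suc (lie_rank g)]) \<noteq> 0"
    using assms(2) by (auto simp: prod_list_zero_iff simp del: upt_Suc)
  ultimately show thesis
    using that by blast
qed

end

locale thin_module = type_one_module scale g q act + thin_lattice g q a X bot P par M
  for scale :: "complex \<Rightarrow> 'v::ab_group_add \<Rightarrow> 'v" and g q act a
    and X :: "('b \<Rightarrow> int) set" and bot P par M +
  fixes v :: 'v
  assumes v_nonzero: "v \<noteq> 0" and irred: irreducible_module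
    and highest: "\<And>i n. i \<in> nodes g \<Longrightarrow> act (gx Plus i n) v = 0"
    and l_weight_v: "\<And>i e r. i \<in> nodes g \<Longrightarrow> act (phi q e i r) v = scale (fps_nth (l_weight g q (M bot) e i) r) v"
begin

fun kval :: "sign \<Rightarrow> nat \<Rightarrow> monomial \<Rightarrow> complex" where
  "kval Plus i m = k_eig g q i m"
| "kval Minus i m = inverse (k_eig g q i m)"

lemma l_weight_kval:
  "m \<in> monomials g \<Longrightarrow> l_weight g q m e i = fps_const (kval e i m) * fexp (h_series_val g q e i m)"
  by (cases e) (simp_all only: kval.simps l_weight_Plus_eq_exp[OF q0 q_nru] l_weight_Minus_eq_exp[OF q0 q_nru])

lemma kval_nonzero: "kval e i m \<noteq> 0"
  by (cases e) (simp_all add: k_eig_nonzero q0)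

lemma v_eigen:
  assumes "i \<in> nodes g"
  shows "act (gk e i) v = scale (kval e i (M bot)) v"
    and "n \<noteq> 0 \<Longrightarrow> act (gh i n) v = scale (h_eig g q i n (M bot)) v"
proof -
  have phi: "act (phi q e i r) v = scale (kval e i (M bot) * fps_nth (fexp (h_series_val g q e i (M bot))) r) v" for e r
    by (simp only: l_weight_v[OF assms] l_weight_kval[OF M_monomial[OF bot_in]] fps_mult_left_const_nth)
  show "act (gk e i) v = scale (kval e i (M bot)) v"
    by (rule eigenvector_h_series(1)[OF assms kval_nonzero h_series_val_0 phi])
  assume n: "n \<noteq> 0"
  define e' where "e' = (if n > 0 then Plus else Minus)"
  show "act (gh i n) v = scale (h_eig g q i n (M bot)) v"
  proof (rule h_from_series[OF q_nru n])
    show "sgn_int e' * n > 0"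
      using n by (simp add: e'_def)
    show "act (fps_nth (h_series q e' i) m) v = scale (fps_nth (h_series_val g q e' i (M bot)) m) v" for m
      by (rule eigenvector_h_series(2)[OF assms kval_nonzero h_series_val_0 phi])
  qed
qed

definition ind :: "('b \<Rightarrow> int) \<Rightarrow> ('b \<Rightarrow> int) \<Rightarrow> complex" where
  "ind \<sigma> \<tau> = (if \<tau> = \<sigma> then 1 else 0)"

text \<open>The pairs generated by the two highest weight vectors; this will turn out to be the graph of
  an isomorphism onto the functions supported on \<open>X\<close>.\<close>

inductive Gr :: "'v \<Rightarrow> (('b \<Rightarrow> int) \<Rightarrow> complex) \<Rightarrow> bool" where
  base: "Gr v (ind bot)"
| add: "Gr u w \<Longrightarrow> Gr u' w' \<Longrightarrow> Gr (u + u') (\<lambda>\<tau>. w \<tau> + w' \<tau>)"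
| scale: "Gr u w \<Longrightarrow> Gr (scale c u) (\<lambda>\<tau>. c * w \<tau>)"
| lower: "Gr u w \<Longrightarrow> j \<in> nodes g \<Longrightarrow> Gr (act (gx Minus j n) u) (wm j n w)"

section \<open>Stability of the graph under all generators\<close>

lemma Gr_zero: "Gr 0 (\<lambda>_. 0)"
  using Gr.scale[OF Gr.base, of 0] by simp

lemma Gr_uminus: "Gr u w \<Longrightarrow> Gr (- u) (\<lambda>\<tau>. - w \<tau>)"
  using Gr.scale[of u w "-1"] by simp

lemma Gr_diff: "Gr u w \<Longrightarrow> Gr u' w' \<Longrightarrow> Gr (u - u') (\<lambda>\<tau>. w \<tau> - w' \<tau>)"
  using Gr.add[OF _ Gr_uminus, of u w u' w'] by simp

lemma Gr_sum: "(\<And>x. x \<in> B \<Longrightarrow> Gr (f x) (h x)) \<Longrightarrow> Gr (\<Sum>x\<in>B. f x) (\<lambda>\<tau>. \<Sum>x\<in>B. h x \<tau>)"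
  by (induction B rule: infinite_finite_induct) (auto intro: Gr_zero Gr.add)

lemma wm_linear:
  "wm j n (\<lambda>\<tau>. w \<tau> + w' \<tau>) = (\<lambda>\<tau>. wm j n w \<tau> + wm j n w' \<tau>)"
  "wm j n (\<lambda>\<tau>. c * w \<tau>) = (\<lambda>\<tau>. c * wm j n w \<tau>)"
  "wm j n (\<lambda>\<tau>. 0) = (\<lambda>\<tau>. 0)"
  by (auto simp: wm_def fun_eq_iff sum.distrib sum_distrib_left algebra_simps)

lemma wp_linear:
  "wp j n (\<lambda>\<tau>. w \<tau> + w' \<tau>) = (\<lambda>\<tau>. wp j n w \<tau> + wp j n w' \<tau>)"
  "wp j n (\<lambda>\<tau>. c * w \<tau>) = (\<lambda>\<tau>. c * wp j n w \<tau>)"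
  "wp j n (\<lambda>\<tau>. 0) = (\<lambda>\<tau>. 0)"
  by (auto simp: wp_def fun_eq_iff sum.distrib sum_distrib_left algebra_simps)

lemma Gr_support: "Gr u w \<Longrightarrow> \<tau> \<notin> X \<Longrightarrow> w \<tau> = 0"
  by (induction rule: Gr.induct) (use bot_in in \<open>auto simp: ind_def wm_def\<close>)

text \<open>Moving \<open>h\<close> past \<open>x^-\<close> produces the same correction, with
  shifted mode, in the module and on the tableaux, and this correction lies in the graph by the rule
  \<open>lower\<close>.\<close>

lemma Gr_h: "Gr u w \<Longrightarrow> i \<in> nodes g \<Longrightarrow> n \<noteq> 0 \<Longrightarrow> Gr (act (gh i n) u) (\<lambda>\<tau>. h_eig g q i n (M \<tau>) * w \<tau>)"
proof (induction arbitrary: n rule: Gr.induct)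
  case base
  have "(\<lambda>\<tau>. h_eig g q i n (M \<tau>) * ind bot \<tau>) = (\<lambda>\<tau>. h_eig g q i n (M bot) * ind bot \<tau>)"
    by (auto simp: ind_def)
  then show ?case
    using Gr.scale[OF Gr.base] v_eigen(2)[OF base] by simp
next
  case (add u w u' w')
  then show ?case
    using Gr.add[OF add.IH] by (simp add: act_add_right distrib_left)
next
  case (scale u w c)
  then show ?case
    using Gr.scale[OF scale.IH] by (simp add: act_scale mult_ac)
next
  case (lower u w j m)
  have "Gr (act (gx Minus j m) (act (gh i n) u) - scale (qint q (n * symm_cartan g i j) / of_int n) (act (gx Minus j (n + m)) u))
    (\<lambda>\<tau>. wm j m (\<lambda>\<tau>. h_eig g q i n (M \<tau>) * w \<tau>) \<tau> - qint q (n * symm_cartan g i j) / of_int n * wm j (n + m) w \<tau>)"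
    by (rule Gr_diff[OF Gr.lower[OF lower.IH[OF lower.prems] lower.hyps(2)] Gr.scale[OF Gr.lower[OF lower.hyps]]])
  then show ?case
    by (simp only: act_h_x[OF lower.prems(1) lower.hyps(2) lower.prems(2)] wh_wm[OF lower.prems(1)])
qed

lemma Gr_k: "Gr u w \<Longrightarrow> i \<in> nodes g \<Longrightarrow> Gr (act (gk e i) u) (\<lambda>\<tau>. kval e i (M \<tau>) * w \<tau>)"
proof (induction rule: Gr.induct)
  case base
  have "(\<lambda>\<tau>. kval e i (M \<tau>) * ind bot \<tau>) = (\<lambda>\<tau>. kval e i (M bot) * ind bot \<tau>)"
    by (auto simp: ind_def)
  then show ?case
    using Gr.scale[OF Gr.base] v_eigen(1)[OF base] by simp
next
  case (add u w u' w')
  then show ?case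
    using Gr.add[OF add.IH] by (simp add: act_add_right distrib_left)
next
  case (scale u w c)
  then show ?case
    using Gr.scale[OF scale.IH] by (simp add: act_scale mult_ac)
next
  case (lower u w j m)
  let ?B = "symm_cartan g i j"
  have I: "Gr (act (gk e i) u) (\<lambda>\<tau>. kval e i (M \<tau>) * w \<tau>)"
    using lower by blast
  show ?case
  proof (cases e)
    case Plus
    from Gr.scale[OF Gr.lower[OF I lower.hyps(2)], of "q powi (- ?B)" m]
    show ?thesis
      by (simp only: Plus kval.simps act_k_x[OF lower.prems lower.hyps(2)] wk_wm[OF lower.prems])
  next
    case Minus
    have wk: "inverse (k_eig g q i (M \<tau>)) * wm j m w \<tau> = q powi ?B * wm j m (\<lambda>\<tau>. inverse (k_eig g q i (M \<tau>)) * w \<tau>) \<tau>" for \<tau>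
    proof -
      have e: "(\<lambda>\<tau>. k_eig g q i (M \<tau>) * (inverse (k_eig g q i (M \<tau>)) * w \<tau>)) = w"
        by (simp add: fun_eq_iff mult.assoc[symmetric] k_eig_nonzero[OF q0])
      have "k_eig g q i (M \<tau>) * wm j m (\<lambda>\<tau>. inverse (k_eig g q i (M \<tau>)) * w \<tau>) \<tau> = q powi (- ?B) * wm j m w \<tau>"
        unfolding wk_wm[OF lower.prems] e by (rule refl)
      then show ?thesis
        using k_eig_nonzero[OF q0, of g i "M \<tau>"] q0 by (simp add: power_int_minus field_simps)
    qed
    from Gr.scale[OF Gr.lower[OF I lower.hyps(2)], of "q powi ?B" m]
    show ?thesis
      by (simp only: Minus kval.simps act_kinv_x[OF lower.prems lower.hyps(2) q0] wk)
  qed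
qed

lemma Gr_h_series:
  assumes "Gr u w" "i \<in> nodes g"
  shows "Gr (act (fps_nth (h_series q e i) m) u) (\<lambda>\<tau>. fps_nth (h_series_val g q e i (M \<tau>)) m * w \<tau>)"
proof (cases "m = 0")
  case True
  then show ?thesis
    by (simp add: h_series_nth h_series_val_0 Gr_zero)
next
  case False
  have "sgn_int e * int m \<noteq> 0"
    using False by (cases e) auto
  from Gr.scale[OF Gr_h[OF assms this], of "of_int (sgn_int e) * (q - inverse q)"] show ?thesis
    using False by (simp add: h_series_nth h_series_val_def mult.assoc)
qed

lemma Gr_h_series_power:
  assumes "Gr u w" "i \<in> nodes g"
  shows "Gr (act (fps_nth (h_series q e i ^ p) m) u) (\<lambda>\<tau>. fps_nth (h_series_val g q e i (M \<tau>) ^ p) m * w \<tau>)"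
proof (induction p arbitrary: m)
  case 0
  then show ?case
    using assms(1) Gr_zero by simp
next
  case (Suc p)
  have "Gr (act (fps_nth (h_series q e i ^ Suc p) m) u)
    (\<lambda>\<tau>. \<Sum>k=0..m. fps_nth (h_series_val g q e i (M \<tau>)) k * (fps_nth (h_series_val g q e i (M \<tau>) ^ p) (m - k) * w \<tau>))"
    unfolding act_h_series_Suc by (intro Gr_sum Gr_h_series Suc assms)
  then show ?case
    by (simp add: fps_mult_nth sum_distrib_right mult.assoc)
qed

lemma Gr_phi:
  assumes "Gr u w" "i \<in> nodes g"
  shows "Gr (act (phi q e i r) u) (\<lambda>\<tau>. fps_nth (l_weight g q (M \<tau>) e i) r * w \<tau>)"
proof -
  have "Gr (act (phi q e i r) u)
    (\<lambda>\<tau>. kval e i (M \<tau>) * (\<Sum>p\<le>r. 1 / fact p * (fps_nth (h_series_val g q e i (M \<tau>) ^ p) r * w \<tau>)))"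
    unfolding act_phi by (intro Gr_k Gr_sum Gr.scale Gr_h_series_power assms)
  moreover have "kval e i (M \<tau>) * (\<Sum>p\<le>r. 1 / fact p * (fps_nth (h_series_val g q e i (M \<tau>) ^ p) r * w \<tau>))
    = fps_nth (l_weight g q (M \<tau>) e i) r * w \<tau>" for \<tau>
  \<comment> \<open>The l-weight is known to be an exponential only for
    \<open>M \<tau> \<in> monomials g\<close>, hence for \<open>\<tau> \<in> X\<close>; elsewhere
    \<open>w\<close> vanishes.\<close>
  proof (cases "\<tau> \<in> X")
    case True
    have "fps_nth (l_weight g q (M \<tau>) e i) r = kval e i (M \<tau>) * fps_nth (fexp (h_series_val g q e i (M \<tau>))) r"
      by (simp only: l_weight_kval[OF M_monomial[OF True]] fps_mult_left_const_nth)
    also have "fps_nth (fexp (h_series_val g q e i (M \<tau>))) r = (\<Sum>p\<le>r. 1 / fact p * fps_nth (h_series_val g q e i (M \<tau>) ^ p) r)"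
      by (simp add: fps_compose_nth atMost_atLeast0)
    finally show ?thesis
      by (simp only: mult.assoc sum_distrib_right)
  qed (use Gr_support[OF assms(1)] in simp)
  ultimately show ?thesis
    by simp
qed

lemma Gr_phi_int:
  assumes "Gr u w" "i \<in> nodes g"
  shows "Gr (act (phi_int q e i n) u)
    (\<lambda>\<tau>. (if sgn_int e * n \<ge> 0 then fps_nth (l_weight g q (M \<tau>) e i) (nat (sgn_int e * n)) else 0) * w \<tau>)"
  using Gr_phi[OF assms] Gr_zero by (simp add: phi_int_def)

text \<open>The counterpart of the highest weight condition: \<open>bot\<close> is not the upper end
  of any step, as no element of \<open>X\<close> lies below it.\<close>

lemma wp_ind_bot: "wp i n (ind bot) = (\<lambda>_. 0)"
proof
  fix \<tau>
  have "up \<tau> \<beta> \<noteq> bot" if "\<tau> \<in> X" for \<beta>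
    using bot_le[OF that, of \<beta>] arg_cong[of "up \<tau> \<beta>" bot "\<lambda>f. f \<beta>"] by force
  then show "wp i n (ind bot) \<tau> = 0"
    by (simp add: wp_def ind_def)
qed

text \<open>Here the commutator of \<open>wp\<close> and \<open>wm\<close> meets the defining
  relation. By \<open>l_weight_residues\<close> its diagonal part is, up to \<open>qden\<close>, the
  difference of the two series \<open>phi\<close>, under which the graph is already known to be
  stable.\<close>

lemma Gr_xp: "Gr u w \<Longrightarrow> i \<in> nodes g \<Longrightarrow> Gr (act (gx Plus i n) u) (wp i n w)"
proof (induction rule: Gr.induct)
  case base
  then show ?case
    by (simp add: wp_ind_bot highest Gr_zero)
next
  case (add u w u' w')
  then show ?case
    using Gr.add[OF add.IH] by (simp add: act_add_right wp_linear)
next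
  case (scale u w c)
  then show ?case
    using Gr.scale[OF scale.IH] by (simp add: act_scale wp_linear)
next
  case (lower u w j m)
  note ij = lower.prems lower.hyps(2)
  have I: "Gr (act (gx Plus i n) u) (wp i n w)"
    using lower by blast
  define k where "k = n + m"
  let ?lw = "\<lambda>e \<tau>. if sgn_int e * k \<ge> 0 then fps_nth (l_weight g q (M \<tau>) e i) (nat (sgn_int e * k)) else 0"
  have comm: "wp i n (wm j m w) \<tau> = wm j m (wp i n w) \<tau>
      + (if i = j then 1 / qden i * (?lw Plus \<tau> * w \<tau> - ?lw Minus \<tau> * w \<tau>) else 0)" for \<tau>
  proof (cases "\<tau> \<in> X")
    case True
    have "?lw Plus \<tau> - ?lw Minus \<tau> = (\<Sum>b | pole_ord g q i b (M \<tau>) = 1. l_res g q i b (M \<tau>) * b powi k)"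
      using l_weight_residues[OF q0 M_monomial[OF True] pole_le[OF True ij(1)], of k]
      by (simp only: sgn_int.simps mult_1_left mult_minus1 neg_0_le_iff_le)
    then have E: "1 / qden i * (?lw Plus \<tau> * w \<tau> - ?lw Minus \<tau> * w \<tau>)
       = (\<Sum>b | pole_ord g q i b (M \<tau>) = 1. l_res g q i b (M \<tau>) * b powi k) / qden i * w \<tau>"
      by (simp only: left_diff_distrib[symmetric] times_divide_eq_left mult_1_left)
    show ?thesis
      using wp_wm_commutator[OF True ij, of n m w] unfolding E k_def[symmetric] diff_eq_eq
      by (simp only: add.commute)
  next
    case False
    then show ?thesis
      using Gr_support[OF lower.hyps(1) False] by (simp add: wp_def wm_def)
  qed
  show ?case
  proof (cases "i = j")
    case True
    have "Gr (act (gx Minus j m) (act (gx Plus i n) u)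
        + scale (1 / qden i) (act (phi_int q Plus i k) u - act (phi_int q Minus i k) u))
      (\<lambda>\<tau>. wm j m (wp i n w) \<tau> + 1 / qden i * (?lw Plus \<tau> * w \<tau> - ?lw Minus \<tau> * w \<tau>))"
      by (intro Gr.add Gr.scale Gr_diff Gr_phi_int Gr.lower I ij lower.hyps)
    moreover have "wp i n (wm j m w) = (\<lambda>\<tau>. wm j m (wp i n w) \<tau> + 1 / qden i * (?lw Plus \<tau> * w \<tau> - ?lw Minus \<tau> * w \<tau>))"
      by (rule ext) (simp only: comm if_P[OF True])
    moreover have "act (gx Plus i n) (act (gx Minus j m) u) = act (gx Minus j m) (act (gx Plus i n) u)
        + scale (1 / qden i) (act (phi_int q Plus i k) u - act (phi_int q Minus i k) u)"
      by (simp only: act_xp_xm[OF ij] if_P[OF True] qden_def k_def)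
    ultimately show ?thesis
      by (simp only:)
  next
    case False
    have "wp i n (wm j m w) = wm j m (wp i n w)"
      using comm False by (simp add: fun_eq_iff)
    then show ?thesis
      using Gr.lower[OF I ij(2), of m] False by (simp add: act_xp_xm[OF ij])
  qed
qed

text \<open>The second clause ensures that a generator maps a pair (u, 0) to a pair of the same
  form, so that the vectors paired with 0 are a submodule.\<close>

lemma Gr_gen:
  assumes "Gr u w"
  obtains w' where "Gr (act (free_gen z) u) w'" "w = (\<lambda>_. 0) \<Longrightarrow> w' = (\<lambda>_. 0)"
proof -
  note result = that
  have out: thesis if "act (free_gen z) u = 0"
    by (rule result[of "\<lambda>_. 0"]) (simp_all add: that Gr_zero)
  show thesis
  proof (cases z)
    case (GX e i n)
    have z: "free_gen z = gx e i n"
      by (simp add: GX gx_def)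
    show thesis
    proof (cases "i \<in> nodes g")
      case True
      show thesis
      proof (cases e)
        case Plus
        then show thesis
          using that[of "wp i n w"] Gr_xp[OF assms True] wp_linear(3) by (simp add: z)
      next
        case Minus
        then show thesis
          using that[of "wm i n w"] Gr.lower[OF assms True] wm_linear(3) by (simp add: z)
      qed
    qed (rule out, simp add: z act_free_gen_outside)
  next
    case (GK i)
    have z: "free_gen z = gk Plus i"
      by (simp add: GK gk.simps)
    show thesis
    proof (cases "i \<in> nodes g")
      case True
      show thesis
        using that[of "\<lambda>\<tau>. kval Plus i (M \<tau>) * w \<tau>"] Gr_k[OF assms True, of Plus] by (simp only: z) simp
    qed (rule out, simp add: z act_free_gen_outside)
  next
    case (GKinv i)
    have z: "free_gen z = gk Minus i"
      by (simp add: GKinv gk.simps)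
    show thesis
    proof (cases "i \<in> nodes g")
      case True
      show thesis
        using that[of "\<lambda>\<tau>. kval Minus i (M \<tau>) * w \<tau>"] Gr_k[OF assms True, of Minus] by (simp only: z) simp
    qed (rule out, simp add: z act_free_gen_outside)
  next
    case (GH i n)
    have z: "free_gen z = gh i n"
      by (simp add: GH gh_def)
    show thesis
    proof (cases "i \<in> nodes g \<and> n \<noteq> 0")
      case True
      then show thesis
        using that[of "\<lambda>\<tau>. h_eig g q i n (M \<tau>) * w \<tau>"] Gr_h[OF assms, of i n] by (simp add: z)
    next
      case False
      then have "act (free_gen z) u = 0"
        unfolding z using act_free_gen_outside(3)[of i n u] act_h_zero[of i u] by blast
      then show thesis
        by (rule out)
    qed
  next
    case GC
    then show thesis
      using that[OF _] assms by simp
  next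
    case GCinv
    then show thesis
      using that[OF _] assms by simp
  qed
qed

end

lemma power_sums_zero_inj:
  fixes f z :: "'x \<Rightarrow> complex"
  assumes "finite I" "inj_on f I" "x \<in> I" "\<And>n. (\<Sum>x\<in>I. z x * f x ^ n) = 0"
  shows "z x = 0"
proof -
  have "(\<Sum>b\<in>f ` I. z (the_inv_into I f b) * b ^ n) = 0" for n
    using assms(2,4) by (simp add: sum.reindex the_inv_into_f_f)
  from power_sums_zero[OF _ _ this, of "f x"] show ?thesis
    using assms(1-3) by (simp add: the_inv_into_f_f)
qed

section \<open>Vectors of weight below the highest one\<close>

context quantum_affine_module
begin

text \<open>\<open>low \<omega>\<close> is the sum of the generalized eigenspaces of the grading element for the eigenvalues
  \<open>\<omega> q\<^sup>-\<^sup>t\<close> with \<open>t > 0\<close>.\<close>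

definition shifted :: "complex \<Rightarrow> int \<Rightarrow> 'v \<Rightarrow> 'v" where
  "shifted \<omega> t u = act (grading_elt g) u - scale (\<omega> * q powi (- t)) u"

definition low :: "complex \<Rightarrow> 'v \<Rightarrow> bool" where
  "low \<omega> u \<longleftrightarrow> (\<exists>ts. (\<forall>t\<in>set ts. t > 0) \<and> foldr (shifted \<omega>) ts u = 0)"

lemma shifted_linear: "shifted \<omega> t (u + u') = shifted \<omega> t u + shifted \<omega> t u'" "shifted \<omega> t (scale c u) = scale c (shifted \<omega> t u)"
  by (simp_all add: shifted_def act_add_right act_scale scale_right_distrib scale_right_diff_distrib mult.commute algebra_simps)

lemma shifted_0 [simp]: "shifted \<omega> t 0 = 0"
  by (simp add: shifted_def)

lemma foldr_shifted_linear:
  "foldr (shifted \<omega>) ts (u + u') = foldr (shifted \<omega>) ts u + foldr (shifted \<omega>) ts u'"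
  "foldr (shifted \<omega>) ts (scale c u) = scale c (foldr (shifted \<omega>) ts u)"
  "foldr (shifted \<omega>) ts 0 = 0"
  by (induction ts) (simp_all add: shifted_linear)

lemma shifted_commute: "shifted \<omega> s (shifted \<omega> t u) = shifted \<omega> t (shifted \<omega> s u)"
  by (simp add: shifted_def act_diff_right act_scale scale_right_diff_distrib mult.commute algebra_simps)

lemma foldr_shifted_commute1: "foldr (shifted \<omega>) ts (shifted \<omega> t u) = shifted \<omega> t (foldr (shifted \<omega>) ts u)"
  by (induction ts) (simp_all add: shifted_commute)

lemma foldr_shifted_commute: "foldr (shifted \<omega>) ts (foldr (shifted \<omega>) ts' u) = foldr (shifted \<omega>) ts' (foldr (shifted \<omega>) ts u)"
  by (induction ts') (simp_all add: foldr_shifted_commute1)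

lemma low_add:
  assumes "low \<omega> u" "low \<omega> u'"
  shows "low \<omega> (u + u')"
proof -
  obtain ts ts' where ts: "\<forall>t\<in>set ts. t > 0" "foldr (shifted \<omega>) ts u = 0" "\<forall>t\<in>set ts'. t > 0" "foldr (shifted \<omega>) ts' u' = 0"
    using assms by (auto simp: low_def)
  have "foldr (shifted \<omega>) (ts @ ts') (u + u') = 0"
    using ts foldr_shifted_commute[of \<omega> ts ts' u] by (simp add: foldr_shifted_linear)
  then show ?thesis
    unfolding low_def using ts by (intro exI[of _ "ts @ ts'"]) auto
qed

lemma low_scale: "low \<omega> u \<Longrightarrow> low \<omega> (scale c u)"
  by (auto simp: low_def foldr_shifted_linear)

lemma low_0: "low \<omega> 0"
  unfolding low_def by (rule exI[of _ "[]"]) simp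

text \<open>\<open>x^-\<close> shifts the exponent of the eigenvalue by \<open>grade g j\<close>.
  The list of exponents that annihilates \<open>u\<close> is therefore translated by a positive
  amount and stays positive.\<close>

lemma low_x:
  assumes "valid_lie_type g" "j \<in> nodes g" "q \<noteq> 0" "low \<omega> u"
  shows "low \<omega> (act (gx Minus j n) u)"
proof -
  let ?x = "act (gx Minus j n)"
  obtain ts where ts: "\<forall>t\<in>set ts. t > 0" "foldr (shifted \<omega>) ts u = 0"
    using assms by (auto simp: low_def)
  have sh: "shifted \<omega> (t + grade g j) (?x u) = scale (q powi (- grade g j)) (?x (shifted \<omega> t u))" for t u
  proof -
    have "q powi (- (t + grade g j)) = q powi (- grade g j) * q powi (- t)"
      using powi_add[OF assms(3), of "- grade g j" "- t"] by (simp add: algebra_simps)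
    then show ?thesis
      by (simp only: shifted_def grading_elt_qcomm[OF assms(2,3)] act_diff_right act_scale scale_right_diff_distrib scale_scale mult_ac)
  qed
  have "\<exists>c. foldr (shifted \<omega>) (map (\<lambda>t. t + grade g j) ts) (?x u) = scale c (?x (foldr (shifted \<omega>) ts u))"
  proof (induction ts)
    case Nil
    show ?case
      by (rule exI[of _ 1]) simp
  next
    case (Cons t ts)
    then obtain c where "foldr (shifted \<omega>) (map (\<lambda>t. t + grade g j) ts) (?x u) = scale c (?x (foldr (shifted \<omega>) ts u))"
      by blast
    then have "foldr (shifted \<omega>) (map (\<lambda>t. t + grade g j) (t # ts)) (?x u)
       = scale (c * q powi (- grade g j)) (?x (foldr (shifted \<omega>) (t # ts) u))"
      by (simp add: shifted_linear sh del: scale_scale) simp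
    then show ?case
      by blast
  qed
  then have "foldr (shifted \<omega>) (map (\<lambda>t. t + grade g j) ts) (?x u) = 0"
    using ts(2) by auto
  moreover have "\<forall>t\<in>set (map (\<lambda>t. t + grade g j) ts). t > 0"
    using ts(1) grade_pos[OF assms(1,2)] by auto
  ultimately show ?thesis
    unfolding low_def by blast
qed

lemma low_x_highest:
  assumes "valid_lie_type g" "j \<in> nodes g" "q \<noteq> 0" "act (grading_elt g) v = scale \<omega> v"
  shows "low \<omega> (act (gx Minus j n) v)"
proof -
  have "shifted \<omega> (grade g j) (act (gx Minus j n) v) = 0"
    by (simp add: shifted_def grading_elt_qcomm[OF assms(2,3)] assms(4) act_scale mult.commute)
  then show ?thesis
    unfolding low_def using grade_pos[OF assms(1,2)] by (intro exI[of _ "[grade g j]"]) simp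
qed

lemma not_low_highest:
  assumes "q \<noteq> 0" "not_root_of_unity q" "act (grading_elt g) v = scale \<omega> v" "\<omega> \<noteq> 0" "v \<noteq> 0"
  shows "\<not> low \<omega> v"
proof -
  have "shifted \<omega> t v = scale (\<omega> - \<omega> * q powi (- t)) v" for t
    by (simp only: shifted_def assms(3) scale_left_diff_distrib)
  then have "foldr (shifted \<omega>) ts v = scale (\<Prod>t\<leftarrow>ts. \<omega> - \<omega> * q powi (- t)) v" for ts
    by (induction ts) (simp_all add: shifted_linear mult.commute)
  moreover have "(\<Prod>t\<leftarrow>ts. \<omega> - \<omega> * q powi (- t)) \<noteq> 0" if "\<forall>t\<in>set ts. t > 0" for ts
  proof -
    have "\<omega> - \<omega> * q powi (- t) \<noteq> 0" if "t \<in> set ts" for t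
      using powi_eq_1_iff[OF assms(1,2), of "- t"] assms(4) \<open>\<forall>t\<in>set ts. t > 0\<close> that by auto
    then show ?thesis
      by (auto simp: prod_list_zero_iff)
  qed
  ultimately show ?thesis
    using assms(5) by (auto simp: low_def)
qed

end

context thin_module
begin

text \<open>Modulo lower weights, \<open>u\<close> is \<open>w bot\<close> times \<open>v\<close>.
  Every rule of the graph preserves this: \<open>x^-\<close> produces lower weights only, and
  \<open>wm\<close> never reaches \<open>bot\<close>.\<close>

lemma Gr_top:
  obtains \<omega> where "\<And>u w. Gr u w \<Longrightarrow> low \<omega> (u - scale (w bot) v)" "\<not> low \<omega> v"
proof -
  obtain \<omega> where \<omega>: "act (grading_elt g) v = scale \<omega> v" "\<omega> \<noteq> 0"
  proof (rule grading_elt_scalar)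
    show "act (gk Plus i) v = scale (k_eig g q i (M bot)) v" if "i \<in> nodes g" for i
      using v_eigen(1)[OF that, of Plus] by simp
    show "k_eig g q i (M bot) \<noteq> 0" for i
      by (rule k_eig_nonzero[OF q0])
  qed
  have "low \<omega> (u - scale (w bot) v)" if "Gr u w" for u w
    using that
  proof (induction rule: Gr.induct)
    case base
    then show ?case
      by (simp add: ind_def low_0)
  next
    case (add u w u' w')
    from low_add[OF add.IH] show ?case
      by (simp add: scale_left_distrib algebra_simps)
  next
    case (scale u w c)
    from low_scale[OF scale.IH, of c] show ?case
      by (simp add: scale_right_diff_distrib)
  next
    case (lower u w j n)
    have "dn bot \<beta> \<notin> X" for \<beta>
      using bot_le[of "dn bot \<beta>" \<beta>] by auto
    then have "wm j n w bot = 0"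
      by (simp add: wm_def ins_def)
    have "low \<omega> (act (gx Minus j n) (u - scale (w bot) v) + scale (w bot) (act (gx Minus j n) v))"
      by (intro low_add low_scale low_x low_x_highest valid lower q0 \<omega>)
    then show ?case
      by (simp add: \<open>wm j n w bot = 0\<close> act_diff_right act_scale)
  qed
  moreover have "\<not> low \<omega> v"
    by (rule not_low_highest[OF q0 q_nru \<omega> v_nonzero])
  ultimately show thesis
    using that by blast
qed

lemma Gr_zero_top: "Gr 0 w \<Longrightarrow> w bot = 0"
proof -
  assume *: "Gr 0 w"
  obtain \<omega> where \<omega>: "\<And>u w. Gr u w \<Longrightarrow> low \<omega> (u - scale (w bot) v)" "\<not> low \<omega> v"
    using Gr_top by blast
  from low_scale[OF \<omega>(1)[OF *], of "- inverse (w bot)"] show "w bot = 0"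
    using \<omega>(2) by (cases "w bot = 0") (simp_all add: scale_minus_left)
qed

lemma not_Gr_v_zero: "\<not> Gr v (\<lambda>_. 0)"
proof
  assume *: "Gr v (\<lambda>_. 0)"
  obtain \<omega> where \<omega>: "\<And>u w. Gr u w \<Longrightarrow> low \<omega> (u - scale (w bot) v)" "\<not> low \<omega> v"
    using Gr_top by blast
  from \<omega>(1)[OF *] \<omega>(2) show False
    by simp
qed

lemma Gr_right_zero:
  assumes "Gr u (\<lambda>_. 0)"
  shows "u = 0"
proof -
  let ?W = "{u. Gr u (\<lambda>_. 0)}"
  have sub: "subspace ?W"
  proof (rule subspaceI)
    show "x + y \<in> ?W" if "x \<in> ?W" "y \<in> ?W" for x y
      using Gr.add[of x _ y] that by fastforce
    show "scale c x \<in> ?W" if "x \<in> ?W" for c x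
      using Gr.scale[of x _ c] that by fastforce
  qed (simp add: Gr_zero)
  have "act y x \<in> ?W" if "x \<in> ?W" for x y
  proof (rule act_closed[OF sub _ that])
    fix z u assume "u \<in> ?W"
    then show "act (free_gen z) u \<in> ?W"
      using Gr_gen[of u "\<lambda>_. 0" z] by (metis mem_Collect_eq)
  qed
  with sub have "submodule ?W"
    by (auto simp: submodule_def)
  with irred have "?W = {0} \<or> ?W = UNIV"
    unfolding irreducible_module_def by blast
  moreover have "v \<notin> ?W"
    using not_Gr_v_zero by simp
  ultimately have "?W = {0}"
    by blast
  then show ?thesis
    using assms by blast
qed

lemma Gr_total: "\<exists>w. Gr u w"
proof -
  let ?W = "{u. \<exists>w. Gr u w}"
  have sub: "subspace ?W"
    by (rule subspaceI) (blast intro: Gr_zero Gr.add Gr.scale)+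
  have "act y x \<in> ?W" if "x \<in> ?W" for x y
  proof (rule act_closed[OF sub _ that])
    fix z u assume "u \<in> ?W"
    then obtain w where "Gr u w"
      by blast
    then show "act (free_gen z) u \<in> ?W"
      by (rule Gr_gen[of u w z]) blast
  qed
  with sub have "submodule ?W"
    by (auto simp: submodule_def)
  with irred have "?W = {0} \<or> ?W = UNIV"
    unfolding irreducible_module_def by blast
  moreover have "v \<in> ?W"
    using Gr.base by blast
  ultimately show ?thesis
    using v_nonzero by blast
qed

section \<open>Bijectivity on the side of the tableaux\<close>

definition height :: "('b \<Rightarrow> int) \<Rightarrow> int" where
  "height \<tau> = (\<Sum>\<beta>\<in>P. \<tau> \<beta> - bot \<beta>)"

lemma height_induct [consumes 1, case_names bot up]:
  assumes "\<tau> \<in> X" "Q bot"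
    and "\<And>\<sigma> i \<beta>. \<sigma> \<in> X \<Longrightarrow> Q \<sigma> \<Longrightarrow> \<beta> \<in> outs i \<sigma> \<Longrightarrow> i \<in> nodes g \<Longrightarrow> Q (up \<sigma> \<beta>)"
  shows "Q \<tau>"
  using assms(1)
proof (induction "nat (height \<tau>)" arbitrary: \<tau> rule: less_induct)
  case less
  show ?case
  proof (cases "\<tau> = bot")
    case False
    then obtain \<beta> where \<beta>: "\<beta> \<in> P" "dn \<tau> \<beta> \<in> X"
      using lowerable[OF less.prems] by (auto simp: dn_def)
    have "height \<tau> = height (dn \<tau> \<beta>) + 1"
      using \<beta>(1) finite_P unfolding height_def by (simp add: sum.remove[of P \<beta>])
    moreover have "height (dn \<tau> \<beta>) \<ge> 0"
      unfolding height_def using bot_le[OF \<beta>(2)] by (intro sum_nonneg) simp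
    ultimately have Q: "Q (dn \<tau> \<beta>)"
      using less.hyps[of "dn \<tau> \<beta>"] \<beta>(2) by simp
    have o: "\<beta> \<in> outs (fst (par \<beta> (\<tau> \<beta> - 1))) (dn \<tau> \<beta>)"
      using \<beta> less.prems by (simp add: outs_def)
    from assms(3)[OF \<beta>(2) Q o outs_node[OF \<beta>(2) o]] show ?thesis
      by simp
  qed (simp add: assms(2))
qed

text \<open>Applying \<open>x^+\<close> with all nonnegative modes to the pair (0, w) gives
  vanishing power sums in the spectral parameters of the steps out of \<open>\<sigma>\<close> at one
  node. These parameters are distinct and \<open>cp\<close> is nonzero, so \<open>w\<close> vanishes
  one step higher.\<close>

lemma Gr_left_zero:
  assumes "\<tau> \<in> X"
  shows "Gr 0 w \<Longrightarrow> w \<tau> = 0"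
  using assms
proof (induction arbitrary: w rule: height_induct)
  case bot
  then show ?case
    by (rule Gr_zero_top)
next
  case (up \<sigma> i \<beta>)
  have "(\<Sum>\<beta>\<in>outs i \<sigma>. (cp \<sigma> \<beta> * w (up \<sigma> \<beta>)) * pout \<sigma> \<beta> ^ n) = 0" for n
  proof -
    have "Gr 0 (wp i (int n) w)"
      using Gr_xp[OF up.prems up.hyps(3), of "int n"] by simp
    then have "wp i (int n) w \<sigma> = 0"
      by (rule up.IH)
    then show ?thesis
      using up.hyps(1) by (simp add: wp_def mult_ac)
  qed
  from power_sums_zero_inj[OF finite_outs _ up.hyps(2) this] have "cp \<sigma> \<beta> * w (up \<sigma> \<beta>) = 0"
    using pout_inj[OF up.hyps(1)] by (auto simp: inj_on_def)
  then show ?case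
    by simp
qed

lemma Gr_unique: "Gr u w \<Longrightarrow> Gr u w' \<Longrightarrow> w = w'"
proof
  fix \<tau>
  assume *: "Gr u w" "Gr u w'"
  show "w \<tau> = w' \<tau>"
  proof (cases "\<tau> \<in> X")
    case True
    from Gr_left_zero[OF this, of "\<lambda>\<tau>. w \<tau> - w' \<tau>"] Gr_diff[OF *] show ?thesis
      by simp
  qed (use Gr_support[OF *(1)] Gr_support[OF *(2)] in simp)
qed

lemma wm_ind:
  assumes "\<sigma> \<in> X"
  shows "wm i n (ind \<sigma>) \<rho> = (\<Sum>\<beta>\<in>outs i \<sigma>. cm \<sigma> \<beta> * pout \<sigma> \<beta> powi n * ind (up \<sigma> \<beta>) \<rho>)"
proof (cases "\<rho> \<in> X")
  case True
  have iff: "dn \<rho> \<beta> = \<sigma> \<longleftrightarrow> \<rho> = up \<sigma> \<beta>" for \<beta>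
    using up_dn[of \<rho> \<beta>] dn_up[of \<sigma> \<beta>] by metis
  have "(\<Sum>\<beta>\<in>ins i \<rho>. cm (dn \<rho> \<beta>) \<beta> * pin \<rho> \<beta> powi n * ind \<sigma> (dn \<rho> \<beta>))
     = (\<Sum>\<beta>\<in>outs i \<sigma>. cm \<sigma> \<beta> * pout \<sigma> \<beta> powi n * ind (up \<sigma> \<beta>) \<rho>)"
  proof (rule sum.mono_neutral_cong)
    show "cm \<sigma> \<beta> * pout \<sigma> \<beta> powi n * ind (up \<sigma> \<beta>) \<rho> = 0" if "\<beta> \<in> outs i \<sigma> - ins i \<rho>" for \<beta>
      using that outs_ins[of \<beta> i \<sigma>] assms by (auto simp: ind_def)
    show "cm (dn \<rho> \<beta>) \<beta> * pin \<rho> \<beta> powi n * ind \<sigma> (dn \<rho> \<beta>) = 0" if "\<beta> \<in> ins i \<rho> - outs i \<sigma>" for \<beta>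
      using that ins_outs[of \<beta> i \<rho>] True by (auto simp: ind_def)
    show "cm (dn \<rho> \<beta>) \<beta> * pin \<rho> \<beta> powi n * ind \<sigma> (dn \<rho> \<beta>) = cm \<sigma> \<beta> * pout \<sigma> \<beta> powi n * ind (up \<sigma> \<beta>) \<rho>" for \<beta>
      using iff[of \<beta>] by (auto simp: ind_def)
  qed simp_all
  then show ?thesis
    using True by (simp add: wm_def)
next
  case False
  then have "(\<Sum>\<beta>\<in>outs i \<sigma>. cm \<sigma> \<beta> * pout \<sigma> \<beta> powi n * ind (up \<sigma> \<beta>) \<rho>) = 0"
    by (intro sum.neutral) (auto simp: outs_def ind_def)
  then show ?thesis
    using False by (simp add: wm_def)
qed

text \<open>The steps out of \<open>\<sigma>\<close> at one node have distinct spectral parameters.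
  A Lagrange polynomial, read as a combination of modes of \<open>x^-\<close>, therefore isolates a
  single step.\<close>

lemma Gr_surj: "\<tau> \<in> X \<Longrightarrow> \<exists>u. Gr u (ind \<tau>)"
proof (induction rule: height_induct)
  case bot
  then show ?case
    using Gr.base by blast
next
  case (up \<sigma> i \<beta>)
  then obtain u where u: "Gr u (ind \<sigma>)"
    by blast
  have inj: "inj_on (pout \<sigma>) (outs i \<sigma>)"
    using pout_inj[OF up.hyps(1)] by (auto simp: inj_on_def)
  obtain p where p: "poly p (pout \<sigma> \<beta>) = 1" "\<And>b. b \<in> pout \<sigma> ` outs i \<sigma> \<Longrightarrow> b \<noteq> pout \<sigma> \<beta> \<Longrightarrow> poly p b = 0"
    using interpolation[of "pout \<sigma> ` outs i \<sigma>" "pout \<sigma> \<beta>"] up.hyps(2) by auto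
  let ?u = "scale (1 / cm \<sigma> \<beta>) (\<Sum>n\<le>degree p. scale (coeff p n) (act (gx Minus i (int n)) u))"
  have "Gr ?u (\<lambda>\<rho>. 1 / cm \<sigma> \<beta> * (\<Sum>n\<le>degree p. coeff p n * wm i (int n) (ind \<sigma>) \<rho>))"
    by (intro Gr.scale Gr_sum Gr.lower u up.hyps(3))
  moreover have "1 / cm \<sigma> \<beta> * (\<Sum>n\<le>degree p. coeff p n * wm i (int n) (ind \<sigma>) \<rho>) = ind (up \<sigma> \<beta>) \<rho>" for \<rho>
  proof -
    have "(\<Sum>n\<le>degree p. coeff p n * wm i (int n) (ind \<sigma>) \<rho>)
       = (\<Sum>n\<le>degree p. \<Sum>\<beta>\<in>outs i \<sigma>. cm \<sigma> \<beta> * ind (up \<sigma> \<beta>) \<rho> * (coeff p n * pout \<sigma> \<beta> ^ n))"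
      by (simp add: wm_ind[OF up.hyps(1)] sum_distrib_left mult_ac)
    also have "\<dots> = (\<Sum>\<beta>\<in>outs i \<sigma>. cm \<sigma> \<beta> * ind (up \<sigma> \<beta>) \<rho> * poly p (pout \<sigma> \<beta>))"
      by (subst sum.swap) (simp add: poly_altdef sum_distrib_left)
    also have "\<dots> = (\<Sum>\<beta>'\<in>outs i \<sigma>. if \<beta>' = \<beta> then cm \<sigma> \<beta> * ind (up \<sigma> \<beta>) \<rho> else 0)"
      using p inj up.hyps(2) by (intro sum.cong) (auto simp: inj_on_def)
    also have "\<dots> = cm \<sigma> \<beta> * ind (up \<sigma> \<beta>) \<rho>"
      using up.hyps(2) by simp
    finally show ?thesis
      by simp
  qed
  ultimately show ?case
    by auto
qed

section \<open>The l-weight spaces of the module\<close>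

definition vec :: "('b \<Rightarrow> int) \<Rightarrow> 'v" where
  "vec \<tau> = (SOME u. Gr u (ind \<tau>))"

lemma Gr_vec: "\<tau> \<in> X \<Longrightarrow> Gr (vec \<tau>) (ind \<tau>)"
  unfolding vec_def using Gr_surj by (rule someI_ex)

lemma Gr_lincomb:
  assumes "F \<subseteq> X"
  shows "Gr (\<Sum>\<tau>\<in>F. scale (c \<tau>) (vec \<tau>)) (\<lambda>\<rho>. if \<rho> \<in> F then c \<rho> else 0)"
proof -
  have "Gr (\<Sum>\<tau>\<in>F. scale (c \<tau>) (vec \<tau>)) (\<lambda>\<rho>. \<Sum>\<tau>\<in>F. c \<tau> * ind \<tau> \<rho>)"
    using assms by (intro Gr_sum Gr.scale Gr_vec) auto
  moreover have "(\<Sum>\<tau>\<in>F. c \<tau> * ind \<tau> \<rho>) = (if \<rho> \<in> F then c \<rho> else 0)" for \<rho>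
    using finite_subset[OF assms finite_X] by (simp add: ind_def if_distrib[of "\<lambda>x. c _ * x"] cong: if_cong)
  ultimately show ?thesis
    by simp
qed

lemma Gr_expand:
  assumes "Gr u w" "F \<subseteq> X" "\<And>\<tau>. \<tau> \<in> X \<Longrightarrow> \<tau> \<notin> F \<Longrightarrow> w \<tau> = 0"
  shows "u = (\<Sum>\<tau>\<in>F. scale (w \<tau>) (vec \<tau>))"
proof -
  have "Gr (u - (\<Sum>\<tau>\<in>F. scale (w \<tau>) (vec \<tau>))) (\<lambda>\<rho>. w \<rho> - (if \<rho> \<in> F then w \<rho> else 0))"
    by (intro Gr_diff assms(1) Gr_lincomb assms(2))
  moreover have "(\<lambda>\<rho>. w \<rho> - (if \<rho> \<in> F then w \<rho> else 0)) = (\<lambda>_. 0)"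
    using assms(3) Gr_support[OF assms(1)] by (force simp: fun_eq_iff)
  ultimately have "Gr (u - (\<Sum>\<tau>\<in>F. scale (w \<tau>) (vec \<tau>))) (\<lambda>_. 0)"
    by (simp only:)
  then have "u - (\<Sum>\<tau>\<in>F. scale (w \<tau>) (vec \<tau>)) = 0"
    by (rule Gr_right_zero)
  then show ?thesis
    by simp
qed

text \<open>Under the graph \<open>phi\<close> becomes diagonal, so a power of its difference with a
  scalar kills the same coordinates as the difference itself. Coordinates with distinct monomials
  are separated by \<open>l_weight_inj\<close>.\<close>

lemma l_weight_space_iff:
  assumes m: "m \<in> monomials g" and u: "Gr u w"
  shows "u \<in> l_weight_space m \<longleftrightarrow> (\<forall>\<tau>\<in>X. w \<tau> \<noteq> 0 \<longrightarrow> M \<tau> = m)"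
proof -
  let ?d = "\<lambda>e i r \<tau>. fps_nth (l_weight g q (M \<tau>) e i) r - fps_nth (l_weight g q m e i) r"
  have iter: "Gr (((\<lambda>w. act (phi q e i r) w - scale (fps_nth (l_weight g q m e i) r) w) ^^ p) u) (\<lambda>\<tau>. ?d e i r \<tau> ^ p * w \<tau>)"
    if "i \<in> nodes g" for e i r p
  proof (induction p)
    case (Suc p)
    from Gr_diff[OF Gr_phi[OF Suc that, of e r] Gr.scale[OF Suc, of "fps_nth (l_weight g q m e i) r"]]
    show ?case
      by (simp add: algebra_simps)
  qed (simp add: u)
  show ?thesis
  proof
    assume "u \<in> l_weight_space m"
    then obtain p where p: "\<And>i e r. i \<in> nodes g \<Longrightarrow>
        ((\<lambda>w. act (phi q e i r) w - scale (fps_nth (l_weight g q m e i) r) w) ^^ p) u = 0"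
      unfolding l_weight_space_def by blast
    show "\<forall>\<tau>\<in>X. w \<tau> \<noteq> 0 \<longrightarrow> M \<tau> = m"
    proof (intro ballI impI)
      fix \<tau> assume \<tau>: "\<tau> \<in> X" "w \<tau> \<noteq> 0"
      have "l_weight g q (M \<tau>) Plus i = l_weight g q m Plus i" if i: "i \<in> nodes g" for i
      proof (rule fps_ext)
        fix r
        have "Gr 0 (\<lambda>\<tau>. ?d Plus i r \<tau> ^ p * w \<tau>)"
          using iter[OF i, where e = Plus and r = r and p = p] p[OF i, of Plus r] by simp
        from Gr_left_zero[OF \<tau>(1) this] have "?d Plus i r \<tau> ^ p * w \<tau> = 0" .
        then show "fps_nth (l_weight g q (M \<tau>) Plus i) r = fps_nth (l_weight g q m Plus i) r"
          using \<tau>(2) by simp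
      qed
      then show "M \<tau> = m"
        by (rule l_weight_inj[OF q0 q_nru M_monomial[OF \<tau>(1)] m])
    qed
  next
    assume *: "\<forall>\<tau>\<in>X. w \<tau> \<noteq> 0 \<longrightarrow> M \<tau> = m"
    have "((\<lambda>w. act (phi q e i r) w - scale (fps_nth (l_weight g q m e i) r) w) ^^ 1) u = 0" if i: "i \<in> nodes g" for e i r
    proof (rule Gr_right_zero)
      have "?d e i r \<tau> ^ 1 * w \<tau> = 0" for \<tau>
        using * Gr_support[OF u, of \<tau>] by (cases "\<tau> \<in> X") auto
      then have "(\<lambda>\<tau>. ?d e i r \<tau> ^ 1 * w \<tau>) = (\<lambda>_. 0)"
        by (rule ext)
      then show "Gr (((\<lambda>w. act (phi q e i r) w - scale (fps_nth (l_weight g q m e i) r) w) ^^ 1) u) (\<lambda>_. 0)"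
        using iter[OF i, where e = e and r = r and p = 1] by (simp only:)
    qed
    then show "u \<in> l_weight_space m"
      unfolding l_weight_space_def by blast
  qed
qed

lemma dim_l_weight_space:
  assumes m: "m \<in> monomials g"
  shows "dim (l_weight_space m) = card {\<tau> \<in> X. M \<tau> = m}"
proof -
  let ?F = "{\<tau> \<in> X. M \<tau> = m}"
  have fin: "finite ?F"
    using finite_X by simp
  have inj: "inj_on vec ?F"
  proof
    fix \<sigma> \<tau> assume *: "\<sigma> \<in> ?F" "\<tau> \<in> ?F" "vec \<sigma> = vec \<tau>"
    then have "ind \<sigma> = ind \<tau>"
      using Gr_unique[OF Gr_vec[of \<sigma>], of "ind \<tau>"] Gr_vec[of \<tau>] by simp
    then have "ind \<sigma> \<sigma> = ind \<tau> \<sigma>"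
      by simp
    then show "\<sigma> = \<tau>"
      by (simp add: ind_def split: if_splits)
  qed
  have "vec ` ?F \<subseteq> l_weight_space m"
    using l_weight_space_iff[OF m Gr_vec] by (auto simp: ind_def)
  moreover have "l_weight_space m \<subseteq> span (vec ` ?F)"
  proof
    fix u assume u: "u \<in> l_weight_space m"
    obtain w where w: "Gr u w"
      using Gr_total by blast
    have "u = (\<Sum>\<tau>\<in>?F. scale (w \<tau>) (vec \<tau>))"
      by (rule Gr_expand[OF w]) (use u l_weight_space_iff[OF m w] in auto)
    also have "\<dots> \<in> span (vec ` ?F)"
      by (intro span_sum span_scale span_base) auto
    finally show "u \<in> span (vec ` ?F)" .
  qed
  moreover have "independent (vec ` ?F)"
  proof (rule independent_if_scalars_zero)
    fix f x assume z: "(\<Sum>x\<in>vec ` ?F. scale (f x) x) = 0" and x: "x \<in> vec ` ?F"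
    then obtain \<tau> where \<tau>: "\<tau> \<in> ?F" "x = vec \<tau>"
      by blast
    have "(\<Sum>\<tau>\<in>?F. scale (f (vec \<tau>)) (vec \<tau>)) = 0"
      using z inj by (simp add: sum.reindex)
    then have "Gr 0 (\<lambda>\<rho>. if \<rho> \<in> ?F then f (vec \<rho>) else 0)"
      using Gr_lincomb[of ?F "\<lambda>\<tau>. f (vec \<tau>)"] by simp
    from Gr_left_zero[OF _ this, of \<tau>] show "f x = 0"
      using \<tau> by auto
  qed (use fin in simp)
  ultimately have "card (vec ` ?F) = dim (l_weight_space m)"
    by (rule basis_card_eq_dim)
  then show ?thesis
    using card_image[OF inj] by simp
qed

theorem q_character_eq: "q_character = (\<Sum>\<tau>\<in>X. Poly_Mapping.single (M \<tau>) 1)"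
proof -
  have sing: "(\<Sum>\<tau>\<in>F. Poly_Mapping.single (M \<tau>) 1) = Poly_Mapping.single m (int (card F))"
    if "finite F" "\<And>\<tau>. \<tau> \<in> F \<Longrightarrow> M \<tau> = m" for F m
    using that
  proof (induction F rule: finite_induct)
    case (insert \<tau> F)
    have "(\<Sum>\<tau>\<in>insert \<tau> F. Poly_Mapping.single (M \<tau>) 1) = Poly_Mapping.single m 1 + Poly_Mapping.single m (int (card F))"
      using insert.IH insert.prems by (simp only: sum.insert[OF insert.hyps] insertI1 insertI2)
    also have "\<dots> = Poly_Mapping.single m (int (card (insert \<tau> F)))"
      by (simp only: single_add[symmetric] card_insert_disjoint[OF insert.hyps] of_nat_Suc)
    finally show ?case .
  qed simp
  have ne: "l_weight_space m \<noteq> {0} \<longleftrightarrow> m \<in> M ` X" if m: "m \<in> monomials g" for m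
  proof
    assume "l_weight_space m \<noteq> {0}"
    moreover have "0 \<in> l_weight_space m"
      using l_weight_space_iff[OF m Gr_zero] by simp
    ultimately obtain u where u: "u \<in> l_weight_space m" "u \<noteq> 0"
      by blast
    obtain w where w: "Gr u w"
      using Gr_total by blast
    then obtain \<tau> where "w \<tau> \<noteq> 0"
      using u(2) Gr_right_zero[of u] by (metis ext)
    then show "m \<in> M ` X"
      using l_weight_space_iff[OF m w] u(1) Gr_support[OF w] by blast
  next
    assume "m \<in> M ` X"
    then obtain \<tau> where \<tau>: "\<tau> \<in> X" "M \<tau> = m"
      by blast
    have "vec \<tau> \<in> l_weight_space m"
      using l_weight_space_iff[OF m Gr_vec[OF \<tau>(1)]] \<tau> by (auto simp: ind_def)
    moreover have "vec \<tau> \<noteq> 0"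
      using Gr_left_zero[OF \<tau>(1), of "ind \<tau>"] Gr_vec[OF \<tau>(1)] by (auto simp: ind_def)
    ultimately show "l_weight_space m \<noteq> {0}"
      by blast
  qed
  have "{m \<in> monomials g. l_weight_space m \<noteq> {0}} = M ` X"
    using ne M_monomial by blast
  then have "q_character = (\<Sum>m\<in>M ` X. Poly_Mapping.single m (int (dim (l_weight_space m))))"
    by (simp add: q_character_def)
  also have "\<dots> = (\<Sum>m\<in>M ` X. \<Sum>\<tau> | \<tau> \<in> X \<and> M \<tau> = m. Poly_Mapping.single (M \<tau>) 1)"
  proof (intro sum.cong refl)
    fix m assume "m \<in> M ` X"
    then have m: "m \<in> monomials g"
      using M_monomial by blast
    show "Poly_Mapping.single m (int (dim (l_weight_space m))) = (\<Sum>\<tau> | \<tau> \<in> X \<and> M \<tau> = m. Poly_Mapping.single (M \<tau>) 1)"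
      unfolding dim_l_weight_space[OF m] by (rule sing[symmetric]) (use finite_X in auto)
  qed
  also have "\<dots> = (\<Sum>\<tau>\<in>X. Poly_Mapping.single (M \<tau>) 1)"
    by (rule sum.image_gen[OF finite_X, symmetric])
  finally show ?thesis .
qed

end

section \<open>Tableaux of skew shape\<close>

text \<open>Letters are encoded as integers \<open>1..n\<close>.  In both types the column condition for \<open>x\<close> above
  \<open>y\<close> is the negation of the row condition for \<open>y\<close> left of \<open>x\<close>.\<close>

locale skew_tableaux =
  fixes n :: int and H :: "int \<Rightarrow> int \<Rightarrow> bool" and S :: "(int \<times> nat) set"
  assumes H_mono: "\<And>x y x' y'. H x y \<Longrightarrow> x' \<le> x \<Longrightarrow> y \<le> y' \<Longrightarrow> H x' y'"
    and H_less: "\<And>x y. x < y \<Longrightarrow> H x y"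
    and H_le: "\<And>x y. H x y \<Longrightarrow> x \<le> y"
    and finite_S: "finite S"
    and rect: "\<And>s t s' t' s1 t1. (s, t) \<in> S \<Longrightarrow> (s', t') \<in> S \<Longrightarrow> s \<le> s1 \<Longrightarrow> s1 \<le> s' \<Longrightarrow> t \<le> t1 \<Longrightarrow> t1 \<le> t' \<Longrightarrow> (s1, t1) \<in> S"
begin

text \<open>The fixed value 0 outside \<open>S\<close> makes a function determined by its entries on
  \<open>S\<close>, and lets order, minimum and maximum be taken pointwise.\<close>

definition tabs :: "(int \<times> nat \<Rightarrow> int) set" where
  "tabs = {\<tau>. (\<forall>\<beta>\<in>S. 1 \<le> \<tau> \<beta> \<and> \<tau> \<beta> \<le> n) \<and> (\<forall>\<beta>. \<beta> \<notin> S \<longrightarrow> \<tau> \<beta> = 0)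
     \<and> (\<forall>s t. (s, t) \<in> S \<and> (s, t + 1) \<in> S \<longrightarrow> H (\<tau> (s, t)) (\<tau> (s, t + 1)))
     \<and> (\<forall>s t. (s, t) \<in> S \<and> (s + 1, t) \<in> S \<longrightarrow> \<not> H (\<tau> (s + 1, t)) (\<tau> (s, t)))}"

text \<open>The position of a box enters its spectral parameter only through this number.\<close>

definition diag :: "int \<times> nat \<Rightarrow> int" where
  "diag \<beta> = int (snd \<beta>) - fst \<beta>"

lemma diag_pair [simp]: "diag (s, t) = int t - s"
  by (simp add: diag_def)

lemma tabs_range: "\<tau> \<in> tabs \<Longrightarrow> \<beta> \<in> S \<Longrightarrow> 1 \<le> \<tau> \<beta> \<and> \<tau> \<beta> \<le> n"
  by (simp add: tabs_def)

lemma tabs_outside: "\<tau> \<in> tabs \<Longrightarrow> \<beta> \<notin> S \<Longrightarrow> \<tau> \<beta> = 0"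
  unfolding tabs_def by blast

lemma tabs_row: "\<tau> \<in> tabs \<Longrightarrow> (s, t) \<in> S \<Longrightarrow> (s, t + 1) \<in> S \<Longrightarrow> H (\<tau> (s, t)) (\<tau> (s, t + 1))"
  by (simp add: tabs_def)

lemma tabs_col: "\<tau> \<in> tabs \<Longrightarrow> (s, t) \<in> S \<Longrightarrow> (s + 1, t) \<in> S \<Longrightarrow> \<not> H (\<tau> (s + 1, t)) (\<tau> (s, t))"
  by (simp add: tabs_def)

lemma finite_tabs: "finite tabs"
proof -
  have "tabs \<subseteq> {\<tau>. \<forall>\<beta>. (\<beta> \<in> S \<longrightarrow> \<tau> \<beta> \<in> {1..n}) \<and> (\<beta> \<notin> S \<longrightarrow> \<tau> \<beta> = 0)}"
    by (auto simp: tabs_def)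
  then show ?thesis
    using finite_set_of_finite_funs[OF finite_S, of "{1..n}" 0] finite_subset by blast
qed

lemma weakly_increasing:
  assumes "\<tau> \<in> tabs" "(s, t) \<in> S" "(s', t') \<in> S" "s \<le> s'" "t \<le> t'"
  shows "\<tau> (s, t) \<le> \<tau> (s', t')"
proof -
  have row: "\<tau> (s, t) \<le> \<tau> (s, t1)" if "t \<le> t1" "(s, t1) \<in> S" for t1
    using that
  proof (induction t1 rule: dec_induct)
    case (step t1)
    have "(s, t1) \<in> S"
      using rect[OF assms(2) step.prems] step.hyps by simp
    then show ?case
      using step.IH tabs_row[OF assms(1), of s t1] step.prems H_le by fastforce
  qed simp
  have col: "\<tau> (s, t') \<le> \<tau> (s1, t')" if "s \<le> s1" "(s, t') \<in> S" "(s1, t') \<in> S" for s1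
    using that
  proof (induction s1 rule: int_ge_induct)
    case (step s1)
    have "(s1, t') \<in> S"
      using rect[OF step.prems(1,2)] step.hyps by simp
    then show ?case
      using step.IH[OF step.prems(1)] tabs_col[OF assms(1), of s1 t'] step.prems(2) H_less
      by (meson linorder_not_less order_trans)
  qed simp
  have "(s, t') \<in> S"
    using rect[OF assms(2,3)] assms(4,5) by simp
  then show ?thesis
    using row[OF assms(5)] col[OF assms(4)] assms(3) by fastforce
qed

text \<open>If y stands to the right of x and above z, then \<open>H x y\<close> and
  \<open>\<not> H z y\<close>, and monotonicity rules out z \<le> x. Growth along diagonals is thus
  strict even where rows or columns admit equal letters.\<close>

lemma diag_increasing:
  assumes "\<tau> \<in> tabs" "(s, t) \<in> S" "(s', t') \<in> S" "s < s'" "t < t'"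
  shows "\<tau> (s, t) < \<tau> (s', t')"
proof -
  have r: "(s, t + 1) \<in> S" "(s + 1, t + 1) \<in> S"
    using rect[OF assms(2,3)] assms(4,5) by simp_all
  have "H (\<tau> (s, t)) (\<tau> (s, t + 1))" "\<not> H (\<tau> (s + 1, t + 1)) (\<tau> (s, t + 1))"
    using tabs_row[OF assms(1,2) r(1)] tabs_col[OF assms(1) r] by auto
  then have "\<tau> (s, t) < \<tau> (s + 1, t + 1)"
    using H_mono[of "\<tau> (s, t)" "\<tau> (s, t + 1)" "\<tau> (s + 1, t + 1)" "\<tau> (s, t + 1)"] by force
  also have "\<dots> \<le> \<tau> (s', t')"
    using weakly_increasing[OF assms(1) r(2) assms(3)] assms(4,5) by simp
  finally show ?thesis .
qed

lemma diag_unique: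
  assumes "\<tau> \<in> tabs" "\<beta> \<in> S" "\<beta>' \<in> S" "diag \<beta> = diag \<beta>'" "\<tau> \<beta> = \<tau> \<beta>'"
  shows "\<beta> = \<beta>'"
proof -
  obtain s t s' t' where b: "\<beta> = (s, t)" "\<beta>' = (s', t')"
    by (cases \<beta>; cases \<beta>')
  consider "s < s'" "t < t'" | "s' < s" "t' < t" | "s = s'" "t = t'"
    using assms(4) b by (simp add: diag_def) linarith
  then show ?thesis
    using diag_increasing[OF assms(1), of s t s' t'] diag_increasing[OF assms(1), of s' t' s t] assms b
    by cases auto
qed

lemma diag_next:
  assumes "\<tau> \<in> tabs" "(s, t) \<in> S" "\<beta>' \<in> S" "diag \<beta>' = diag (s, t)" "\<tau> \<beta>' = \<tau> (s, t) + 1"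
  shows "\<beta>' = (s + 1, t + 1)"
proof -
  obtain s' t' where b: "\<beta>' = (s', t')"
    by (cases \<beta>')
  have S': "(s', t') \<in> S" "int t' - s' = int t - s" "\<tau> (s', t') = \<tau> (s, t) + 1"
    using assms b by simp_all
  have "s < s'"
  proof (rule ccontr)
    assume "\<not> s < s'"
    then show False
      using weakly_increasing[OF assms(1) S'(1) assms(2)] S' by simp
  qed
  moreover have "\<not> s + 1 < s'"
  proof
    assume *: "s + 1 < s'"
    then have "(s + 1, t + 1) \<in> S"
      using rect[OF assms(2) S'(1)] S'(2) by simp
    then show False
      using diag_increasing[OF assms(1,2), of "s + 1" "t + 1"] diag_increasing[OF assms(1) _ S'(1), of "s + 1" "t + 1"] * S'
      by simp
  qed
  ultimately show ?thesis
    using S'(2) b by simp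
qed

text \<open>By monotonicity of \<open>H\<close> the conditions with the left and upper neighbours
  persist, so only the neighbours to the right and below can obstruct.\<close>

lemma raise_iff:
  assumes "\<tau> \<in> tabs" "(s, t) \<in> S"
  shows "\<tau>((s, t) := \<tau> (s, t) + 1) \<in> tabs \<longleftrightarrow> \<tau> (s, t) < n
    \<and> ((s, t + 1) \<in> S \<longrightarrow> H (\<tau> (s, t) + 1) (\<tau> (s, t + 1)))
    \<and> ((s + 1, t) \<in> S \<longrightarrow> \<not> H (\<tau> (s + 1, t)) (\<tau> (s, t) + 1))" (is "?\<sigma> \<in> tabs \<longleftrightarrow> ?R")
proof
  assume \<sigma>: "?\<sigma> \<in> tabs"
  show ?R
    using tabs_range[OF \<sigma> assms(2)] tabs_row[OF \<sigma> assms(2)] tabs_col[OF \<sigma> assms(2)] by auto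
next
  assume R: ?R
  have "H (?\<sigma> (s', t')) (?\<sigma> (s', t' + 1))" if "(s', t') \<in> S" "(s', t' + 1) \<in> S" for s' t'
    using tabs_row[OF assms(1) that] R that H_mono[of "\<tau> (s', t')" "\<tau> (s', t' + 1)" "\<tau> (s', t')" "\<tau> (s', t' + 1) + 1"]
    by auto
  moreover have "\<not> H (?\<sigma> (s' + 1, t')) (?\<sigma> (s', t'))" if "(s', t') \<in> S" "(s' + 1, t') \<in> S" for s' t'
    using tabs_col[OF assms(1) that] R that H_mono[of "\<tau> (s' + 1, t') + 1" "\<tau> (s', t')" "\<tau> (s' + 1, t')" "\<tau> (s', t')"]
    by auto
  ultimately show "?\<sigma> \<in> tabs"
    using assms R unfolding tabs_def by auto
qed

text \<open>The dual of raising. The condition \<open>t > 0\<close> guards against truncated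
  subtraction, since \<open>t - 1\<close> is \<open>t\<close> for \<open>t = 0\<close>.\<close>

lemma lower_iff:
  assumes "\<tau> \<in> tabs" "(s, t) \<in> S"
  shows "\<tau>((s, t) := \<tau> (s, t) - 1) \<in> tabs \<longleftrightarrow> 1 < \<tau> (s, t)
    \<and> (t > 0 \<and> (s, t - 1) \<in> S \<longrightarrow> H (\<tau> (s, t - 1)) (\<tau> (s, t) - 1))
    \<and> ((s - 1, t) \<in> S \<longrightarrow> \<not> H (\<tau> (s, t) - 1) (\<tau> (s - 1, t)))" (is "?\<sigma> \<in> tabs \<longleftrightarrow> ?R")
proof
  assume \<sigma>: "?\<sigma> \<in> tabs"
  show ?R
    using tabs_range[OF \<sigma> assms(2)] tabs_row[OF \<sigma>, of s "t - 1"] tabs_col[OF \<sigma>, of "s - 1" t] assms(2)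
    by (auto split: if_splits)
next
  assume R: ?R
  have "H (?\<sigma> (s', t')) (?\<sigma> (s', t' + 1))" if "(s', t') \<in> S" "(s', t' + 1) \<in> S" for s' t'
    using tabs_row[OF assms(1) that] R that H_mono[of "\<tau> (s', t')" "\<tau> (s', t' + 1)" "\<tau> (s', t') - 1" "\<tau> (s', t' + 1)"]
    by auto
  moreover have "\<not> H (?\<sigma> (s' + 1, t')) (?\<sigma> (s', t'))" if "(s', t') \<in> S" "(s' + 1, t') \<in> S" for s' t'
    using tabs_col[OF assms(1) that] R that H_mono[of "\<tau> (s' + 1, t')" "\<tau> (s', t') - 1" "\<tau> (s' + 1, t')" "\<tau> (s', t')"]
    by auto
  ultimately show "?\<sigma> \<in> tabs"
    using assms R tabs_range[OF assms] unfolding tabs_def by auto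
qed

text \<open>Boxes on an adjacent diagonal that contribute a zero at the place of the step from
  \<open>x\<close> to \<open>x + 1\<close>. In type A the letter is \<open>x + 1\<close> here and
  \<open>x\<close> in \<open>Uset\<close>; phrased through \<open>H\<close>, the sets also fit type
  B, where near the letter \<open>Zero\<close> two letters or none may qualify.\<close>

definition Dset :: "(int \<times> nat \<Rightarrow> int) \<Rightarrow> int \<Rightarrow> int \<Rightarrow> (int \<times> nat) set" where
  "Dset \<tau> d x = {\<beta> \<in> S. diag \<beta> = d - 1 \<and> H (\<tau> \<beta>) (x + 1) \<and> \<not> H (\<tau> \<beta>) x}"

definition Uset :: "(int \<times> nat \<Rightarrow> int) \<Rightarrow> int \<Rightarrow> int \<Rightarrow> (int \<times> nat) set" where
  "Uset \<tau> d x = {\<beta> \<in> S. diag \<beta> = d + 1 \<and> H x (\<tau> \<beta>) \<and> \<not> H (x + 1) (\<tau> \<beta>)}"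

definition on_diag :: "(int \<times> nat \<Rightarrow> int) \<Rightarrow> int \<Rightarrow> int \<Rightarrow> (int \<times> nat) set" where
  "on_diag \<tau> d x = {\<beta> \<in> S. diag \<beta> = d \<and> \<tau> \<beta> = x}"

definition movable :: "(int \<times> nat \<Rightarrow> int) \<Rightarrow> int \<Rightarrow> int \<Rightarrow> bool" where
  "movable \<tau> d x \<longleftrightarrow> (\<exists>\<beta>\<in>S. diag \<beta> = d \<and> (\<tau> \<beta> = x \<and> \<tau>(\<beta> := \<tau> \<beta> + 1) \<in> tabs \<or> \<tau> \<beta> = x + 1 \<and> \<tau>(\<beta> := \<tau> \<beta> - 1) \<in> tabs))"

text \<open>The count of boxes that will turn out to be the pole order at the step from
  \<open>x\<close> to \<open>x + 1\<close> on diagonal \<open>d\<close>.\<close>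

definition excess :: "(int \<times> nat \<Rightarrow> int) \<Rightarrow> int \<Rightarrow> int \<Rightarrow> int" where
  "excess \<tau> d x = int (card (on_diag \<tau> d x)) + int (card (on_diag \<tau> d (x + 1)))
     - int (card (Dset \<tau> d x)) - int (card (Uset \<tau> d x))"

lemma finite_sets [simp]: "finite (Dset \<tau> d x)" "finite (Uset \<tau> d x)"
  using finite_S by (auto simp: Dset_def Uset_def)

lemma on_diag_eq:
  assumes "\<tau> \<in> tabs" "\<beta> \<in> on_diag \<tau> d x"
  shows "on_diag \<tau> d x = {\<beta>}"
  using diag_unique[OF assms(1), of _ \<beta>] assms(2) by (auto simp: on_diag_def)

lemma card_subset_singleton: "A \<subseteq> {b} \<Longrightarrow> int (card A) = (if b \<in> A then 1 else 0)"
  by (auto dest!: subset_singletonD)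

text \<open>On the adjacent diagonals only the right and the lower neighbour of the box can
  contribute, and each does so exactly when it blocks the raise.\<close>

lemma excess_first_only:
  assumes \<tau>: "\<tau> \<in> tabs" and x: "x < n" and b: "(s, t) \<in> on_diag \<tau> d x" and none: "on_diag \<tau> d (x + 1) = {}"
  shows "excess \<tau> d x \<le> 1 \<and> (excess \<tau> d x = 1 \<longleftrightarrow> movable \<tau> d x)"
proof -
  have st: "(s, t) \<in> S" "d = int t - s" "\<tau> (s, t) = x"
    using b by (auto simp: on_diag_def)
  \<comment> \<open>Since \<open>x + 1\<close> is missing on the diagonal, the next letter there
    exceeds \<open>x\<close> by at least 2. This gap excludes the boxes further to the lower
    right.\<close>
  have next_ge: "\<tau> (s + 1, t + 1) \<ge> x + 2" if "(s + 1, t + 1) \<in> S"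
  proof -
    have "\<tau> (s + 1, t + 1) > x"
      using diag_increasing[OF \<tau> st(1) that] st by simp
    moreover have "\<tau> (s + 1, t + 1) \<noteq> x + 1"
      using none that st(2) by (auto simp: on_diag_def)
    ultimately show ?thesis
      by simp
  qed
  have U: "Uset \<tau> d x \<subseteq> {(s, t + 1)}"
  proof
    fix \<beta> assume \<beta>: "\<beta> \<in> Uset \<tau> d x"
    obtain s' t' where b': "\<beta> = (s', t')"
      by (cases \<beta>)
    have *: "(s', t') \<in> S" "int t' - s' = int t - s + 1" "H x (\<tau> (s', t'))" "\<not> H (x + 1) (\<tau> (s', t'))"
      using \<beta> b' st(2) by (auto simp: Uset_def)
    consider "s' > s" | "s' < s" | "s' = s"
      by linarith
    then show "\<beta> \<in> {(s, t + 1)}"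
    proof cases
      case 1
      then have S1: "(s + 1, t + 1) \<in> S"
        using rect[OF st(1) *(1)] *(2) by simp
      have "x + 2 \<le> \<tau> (s', t')"
        using next_ge[OF S1] weakly_increasing[OF \<tau> S1 *(1)] 1 *(2) by simp
      then show ?thesis
        using H_less[of "x + 1" "\<tau> (s', t')"] *(4) by simp
    next
      case 2
      then have S1: "(s - 1, t) \<in> S"
        using rect[OF *(1) st(1)] *(2) by simp
      have "\<not> H x (\<tau> (s - 1, t))"
        using tabs_col[OF \<tau> S1] st by simp
      moreover have "\<tau> (s', t') \<le> \<tau> (s - 1, t)"
        using weakly_increasing[OF \<tau> *(1) S1] 2 *(2) by simp
      ultimately show ?thesis
        using H_mono[OF *(3)] by blast
    next
      case 3
      then show ?thesis
        using b' *(2) by simp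
    qed
  qed
  have D: "Dset \<tau> d x \<subseteq> {(s + 1, t)}"
  proof
    fix \<beta> assume \<beta>: "\<beta> \<in> Dset \<tau> d x"
    obtain s' t' where b': "\<beta> = (s', t')"
      by (cases \<beta>)
    have *: "(s', t') \<in> S" "int t' - s' = int t - s - 1" "H (\<tau> (s', t')) (x + 1)" "\<not> H (\<tau> (s', t')) x"
      using \<beta> b' st(2) by (auto simp: Dset_def)
    consider "t' > t" | "t' < t" | "t' = t"
      by linarith
    then show "\<beta> \<in> {(s + 1, t)}"
    proof cases
      case 1
      then have S1: "(s + 1, t + 1) \<in> S"
        using rect[OF st(1) *(1)] *(2) by simp
      have "x + 2 \<le> \<tau> (s', t')"
        using next_ge[OF S1] weakly_increasing[OF \<tau> S1 *(1)] 1 *(2) by simp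
      then show ?thesis
        using H_le[OF *(3)] by simp
    next
      case 2
      then have S1: "(s, t - 1) \<in> S"
        using rect[OF *(1) st(1)] *(2) by simp
      have "H (\<tau> (s, t - 1)) x"
        using tabs_row[OF \<tau> S1] st 2 by simp
      moreover have "\<tau> (s', t') \<le> \<tau> (s, t - 1)"
        using weakly_increasing[OF \<tau> *(1) S1] 2 *(2) by simp
      ultimately show ?thesis
        using H_mono[of "\<tau> (s, t - 1)" x "\<tau> (s', t')" x] *(4) by simp
    next
      case 3
      then show ?thesis
        using b' *(2) by simp
    qed
  qed
  have mov: "movable \<tau> d x \<longleftrightarrow> \<tau>((s, t) := \<tau> (s, t) + 1) \<in> tabs"
  proof -
    have "\<beta> = (s, t)" if "\<beta> \<in> S" "diag \<beta> = d" "\<tau> \<beta> = x" for \<beta>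
      using diag_unique[OF \<tau> that(1) st(1)] that st by simp
    moreover have "\<not> (\<beta> \<in> S \<and> diag \<beta> = d \<and> \<tau> \<beta> = x + 1)" for \<beta>
      using none unfolding on_diag_def by blast
    ultimately show ?thesis
      unfolding movable_def using st by (metis diag_pair)
  qed
  have "movable \<tau> d x \<longleftrightarrow> (s, t + 1) \<notin> Uset \<tau> d x \<and> (s + 1, t) \<notin> Dset \<tau> d x"
    unfolding mov raise_iff[OF \<tau> st(1)] using x st tabs_row[OF \<tau> st(1)] tabs_col[OF \<tau> st(1)]
    by (auto simp: Uset_def Dset_def)
  then show ?thesis
    unfolding excess_def on_diag_eq[OF \<tau> b] none card_subset_singleton[OF U] card_subset_singleton[OF D] by auto
qed

text \<open>The mirror image: the upper and the left neighbour are the only possible contributions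
  and the only obstructions to lowering the box.\<close>

lemma excess_second_only:
  assumes \<tau>: "\<tau> \<in> tabs" and x: "1 \<le> x" and b: "(s, t) \<in> on_diag \<tau> d (x + 1)" and none: "on_diag \<tau> d x = {}"
  shows "excess \<tau> d x \<le> 1 \<and> (excess \<tau> d x = 1 \<longleftrightarrow> movable \<tau> d x)"
proof -
  have st: "(s, t) \<in> S" "d = int t - s" "\<tau> (s, t) = x + 1"
    using b by (auto simp: on_diag_def)
  have prev_le: "\<tau> (s - 1, t - 1) \<le> x - 1" if "(s - 1, t - 1) \<in> S" "t > 0"
  proof -
    have "\<tau> (s - 1, t - 1) < x + 1"
      using diag_increasing[OF \<tau> that(1) st(1)] st that(2) by simp
    moreover have "\<tau> (s - 1, t - 1) \<noteq> x"
      using none that st(2) by (auto simp: on_diag_def of_nat_diff)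
    ultimately show ?thesis
      by simp
  qed
  have U: "Uset \<tau> d x \<subseteq> {(s - 1, t)}"
  proof
    fix \<beta> assume \<beta>: "\<beta> \<in> Uset \<tau> d x"
    obtain s' t' where b': "\<beta> = (s', t')"
      by (cases \<beta>)
    have *: "(s', t') \<in> S" "int t' - s' = int t - s + 1" "H x (\<tau> (s', t'))" "\<not> H (x + 1) (\<tau> (s', t'))"
      using \<beta> b' st(2) by (auto simp: Uset_def)
    consider "t' > t" | "t' < t" | "t' = t"
      by linarith
    then show "\<beta> \<in> {(s - 1, t)}"
    proof cases
      case 1
      then have S1: "(s, t + 1) \<in> S"
        using rect[OF st(1) *(1)] *(2) by simp
      have "H (x + 1) (\<tau> (s, t + 1))"
        using tabs_row[OF \<tau> st(1) S1] st by simp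
      moreover have "\<tau> (s, t + 1) \<le> \<tau> (s', t')"
        using weakly_increasing[OF \<tau> S1 *(1)] 1 *(2) by simp
      ultimately show ?thesis
        using H_mono *(4) by blast
    next
      case 2
      then have S1: "(s - 1, t - 1) \<in> S"
        using rect[OF *(1) st(1)] *(2) by simp
      have "\<tau> (s', t') \<le> \<tau> (s - 1, t - 1)"
        using weakly_increasing[OF \<tau> *(1) S1] 2 *(2) by simp
      then show ?thesis
        using prev_le[OF S1] 2 H_le[OF *(3)] by simp
    next
      case 3
      then show ?thesis
        using b' *(2) by simp
    qed
  qed
  \<comment> \<open>For \<open>t = 0\<close> there is no box to the left, and
    \<open>(s, t - 1)\<close> denotes \<open>(s, t)\<close> itself; emptiness is recorded
    separately.\<close>
  have D: "Dset \<tau> d x \<subseteq> {(s, t - 1)}" and D0: "t = 0 \<Longrightarrow> Dset \<tau> d x = {}"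
  proof -
    have key: "s' = s \<and> t' + 1 = t" if \<beta>: "(s', t') \<in> Dset \<tau> d x" for s' t'
    proof -
      have *: "(s', t') \<in> S" "int t' - s' = int t - s - 1" "H (\<tau> (s', t')) (x + 1)" "\<not> H (\<tau> (s', t')) x"
        using \<beta> st(2) by (auto simp: Dset_def)
      consider "s' > s" | "s' < s" | "s' = s"
        by linarith
      then show ?thesis
      proof cases
        case 1
        then have S1: "(s + 1, t) \<in> S"
          using rect[OF st(1) *(1)] *(2) by simp
        have "\<not> H (\<tau> (s + 1, t)) (x + 1)"
          using tabs_col[OF \<tau> st(1) S1] st by simp
        moreover have "\<tau> (s + 1, t) \<le> \<tau> (s', t')"
          using weakly_increasing[OF \<tau> S1 *(1)] 1 *(2) by simp
        ultimately show ?thesis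
          using H_mono[OF *(3)] by blast
      next
        case 2
        then have S1: "(s - 1, t - 1) \<in> S"
          using rect[OF *(1) st(1)] *(2) by simp
        have "\<tau> (s', t') \<le> \<tau> (s - 1, t - 1)"
          using weakly_increasing[OF \<tau> *(1) S1] 2 *(2) by simp
        then have "\<tau> (s', t') < x"
          using prev_le[OF S1] 2 *(2) by simp
        then show ?thesis
          using H_less *(4) by blast
      next
        case 3
        then show ?thesis
          using *(2) by simp
      qed
    qed
    show "Dset \<tau> d x \<subseteq> {(s, t - 1)}"
      using key by force
    show "Dset \<tau> d x = {}" if "t = 0"
      using key that by force
  qed
  have mov: "movable \<tau> d x \<longleftrightarrow> \<tau>((s, t) := \<tau> (s, t) - 1) \<in> tabs"
  proof -
    have "\<beta> = (s, t)" if "\<beta> \<in> S" "diag \<beta> = d" "\<tau> \<beta> = x + 1" for \<beta>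
      using diag_unique[OF \<tau> that(1) st(1)] that st by simp
    moreover have "\<not> (\<beta> \<in> S \<and> diag \<beta> = d \<and> \<tau> \<beta> = x)" for \<beta>
      using none unfolding on_diag_def by blast
    ultimately show ?thesis
      unfolding movable_def using st by (metis diag_pair)
  qed
  have left: "t > 0 \<and> (s, t - 1) \<in> S \<longrightarrow> H (\<tau> (s, t - 1)) (x + 1)"
    using tabs_row[OF \<tau>, of s "t - 1"] st by auto
  have above: "(s - 1, t) \<in> S \<longrightarrow> \<not> H (x + 1) (\<tau> (s - 1, t))"
    using tabs_col[OF \<tau>, of "s - 1" t] st by simp
  have "movable \<tau> d x \<longleftrightarrow> (s - 1, t) \<notin> Uset \<tau> d x \<and> (s, t - 1) \<notin> Dset \<tau> d x"
  proof (cases "t = 0")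
    case True
    then show ?thesis
      unfolding mov lower_iff[OF \<tau> st(1)] using x st above D0
      by (auto simp: Uset_def)
  next
    case False
    then show ?thesis
      unfolding mov lower_iff[OF \<tau> st(1)] using x st left above
      by (auto simp: Uset_def Dset_def of_nat_diff)
  qed
  then show ?thesis
    unfolding excess_def on_diag_eq[OF \<tau> b] none card_subset_singleton[OF U] card_subset_singleton[OF D] by auto
qed

text \<open>The two letters occupy opposite corners of a square of four boxes. The other two corners
  always contribute zeros, and they block both moves.\<close>

lemma excess_both:
  assumes \<tau>: "\<tau> \<in> tabs" and b: "(s, t) \<in> on_diag \<tau> d x" and b': "\<beta>' \<in> on_diag \<tau> d (x + 1)"
  shows "excess \<tau> d x \<le> 0 \<and> \<not> movable \<tau> d x"
proof -
  have st: "(s, t) \<in> S" "d = int t - s" "\<tau> (s, t) = x"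
    using b by (auto simp: on_diag_def)
  have "\<beta>' = (s + 1, t + 1)"
    using b' st by (intro diag_next[OF \<tau> st(1)]) (auto simp: on_diag_def)
  then have st': "(s + 1, t + 1) \<in> S" "\<tau> (s + 1, t + 1) = x + 1"
    using b' by (auto simp: on_diag_def)
  have R: "(s, t + 1) \<in> S" and B: "(s + 1, t) \<in> S"
    using rect[OF st(1) st'(1)] by simp_all
  have r: "H x (\<tau> (s, t + 1))" "\<not> H (x + 1) (\<tau> (s, t + 1))" "H (\<tau> (s + 1, t)) (x + 1)" "\<not> H (\<tau> (s + 1, t)) x"
    using tabs_row[OF \<tau> st(1) R] tabs_col[OF \<tau> R] tabs_row[OF \<tau> B] tabs_col[OF \<tau> st(1) B] st st' by auto
  have "(s, t + 1) \<in> Uset \<tau> d x" "(s + 1, t) \<in> Dset \<tau> d x"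
    using r R B st by (auto simp: Uset_def Dset_def)
  then have "card (Uset \<tau> d x) > 0" "card (Dset \<tau> d x) > 0"
    by (auto simp: card_gt_0_iff)
  then have "excess \<tau> d x \<le> 0"
    unfolding excess_def on_diag_eq[OF \<tau> b] on_diag_eq[OF \<tau> b'] by simp
  moreover have "\<not> movable \<tau> d x"
  proof
    assume "movable \<tau> d x"
    then obtain \<beta> where \<beta>: "\<beta> \<in> S" "diag \<beta> = d"
      "\<tau> \<beta> = x \<and> \<tau>(\<beta> := \<tau> \<beta> + 1) \<in> tabs \<or> \<tau> \<beta> = x + 1 \<and> \<tau>(\<beta> := \<tau> \<beta> - 1) \<in> tabs"
      by (auto simp: movable_def)
    from \<beta>(3) show False
    proof
      assume *: "\<tau> \<beta> = x \<and> \<tau>(\<beta> := \<tau> \<beta> + 1) \<in> tabs"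
      then have "\<beta> = (s, t)"
        using diag_unique[OF \<tau> \<beta>(1) st(1)] \<beta>(2) st by simp
      then show False
        using * raise_iff[OF \<tau> st(1)] R r st by simp
    next
      assume *: "\<tau> \<beta> = x + 1 \<and> \<tau>(\<beta> := \<tau> \<beta> - 1) \<in> tabs"
      then have "\<beta> = (s + 1, t + 1)"
        using diag_unique[OF \<tau> \<beta>(1) st'(1)] \<beta>(2) st st' by simp
      then show False
        using * lower_iff[OF \<tau> st'(1)] R r st' by auto
    qed
  qed
  ultimately show ?thesis
    by simp
qed

theorem excess_movable:
  assumes \<tau>: "\<tau> \<in> tabs" and x: "1 \<le> x" "x < n"
  shows "excess \<tau> d x \<le> 1" and "excess \<tau> d x = 1 \<longleftrightarrow> movable \<tau> d x"
proof -
  have "excess \<tau> d x \<le> 1 \<and> (excess \<tau> d x = 1 \<longleftrightarrow> movable \<tau> d x)"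
  proof (cases "on_diag \<tau> d x = {}"; cases "on_diag \<tau> d (x + 1) = {}")
    assume *: "on_diag \<tau> d x = {}" "on_diag \<tau> d (x + 1) = {}"
    then have "\<not> movable \<tau> d x"
      unfolding movable_def on_diag_def by blast
    then show ?thesis
      unfolding excess_def * by simp
  next
    assume *: "on_diag \<tau> d x = {}" "on_diag \<tau> d (x + 1) \<noteq> {}"
    then obtain s t where "(s, t) \<in> on_diag \<tau> d (x + 1)"
      by auto
    from excess_second_only[OF \<tau> x(1) this *(1)] show ?thesis .
  next
    assume *: "on_diag \<tau> d x \<noteq> {}" "on_diag \<tau> d (x + 1) = {}"
    then obtain s t where "(s, t) \<in> on_diag \<tau> d x"
      by auto
    from excess_first_only[OF \<tau> x(2) this *(2)] show ?thesis .
  next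
    assume *: "on_diag \<tau> d x \<noteq> {}" "on_diag \<tau> d (x + 1) \<noteq> {}"
    then obtain s t \<beta>' where "(s, t) \<in> on_diag \<tau> d x" "\<beta>' \<in> on_diag \<tau> d (x + 1)"
      by auto
    from excess_both[OF \<tau> this] show ?thesis
      by simp
  qed
  then show "excess \<tau> d x \<le> 1" "excess \<tau> d x = 1 \<longleftrightarrow> movable \<tau> d x"
    by auto
qed

lemma raise_lower_exclusive:
  assumes \<tau>: "\<tau> \<in> tabs" and "\<beta> \<in> S" "\<beta>' \<in> S" "diag \<beta> = diag \<beta>'" "\<tau> \<beta>' = \<tau> \<beta> + 1"
    and "\<tau>(\<beta> := \<tau> \<beta> + 1) \<in> tabs"
  shows False
proof -
  obtain s t where st: "\<beta> = (s, t)"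
    by (cases \<beta>)
  have "(s, t) \<in> on_diag \<tau> (diag \<beta>) (\<tau> \<beta>)" "\<beta>' \<in> on_diag \<tau> (diag \<beta>) (\<tau> \<beta> + 1)"
    using assms st by (auto simp: on_diag_def)
  from excess_both[OF \<tau> this] have "\<not> movable \<tau> (diag \<beta>) (\<tau> \<beta>)"
    by simp
  then show False
    using assms by (auto simp: movable_def)
qed

lemma tabs_min: "\<sigma> \<in> tabs \<Longrightarrow> \<tau> \<in> tabs \<Longrightarrow> (\<lambda>\<beta>. min (\<sigma> \<beta>) (\<tau> \<beta>)) \<in> tabs"
  and tabs_max: "\<sigma> \<in> tabs \<Longrightarrow> \<tau> \<in> tabs \<Longrightarrow> (\<lambda>\<beta>. max (\<sigma> \<beta>) (\<tau> \<beta>)) \<in> tabs"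
proof -
  have Hmin: "H (min x x') (min y y')" and Hmax: "H (max x x') (max y y')" if "H x y" "H x' y'" for x x' y y'
    using that H_mono by (smt (verit) min_def max_def)+
  have Vmin: "\<not> H (min x x') (min y y')" and Vmax: "\<not> H (max x x') (max y y')" if "\<not> H x y" "\<not> H x' y'" for x x' y y'
    using that H_mono by (smt (verit) min_def max_def)+
  assume "\<sigma> \<in> tabs" "\<tau> \<in> tabs"
  then show "(\<lambda>\<beta>. min (\<sigma> \<beta>) (\<tau> \<beta>)) \<in> tabs" "(\<lambda>\<beta>. max (\<sigma> \<beta>) (\<tau> \<beta>)) \<in> tabs"
    unfolding tabs_def by (auto intro: Hmin Hmax simp: Vmin Vmax)
qed

text \<open>Among the boxes that exceed \<open>low0\<close>, one with minimal \<open>s + t\<close>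
  is lowered: its left and upper neighbours carry the letters of \<open>low0\<close>, so the
  conditions satisfied by \<open>low0\<close> carry over.\<close>

lemma tabs_lowerable:
  assumes low0: "low0 \<in> tabs" "\<And>\<tau> \<beta>. \<tau> \<in> tabs \<Longrightarrow> low0 \<beta> \<le> \<tau> \<beta>" and \<tau>: "\<tau> \<in> tabs" "\<tau> \<noteq> low0"
  shows "\<exists>\<beta>\<in>S. \<tau>(\<beta> := \<tau> \<beta> - 1) \<in> tabs"
proof -
  define E where "E = {\<beta> \<in> S. low0 \<beta> < \<tau> \<beta>}"
  define f where "f = (\<lambda>\<beta> :: int \<times> nat. fst \<beta> + int (snd \<beta>))"
  have "finite E"
    using finite_S by (simp add: E_def)
  moreover have "E \<noteq> {}"
  proof
    assume E: "E = {}"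
    have "\<tau> \<beta> = low0 \<beta>" for \<beta>
    proof (cases "\<beta> \<in> S")
      case True
      then have "\<not> low0 \<beta> < \<tau> \<beta>"
        using E unfolding E_def by blast
      then show ?thesis
        using low0(2)[OF \<tau>(1), of \<beta>] by simp
    qed (use tabs_outside[OF \<tau>(1)] tabs_outside[OF low0(1)] in simp)
    then show False
      using \<tau>(2) by auto
  qed
  ultimately have "\<exists>\<beta>\<in>E. \<forall>\<beta>'\<in>E. f \<beta> \<le> f \<beta>'"
    by (metis arg_min_if_finite(1,2) linorder_not_less)
  then obtain s t where st: "(s, t) \<in> E" "\<And>\<beta>'. \<beta>' \<in> E \<Longrightarrow> f (s, t) \<le> f \<beta>'"
    by auto
  then have S: "(s, t) \<in> S" "low0 (s, t) < \<tau> (s, t)"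
    by (auto simp: E_def)
  have eq: "\<tau> \<beta>' = low0 \<beta>'" if "\<beta>' \<in> S" "f \<beta>' < f (s, t)" for \<beta>'
  proof -
    have "\<beta>' \<notin> E"
      using st(2)[of \<beta>'] that(2) by auto
    then show ?thesis
      using that(1) low0(2)[OF \<tau>(1), of \<beta>'] unfolding E_def by force
  qed
  have "1 < \<tau> (s, t)"
    using tabs_range[OF low0(1) S(1)] S(2) by simp
  moreover have "H (\<tau> (s, t - 1)) (\<tau> (s, t) - 1)" if "t > 0" "(s, t - 1) \<in> S"
    using eq[OF that(2)] that tabs_row[OF low0(1) that(2)] S H_mono[of "low0 (s, t - 1)" "low0 (s, t)" "low0 (s, t - 1)" "\<tau> (s, t) - 1"]
    by (simp add: f_def of_nat_diff)
  moreover have "\<not> H (\<tau> (s, t) - 1) (\<tau> (s - 1, t))" if "(s - 1, t) \<in> S"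
    using eq[OF that] tabs_col[OF low0(1) that] S H_mono[of "\<tau> (s, t) - 1" "low0 (s - 1, t)" "low0 (s, t)" "low0 (s - 1, t)"]
    by (auto simp: f_def)
  ultimately have "\<tau>((s, t) := \<tau> (s, t) - 1) \<in> tabs"
    unfolding lower_iff[OF \<tau>(1) S(1)] by blast
  then show ?thesis
    using S(1) by blast
qed

end

text \<open>Separates the counting of boxes from the two types. \<open>pole_step\<close> gives the
  contribution of one box in the shape of the summands of \<open>excess\<close>;
  \<open>par_inj\<close> says that node and spectral parameter determine letter and diagonal of a
  step.\<close>

locale boxed_tableaux = skew_tableaux n H S
  for n :: int and H and S :: "(int \<times> nat) set" +
  fixes g :: lie_type and q a :: complex and node :: "int \<Rightarrow> nat" and shift :: "int \<Rightarrow> int" and K :: int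
    and bx :: "int \<Rightarrow> int \<Rightarrow> monomial" and low0 :: "int \<times> nat \<Rightarrow> int"
  assumes valid: "valid_lie_type g" and q0: "q \<noteq> 0" and q_nru: "not_root_of_unity q" and a0: "a \<noteq> 0"
    and low0_in: "low0 \<in> tabs" and low0_le: "\<And>\<tau> \<beta>. \<tau> \<in> tabs \<Longrightarrow> low0 \<beta> \<le> \<tau> \<beta>"
    and node_in: "\<And>x. 1 \<le> x \<Longrightarrow> x < n \<Longrightarrow> node x \<in> nodes g"
    and bx_monomial: "\<And>x k. bx x k \<in> monomials g"
    and bx_step: "\<And>x k. 1 \<le> x \<Longrightarrow> x < n \<Longrightarrow> bx (x + 1) k = bx x k - A_mon g q a (node x) (shift x + k)"
    and par_inj: "\<And>x x' d d'. 1 \<le> x \<Longrightarrow> x < n \<Longrightarrow> 1 \<le> x' \<Longrightarrow> x' < n \<Longrightarrow> node x = node x' \<Longrightarrow>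
      shift x + K * d = shift x' + K * d' \<Longrightarrow> x = x' \<and> d = d'"
    and pole_step: "\<And>x y d0 d. 1 \<le> x \<Longrightarrow> x < n \<Longrightarrow> 1 \<le> y \<Longrightarrow> y \<le> n \<Longrightarrow>
      pole_ord g q (node x) (a * q powi (shift x + K * d0)) (bx y (K * d)) =
        (if d = d0 \<and> y = x then 1 else 0) + (if d = d0 \<and> y = x + 1 then 1 else 0)
        - (if d = d0 - 1 \<and> H y (x + 1) \<and> \<not> H y x then 1 else 0)
        - (if d = d0 + 1 \<and> H x y \<and> \<not> H (x + 1) y then 1 else 0)"
    and pole_no_step: "\<And>i l y d. i \<in> nodes g \<Longrightarrow> (\<And>x d0. 1 \<le> x \<Longrightarrow> x < n \<Longrightarrow> node x = i \<Longrightarrow> l \<noteq> shift x + K * d0) \<Longrightarrow>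
      1 \<le> y \<Longrightarrow> y \<le> n \<Longrightarrow> pole_ord g q i (a * q powi l) (bx y (K * d)) = 0"
    and pole_other: "\<And>i b y k. (\<And>l. b \<noteq> a * q powi l) \<Longrightarrow> pole_ord g q i b (bx y k) = 0"
begin

definition step_par :: "int \<times> nat \<Rightarrow> int \<Rightarrow> nat \<times> int" where
  "step_par \<beta> x = (node x, shift x + K * diag \<beta>)"

definition mon :: "(int \<times> nat \<Rightarrow> int) \<Rightarrow> monomial" where
  "mon \<tau> = (\<Sum>\<beta>\<in>S. bx (\<tau> \<beta>) (K * diag \<beta>))"

lemma pole_ord_sum: "pole_ord g q i b (sum f A) = (\<Sum>x\<in>A. pole_ord g q i b (f x))"
  by (induction A rule: infinite_finite_induct) (simp_all add: pole_ord_add)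

lemma pole_ord_mon:
  assumes "\<tau> \<in> tabs" "1 \<le> x" "x < n"
  shows "pole_ord g q (node x) (a * q powi (shift x + K * d)) (mon \<tau>) = excess \<tau> d x"
proof -
  have count: "(\<Sum>\<beta>\<in>S. if Q \<beta> then 1 else 0) = int (card {\<beta> \<in> S. Q \<beta>})" for Q
    using finite_S by (simp add: sum.If_cases Int_def)
  have "pole_ord g q (node x) (a * q powi (shift x + K * d)) (mon \<tau>)
    = (\<Sum>\<beta>\<in>S. (if diag \<beta> = d \<and> \<tau> \<beta> = x then 1 else 0) + (if diag \<beta> = d \<and> \<tau> \<beta> = x + 1 then 1 else 0)
        - (if diag \<beta> = d - 1 \<and> H (\<tau> \<beta>) (x + 1) \<and> \<not> H (\<tau> \<beta>) x then 1 else 0)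
        - (if diag \<beta> = d + 1 \<and> H x (\<tau> \<beta>) \<and> \<not> H (x + 1) (\<tau> \<beta>) then 1 else 0))"
    unfolding mon_def pole_ord_sum using tabs_range[OF assms(1)] assms(2,3)
    by (intro sum.cong refl pole_step) auto
  also have "\<dots> = excess \<tau> d x"
    unfolding sum_subtractf sum.distrib count excess_def on_diag_def Dset_def Uset_def by (rule refl)
  finally show ?thesis .
qed

lemma raised_range: "\<tau> \<in> tabs \<Longrightarrow> \<beta> \<in> S \<Longrightarrow> \<tau>(\<beta> := \<tau> \<beta> + 1) \<in> tabs \<Longrightarrow> 1 \<le> \<tau> \<beta> \<and> \<tau> \<beta> < n"
  using tabs_range[of \<tau> \<beta>] tabs_range[of "\<tau>(\<beta> := \<tau> \<beta> + 1)" \<beta>] by simp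

lemma lowered_range: "\<tau> \<in> tabs \<Longrightarrow> \<beta> \<in> S \<Longrightarrow> \<tau>(\<beta> := \<tau> \<beta> - 1) \<in> tabs \<Longrightarrow> 1 \<le> \<tau> \<beta> - 1 \<and> \<tau> \<beta> - 1 < n"
  using tabs_range[of \<tau> \<beta>] tabs_range[of "\<tau>(\<beta> := \<tau> \<beta> - 1)" \<beta>] by simp

lemma pole_movable:
  assumes \<tau>: "\<tau> \<in> tabs" and i: "i \<in> nodes g"
  shows "pole_ord g q i b (mon \<tau>) \<le> 1 \<and> (pole_ord g q i b (mon \<tau>) = 1 \<longleftrightarrow>
      (\<exists>\<beta>\<in>S. \<exists>l. b = a * q powi l \<and> (\<tau>(\<beta> := \<tau> \<beta> + 1) \<in> tabs \<and> step_par \<beta> (\<tau> \<beta>) = (i, l)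
         \<or> \<tau>(\<beta> := \<tau> \<beta> - 1) \<in> tabs \<and> step_par \<beta> (\<tau> \<beta> - 1) = (i, l))))" (is "_ \<and> (_ \<longleftrightarrow> ?R)")
proof (cases "\<exists>x d. 1 \<le> x \<and> x < n \<and> node x = i \<and> b = a * q powi (shift x + K * d)")
  case True
  then obtain x d where x: "1 \<le> x" "x < n" "node x = i" "b = a * q powi (shift x + K * d)"
    by blast
  have e: "pole_ord g q i b (mon \<tau>) = excess \<tau> d x"
    using pole_ord_mon[OF \<tau> x(1,2)] x(3,4) by simp
  have "?R \<longleftrightarrow> movable \<tau> d x"
  proof
    assume ?R
    then obtain \<beta> l where \<beta>: "\<beta> \<in> S" "b = a * q powi l"
      "\<tau>(\<beta> := \<tau> \<beta> + 1) \<in> tabs \<and> step_par \<beta> (\<tau> \<beta>) = (i, l) \<or> \<tau>(\<beta> := \<tau> \<beta> - 1) \<in> tabs \<and> step_par \<beta> (\<tau> \<beta> - 1) = (i, l)"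
      by blast
    have l: "l = shift x + K * d"
      using \<beta>(2) x(4) a_powi_inj[OF q0 q_nru a0] by simp
    from \<beta>(3) show "movable \<tau> d x"
    proof
      assume *: "\<tau>(\<beta> := \<tau> \<beta> + 1) \<in> tabs \<and> step_par \<beta> (\<tau> \<beta>) = (i, l)"
      then have "\<tau> \<beta> = x \<and> diag \<beta> = d"
        using raised_range[OF \<tau> \<beta>(1)] x l by (intro par_inj) (auto simp: step_par_def)
      then show ?thesis
        using * \<beta>(1) unfolding movable_def by blast
    next
      assume *: "\<tau>(\<beta> := \<tau> \<beta> - 1) \<in> tabs \<and> step_par \<beta> (\<tau> \<beta> - 1) = (i, l)"
      then have "\<tau> \<beta> - 1 = x \<and> diag \<beta> = d"
        using lowered_range[OF \<tau> \<beta>(1)] x l by (intro par_inj) (auto simp: step_par_def)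
      then have "\<tau> \<beta> = x + 1 \<and> diag \<beta> = d"
        by simp
      then show ?thesis
        using * \<beta>(1) unfolding movable_def by blast
    qed
  next
    assume "movable \<tau> d x"
    then obtain \<beta> where \<beta>: "\<beta> \<in> S" "diag \<beta> = d"
      "\<tau> \<beta> = x \<and> \<tau>(\<beta> := \<tau> \<beta> + 1) \<in> tabs \<or> \<tau> \<beta> = x + 1 \<and> \<tau>(\<beta> := \<tau> \<beta> - 1) \<in> tabs"
      unfolding movable_def by blast
    show ?R
      by (rule bexI[OF _ \<beta>(1)], rule exI[of _ "shift x + K * d"]) (use \<beta>(2,3) x in \<open>auto simp: step_par_def\<close>)
  qed
  then show ?thesis
    using e excess_movable[OF \<tau> x(1,2)] by simp
next
  case False
  have "pole_ord g q i b (mon \<tau>) = 0"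
    unfolding mon_def pole_ord_sum
  proof (intro sum.neutral ballI)
    fix \<beta> assume \<beta>: "\<beta> \<in> S"
    show "pole_ord g q i b (bx (\<tau> \<beta>) (K * diag \<beta>)) = 0"
    proof (cases "\<exists>l. b = a * q powi l")
      case True
      then obtain l where l: "b = a * q powi l"
        by blast
      show ?thesis
        unfolding l using False l tabs_range[OF \<tau> \<beta>] by (intro pole_no_step[OF i]) auto
    qed (use pole_other in blast)
  qed
  moreover have "\<not> ?R"
    using False raised_range[OF \<tau>] lowered_range[OF \<tau>] unfolding step_par_def prod.inject by metis
  ultimately show ?thesis
    by simp
qed

lemma mon_raise:
  assumes "\<tau> \<in> tabs" "\<beta> \<in> S" "\<tau>(\<beta> := \<tau> \<beta> + 1) \<in> tabs"
  shows "mon (\<tau>(\<beta> := \<tau> \<beta> + 1)) = mon \<tau> - A_mon g q a (node (\<tau> \<beta>)) (shift (\<tau> \<beta>) + K * diag \<beta>)"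
proof -
  have "(\<Sum>\<beta>'\<in>S - {\<beta>}. bx ((\<tau>(\<beta> := \<tau> \<beta> + 1)) \<beta>') (K * diag \<beta>')) = (\<Sum>\<beta>'\<in>S - {\<beta>}. bx (\<tau> \<beta>') (K * diag \<beta>'))"
    by (intro sum.cong) auto
  then show ?thesis
    using raised_range[OF assms] unfolding mon_def sum.remove[OF finite_S assms(2)]
    by (simp add: bx_step)
qed

theorem thin: "thin_lattice g q a tabs low0 S step_par mon"
proof
  fix \<sigma> \<tau> assume "\<sigma> \<in> tabs" "\<tau> \<in> tabs"
  then show "(\<lambda>\<beta>. min (\<sigma> \<beta>) (\<tau> \<beta>)) \<in> tabs" "(\<lambda>\<beta>. max (\<sigma> \<beta>) (\<tau> \<beta>)) \<in> tabs"
    by (fact tabs_min tabs_max)+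
next
  fix \<tau> assume "\<tau> \<in> tabs" "\<tau> \<noteq> low0"
  then show "\<exists>\<beta>\<in>S. \<tau>(\<beta> := \<tau> \<beta> - 1) \<in> tabs"
    using tabs_lowerable[of low0 \<tau>] low0_in low0_le by blast
next
  fix \<tau> \<beta> assume "\<tau> \<in> tabs" "\<beta> \<in> S" "\<tau>(\<beta> := \<tau> \<beta> + 1) \<in> tabs"
  then show "fst (step_par \<beta> (\<tau> \<beta>)) \<in> nodes g"
    and "mon (\<tau>(\<beta> := \<tau> \<beta> + 1)) = mon \<tau> - A_mon g q a (fst (step_par \<beta> (\<tau> \<beta>))) (snd (step_par \<beta> (\<tau> \<beta>)))"
    using raised_range[of \<tau> \<beta>] mon_raise[of \<tau> \<beta>] by (simp_all add: step_par_def node_in)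
next
  fix \<tau> assume "\<tau> \<in> tabs"
  show "mon \<tau> \<in> monomials g"
    unfolding mon_def by (intro monomials_sum bx_monomial)
next
  fix \<tau> i b assume "\<tau> \<in> tabs" "i \<in> nodes g"
  from pole_movable[OF this, of b]
  show "pole_ord g q i b (mon \<tau>) \<le> 1"
    and "pole_ord g q i b (mon \<tau>) = 1 \<longleftrightarrow>
      (\<exists>\<beta>\<in>S. \<exists>l. b = a * q powi l \<and> (\<tau>(\<beta> := \<tau> \<beta> + 1) \<in> tabs \<and> step_par \<beta> (\<tau> \<beta>) = (i, l)
         \<or> \<tau>(\<beta> := \<tau> \<beta> - 1) \<in> tabs \<and> step_par \<beta> (\<tau> \<beta> - 1) = (i, l)))"
    by blast+
next
  fix \<tau> \<beta> \<beta>' assume *: "\<tau> \<in> tabs" "\<beta> \<in> S" "\<beta>' \<in> S" "\<tau>(\<beta> := \<tau> \<beta> + 1) \<in> tabs" "\<tau>(\<beta>' := \<tau> \<beta>' + 1) \<in> tabs"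
    "step_par \<beta> (\<tau> \<beta>) = step_par \<beta>' (\<tau> \<beta>')"
  then have "\<tau> \<beta> = \<tau> \<beta>' \<and> diag \<beta> = diag \<beta>'"
    using raised_range[of \<tau> \<beta>] raised_range[of \<tau> \<beta>'] by (intro par_inj) (auto simp: step_par_def)
  then show "\<beta> = \<beta>'"
    using diag_unique[OF *(1-3)] by simp
next
  fix \<tau> \<beta> \<beta>' assume *: "\<tau> \<in> tabs" "\<beta> \<in> S" "\<beta>' \<in> S" "\<tau>(\<beta> := \<tau> \<beta> - 1) \<in> tabs" "\<tau>(\<beta>' := \<tau> \<beta>' - 1) \<in> tabs"
    "step_par \<beta> (\<tau> \<beta> - 1) = step_par \<beta>' (\<tau> \<beta>' - 1)"
  then have "\<tau> \<beta> - 1 = \<tau> \<beta>' - 1 \<and> diag \<beta> = diag \<beta>'"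
    using lowered_range[of \<tau> \<beta>] lowered_range[of \<tau> \<beta>'] by (intro par_inj) (auto simp: step_par_def)
  then show "\<beta> = \<beta>'"
    using diag_unique[OF *(1-3)] by simp
next
  fix \<tau> \<beta> \<beta>' assume *: "\<tau> \<in> tabs" "\<beta> \<in> S" "\<beta>' \<in> S" "\<tau>(\<beta> := \<tau> \<beta> + 1) \<in> tabs" "\<tau>(\<beta>' := \<tau> \<beta>' - 1) \<in> tabs"
  show "step_par \<beta> (\<tau> \<beta>) \<noteq> step_par \<beta>' (\<tau> \<beta>' - 1)"
  proof
    assume "step_par \<beta> (\<tau> \<beta>) = step_par \<beta>' (\<tau> \<beta>' - 1)"
    then have "\<tau> \<beta> = \<tau> \<beta>' - 1 \<and> diag \<beta> = diag \<beta>'"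
      using * raised_range[of \<tau> \<beta>] lowered_range[of \<tau> \<beta>'] by (intro par_inj) (auto simp: step_par_def)
    then show False
      using raise_lower_exclusive[OF *(1-3)] *(4) by simp
  qed
qed (fact valid q0 q_nru a0 finite_tabs finite_S low0_in low0_le)+

end

section \<open>The alphabets\<close>

fun top_letter :: "lie_type \<Rightarrow> int" where
  "top_letter (TypeA N) = int N + 1"
| "top_letter (TypeB N) = 2 * int N + 1"

fun letter_of :: "lie_type \<Rightarrow> int \<Rightarrow> letter" where
  "letter_of (TypeA N) x = Plain (nat x)"
| "letter_of (TypeB N) x = (if x \<le> int N then Plain (nat x) else if x = int N + 1 then Zero
     else Barred (nat (2 * int N + 2 - x)))"

fun row_rel :: "lie_type \<Rightarrow> int \<Rightarrow> int \<Rightarrow> bool" where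
  "row_rel (TypeA N) x y \<longleftrightarrow> x \<le> y"
| "row_rel (TypeB N) x y \<longleftrightarrow> x \<le> y \<and> \<not> (x = int N + 1 \<and> y = int N + 1)"

text \<open>The node of the \<open>A\<close> that leads from the letter \<open>x\<close> to
  \<open>x + 1\<close>. In type B node N serves two consecutive steps, into and out of the letter 0,
  which \<open>step_shift\<close> keeps apart.\<close>

fun step_node :: "lie_type \<Rightarrow> int \<Rightarrow> nat" where
  "step_node (TypeA N) x = nat x"
| "step_node (TypeB N) x = nat (if x \<le> int N then x else 2 * int N + 1 - x)"

fun step_shift :: "lie_type \<Rightarrow> int \<Rightarrow> int" where
  "step_shift (TypeA N) x = x"
| "step_shift (TypeB N) x = (if x \<le> int N then 2 * x else 2 * x - 4)"

lemma bij_letter_of: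
  assumes "valid_lie_type g"
  shows "bij_betw (letter_of g) {1..top_letter g} (alphabet g)"
proof (cases g)
  case (TypeA N)
  have "letter_of g ` {1..top_letter g} = alphabet g"
  proof -
    have "nat ` {1..int N + 1} = {1..N + 1}"
      by (auto simp: image_iff intro!: bexI[of _ "int _"])
    then show ?thesis
      by (simp add: TypeA image_image[of Plain nat, symmetric])
  qed
  moreover have "inj_on (letter_of g) {1..top_letter g}"
    by (auto simp: TypeA inj_on_def)
  ultimately show ?thesis
    by (simp add: bij_betw_def)
next
  case (TypeB N)
  have inj: "inj_on (letter_of g) {1..top_letter g}"
    by (auto simp: TypeB inj_on_def split: if_splits)
  have "letter_of g ` {1..top_letter g} \<subseteq> alphabet g"
    by (auto simp: TypeB image_iff)
  moreover have "alphabet g \<subseteq> letter_of g ` {1..top_letter g}"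
  proof
    fix y assume y: "y \<in> alphabet g"
    then show "y \<in> letter_of g ` {1..top_letter g}"
    proof (cases y)
      case (Plain i)
      then show ?thesis
        using y by (intro image_eqI[of _ _ "int i"]) (auto simp: TypeB)
    next
      case Zero
      then show ?thesis
        using y by (intro image_eqI[of _ _ "int N + 1"]) (auto simp: TypeB)
    next
      case (Barred i)
      then show ?thesis
        using y by (intro image_eqI[of _ _ "2 * int N + 2 - int i"]) (auto simp: TypeB)
    qed
  qed
  ultimately show ?thesis
    using inj by (simp add: bij_betw_def)
qed

lemma row_ok_letter_of:
  assumes "x \<in> {1..top_letter g}" "y \<in> {1..top_letter g}"
  shows "row_ok g (letter_of g x) (letter_of g y) \<longleftrightarrow> row_rel g x y"
  using assms by (cases g) (auto simp: less_eq_letter_def)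

lemma col_ok_letter_of:
  assumes "x \<in> {1..top_letter g}" "y \<in> {1..top_letter g}"
  shows "col_ok g (letter_of g x) (letter_of g y) \<longleftrightarrow> \<not> row_rel g y x"
  using assms by (cases g) (auto simp: less_eq_letter_def)

lemma row_rel_mono: "row_rel g x y \<Longrightarrow> x' \<le> x \<Longrightarrow> y \<le> y' \<Longrightarrow> row_rel g x' y'"
  by (cases g) auto

lemma row_rel_less: "x < y \<Longrightarrow> row_rel g x y"
  by (cases g) auto

lemma row_rel_le: "row_rel g x y \<Longrightarrow> x \<le> y"
  by (cases g) auto

lemma Y_outside: "i \<notin> nodes g \<Longrightarrow> Y g q a i k = 0"
  by (simp add: Y_def)

section \<open>The effect of one step on a single box\<close>

lemma A_mon_TypeA:
  assumes "j \<in> {1..N}"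
  shows "A_mon (TypeA N) q a j l = Y (TypeA N) q a j (l - 1) + Y (TypeA N) q a j (l + 1)
     - Y (TypeA N) q a (j - 1) l - Y (TypeA N) q a (Suc j) l"
proof -
  have "A_mon (TypeA N) q a j l = (if j > 1 then - Y (TypeA N) q a (j - 1) l else 0)
     + (Y (TypeA N) q a j (l - 1) + Y (TypeA N) q a j (l + 1))
     + (if j < N then - Y (TypeA N) q a (Suc j) l else 0)"
    unfolding A_mon_def nodes_def lie_rank.simps
    by (subst sum_neighbours[OF assms]) (use assms in \<open>auto simp: A_part_def\<close>)
  then show ?thesis
    using assms by (auto simp: Y_outside nodes_def)
qed

lemma A_mon_TypeB:
  assumes "j \<in> {1..N}"
  shows "A_mon (TypeB N) q a j l =
    (if j < N then Y (TypeB N) q a j (l - 2) + Y (TypeB N) q a j (l + 2) else Y (TypeB N) q a j (l - 1) + Y (TypeB N) q a j (l + 1))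
     - Y (TypeB N) q a (j - 1) l
     - (if j = N then 0 else if Suc j = N then Y (TypeB N) q a N (l - 1) + Y (TypeB N) q a N (l + 1) else Y (TypeB N) q a (Suc j) l)"
proof -
  have "A_mon (TypeB N) q a j l = (if j > 1 then - Y (TypeB N) q a (j - 1) l else 0)
     + (if j < N then Y (TypeB N) q a j (l - 2) + Y (TypeB N) q a j (l + 2) else Y (TypeB N) q a j (l - 1) + Y (TypeB N) q a j (l + 1))
     + (if j < N then (if Suc j = N then - Y (TypeB N) q a N (l - 1) - Y (TypeB N) q a N (l + 1) else - Y (TypeB N) q a (Suc j) l) else 0)"
    unfolding A_mon_def nodes_def lie_rank.simps
    by (subst sum_neighbours[OF assms]) (use assms in \<open>auto simp: A_part_def\<close>)
  then show ?thesis
    using assms by (auto simp: Y_outside nodes_def)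
qed

definition letter_box :: "lie_type \<Rightarrow> complex \<Rightarrow> complex \<Rightarrow> int \<Rightarrow> int \<Rightarrow> monomial" where
  "letter_box g q a x k = box g q a (letter_of g x) k"

lemma letter_box_TypeA: "letter_box (TypeA N) q a x k = - Y (TypeA N) q a (nat x - 1) (int (nat x) + k) + Y (TypeA N) q a (nat x) (int (nat x) - 1 + k)"
  by (simp add: letter_box_def Let_def)

lemma letter_box_monomial:
  assumes "q \<noteq> 0" "a \<noteq> 0"
  shows "letter_box g q a x k \<in> monomials g"
  using assms
  by (cases g) (auto simp: letter_box_def Let_def intro!: monomials_add monomials_diff monomials_uminus monomials_Y split: letter.splits)

text \<open>All indices are expressed through the integer letter \<open>x\<close>, barred letters
  included, so that the boxes of consecutive letters can be compared directly.\<close>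

lemma letter_box_TypeB:
  assumes "1 \<le> x" "x \<le> 2 * int N + 1"
  shows "letter_box (TypeB N) q a x k =
    (if x < int N then - Y (TypeB N) q a (nat (x - 1)) (2 * x + k) + Y (TypeB N) q a (nat x) (2 * x - 2 + k)
     else if x = int N then - Y (TypeB N) q a (nat (int N - 1)) (2 * int N + k) + Y (TypeB N) q a N (2 * int N - 3 + k) + Y (TypeB N) q a N (2 * int N - 1 + k)
     else if x = int N + 1 then - Y (TypeB N) q a N (2 * int N + 1 + k) + Y (TypeB N) q a N (2 * int N - 3 + k)
     else if x = int N + 2 then - Y (TypeB N) q a N (2 * int N - 1 + k) - Y (TypeB N) q a N (2 * int N + 1 + k) + Y (TypeB N) q a (nat (int N - 1)) (2 * int N - 2 + k)
     else - Y (TypeB N) q a (nat (2 * int N + 2 - x)) (2 * x - 4 + k) + Y (TypeB N) q a (nat (2 * int N + 1 - x)) (2 * x - 6 + k))"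
proof -
  consider "x < int N" | "x = int N" | "x = int N + 1" | "x = int N + 2" | "x > int N + 2"
    by linarith
  then show ?thesis
  proof cases
    case 1
    define i where "i = nat x"
    have i: "i < N" "int i = x" "i - 1 = nat (x - 1)"
      using 1 assms by (auto simp: i_def)
    have "letter_box (TypeB N) q a x k = - Y (TypeB N) q a (i - 1) (2 * int i + k) + Y (TypeB N) q a i (2 * int i - 2 + k)"
      using 1 i(1) by (simp add: letter_box_def Let_def i_def[symmetric])
    then show ?thesis
      using 1 by (simp only: i(2,3)) (simp add: i_def)
  next
    case 2
    then have "nat x = N" "N - 1 = nat (int N - 1)"
      by auto
    then show ?thesis
      using 2 by (simp add: letter_box_def Let_def)
  next
    case 3
    then show ?thesis
      by (simp add: letter_box_def Let_def)
  next
    case 4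
    then have "nat (2 * int N + 2 - x) = N" "N - 1 = nat (int N - 1)"
      by auto
    then show ?thesis
      using 4 by (simp add: letter_box_def Let_def)
  next
    case 5
    define i where "i = nat (2 * int N + 2 - x)"
    have i: "i < N" "int i = 2 * int N + 2 - x" "i - 1 = nat (2 * int N + 1 - x)"
      using 5 assms by (auto simp: i_def)
    have "letter_box (TypeB N) q a x k = - Y (TypeB N) q a i (4 * int N - 2 * int i + k) + Y (TypeB N) q a (i - 1) (4 * int N - 2 - 2 * int i + k)"
      using 5 i(1) by (simp add: letter_box_def Let_def i_def[symmetric])
    moreover have "4 * int N - 2 * int i + k = 2 * x - 4 + k" "4 * int N - 2 - 2 * int i + k = 2 * x - 6 + k"
      using i(2) by simp_all
    ultimately show ?thesis
      using 5 by (simp only: i(3)) (simp add: i_def)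
  qed
qed

text \<open>In type B the neighbourhood of the short node needs separate cases: for
  \<open>x = N - 1\<close> and \<open>x = N + 2\<close> the monomial \<open>A\<close> has two
  factors at node N, and for \<open>x = N\<close> and \<open>x = N + 1\<close> it belongs to node N
  itself.\<close>

lemma letter_box_step:
  assumes "valid_lie_type g" "1 \<le> x" "x < top_letter g"
  shows "letter_box g q a (x + 1) k = letter_box g q a x k - A_mon g q a (step_node g x) (step_shift g x + k)"
proof (cases g)
  case (TypeA N)
  have x: "nat x \<in> {1..N}" "nat (x + 1) = Suc (nat x)" "int (nat x) = x"
    using assms TypeA by auto
  show ?thesis
    unfolding TypeA letter_box_TypeA step_node.simps step_shift.simps A_mon_TypeA[OF x(1)]
    using x by (simp add: algebra_simps)
next
  case (TypeB N)
  have N: "2 \<le> N" and x: "1 \<le> x" "x < 2 * int N + 1"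
    using assms TypeB by auto
  consider "x < int N - 1" | "x = int N - 1" | "x = int N" | "x = int N + 1" | "x = int N + 2" | "x > int N + 2"
    by linarith
  then show ?thesis
  proof cases
    case 1
    have j: "nat x \<in> {1..N}" "nat x < N" "Suc (nat x) \<noteq> N" "nat x \<noteq> N" "nat x - 1 = nat (x - 1)" "Suc (nat x) = nat (x + 1)"
      using x 1 by auto
    show ?thesis
      unfolding TypeB using 1 x j by (simp add: letter_box_TypeB A_mon_TypeB[OF j(1)] algebra_simps)
  next
    case 2
    have j: "nat x \<in> {1..N}" "nat x < N" "Suc (nat x) = N" "nat x \<noteq> N" "nat x - 1 = nat (x - 1)"
      using x 2 by auto
    have n: "int N = x + 1" "nat (int N - 1) = nat x"
      using 2 by auto
    show ?thesis
      unfolding TypeB using x j by (simp add: letter_box_TypeB A_mon_TypeB[OF j(1)] n algebra_simps)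
  next
    case 3
    have j: "N \<in> {1..N}" "N - 1 = nat (int N - 1)"
      using N by auto
    show ?thesis
      unfolding TypeB using 3 x j by (simp add: letter_box_TypeB A_mon_TypeB[OF j(1)] algebra_simps)
  next
    case 4
    have j: "N \<in> {1..N}" "N - 1 = nat (int N - 1)"
      using N by auto
    show ?thesis
      unfolding TypeB using 4 x j by (simp add: letter_box_TypeB A_mon_TypeB[OF j(1)] algebra_simps)
  next
    case 5
    define J where "J = N - 1"
    have j: "J \<in> {1..N}" "J < N" "Suc J = N" "J \<noteq> N" "nat (2 * int N + 1 - x) = J"
      "nat (int N - 1) = J" "nat (2 * int N - x) = J - 1" "nat (int N - 2) = J - 1"
      using N x 5 by (auto simp: J_def)
    show ?thesis
      unfolding TypeB using 5 x j by (simp add: letter_box_TypeB A_mon_TypeB[OF j(1)] algebra_simps)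
  next
    case 6
    define J where "J = nat (2 * int N + 1 - x)"
    have j: "J \<in> {1..N}" "J < N" "Suc J \<noteq> N" "J \<noteq> N" "nat (2 * int N + 1 - x) = J"
      "nat (2 * int N + 2 - x) = Suc J" "nat (2 * int N - x) = J - 1"
      using N x 6 by (auto simp: J_def)
    show ?thesis
      unfolding TypeB using 6 x j by (simp add: letter_box_TypeB A_mon_TypeB[OF j(1)] algebra_simps)
  qed
qed

lemma step_node_in:
  assumes "valid_lie_type g" "1 \<le> x" "x < top_letter g"
  shows "step_node g x \<in> nodes g"
  using assms by (cases g) (auto simp: nodes_def)

text \<open>In type B two distinct letters with the same node satisfy x + x' = 2 N + 1. Hence x - x'
  is odd and the shifts 2 x and 2 x' - 4 differ modulo 4, whereas a change of diagonal contributes a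
  multiple of 4.\<close>

lemma step_inj:
  assumes "1 \<le> x" "x < top_letter g" "1 \<le> x'" "x' < top_letter g" "step_node g x = step_node g x'"
    "step_shift g x + 2 * dual_lacing g * d = step_shift g x' + 2 * dual_lacing g * d'"
  shows "x = x' \<and> d = d'"
proof (cases g)
  case (TypeA N)
  then show ?thesis
    using assms by auto
next
  case (TypeB N)
  have r: "1 \<le> x" "x \<le> 2 * int N" "1 \<le> x'" "x' \<le> 2 * int N"
    using assms TypeB by auto
  have "(if x \<le> int N then x else 2 * int N + 1 - x) = (if x' \<le> int N then x' else 2 * int N + 1 - x')"
    using assms(5) r by (subst (asm) TypeB, subst (asm) TypeB, simp only: step_node.simps) (auto split: if_splits)
  then consider "x = x'" | "x \<le> int N" "x' > int N" "x + x' = 2 * int N + 1"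
    | "x' \<le> int N" "x > int N" "x + x' = 2 * int N + 1"
    using r by (auto split: if_splits)
  then show ?thesis
  proof cases
    case 1
    then show ?thesis
      using assms(6) TypeB by simp
  next
    case 2
    then have "2 * x + 4 * d = 2 * x' - 4 + 4 * d'"
      using assms(6) TypeB by simp
    then show ?thesis
      using 2(3) by presburger
  next
    case 3
    then have "2 * x - 4 + 4 * d = 2 * x' + 4 * d'"
      using assms(6) TypeB by simp
    then show ?thesis
      using 3(3) by presburger
  qed
qed

section \<open>Zeros and poles contributed by a single box\<close>

lemma pole_ord_uminus: "pole_ord g q i b (- m) = - pole_ord g q i b m"
  by (simp add: pole_ord_def)

lemma pole_ord_Y_other:
  assumes "q \<noteq> 0" "\<And>l. b \<noteq> a * q powi l"
  shows "pole_ord g q i b (Y g q a j k) = 0"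
proof -
  have "b * q powi r \<noteq> a * q powi k" for r
  proof
    assume "b * q powi r = a * q powi k"
    then have "b = a * q powi (k - r)"
      using assms(1) by (simp add: power_int_diff field_simps)
    then show False
      using assms(2) by blast
  qed
  then show ?thesis
    by (simp add: pole_ord_def lookup_Y)
qed

lemma pole_ord_letter_box_other:
  assumes "q \<noteq> 0" "\<And>l. b \<noteq> a * q powi l"
  shows "pole_ord g q i b (letter_box g q a x k) = 0"
  using pole_ord_Y_other[OF assms]
  by (cases g) (auto simp: letter_box_def Let_def pole_ord_add pole_ord_diff pole_ord_uminus)

lemma pole_ord_Y_TypeA:
  assumes "q \<noteq> 0" "not_root_of_unity q" "a \<noteq> 0" "1 \<le> I" "I \<le> int N"
  shows "pole_ord (TypeA N) q (nat I) (a * q powi l) (Y (TypeA N) q a j k)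
    = (if I = int j then (if k = l - 1 then 1 else 0) - (if k = l + 1 then 1 else 0) else 0)"
  using assms by (auto simp: pole_ord_Y nodes_def)

lemma pole_ord_Y_TypeB:
  assumes "q \<noteq> 0" "not_root_of_unity q" "a \<noteq> 0" "1 \<le> I" "I \<le> int N"
  shows "pole_ord (TypeB N) q (nat I) (a * q powi l) (Y (TypeB N) q a j k)
    = (if I = int j then (if k = l - (if I < int N then 2 else 1) then 1 else 0) - (if k = l + (if I < int N then 2 else 1) then 1 else 0) else 0)"
  using assms by (auto simp: pole_ord_Y nodes_def)

lemma pole_ord_letter_box_TypeA:
  assumes "q \<noteq> 0" "not_root_of_unity q" "a \<noteq> 0" "1 \<le> I" "I \<le> int N" "1 \<le> y"
  shows "pole_ord (TypeA N) q (nat I) (a * q powi l) (letter_box (TypeA N) q a y k)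
    = (if I = y then (if y - 1 + k = l - 1 then 1 else 0) - (if y - 1 + k = l + 1 then 1 else 0) else 0)
    - (if I = y - 1 then (if y + k = l - 1 then 1 else 0) - (if y + k = l + 1 then 1 else 0) else 0)"
proof -
  have "int (nat y) = y" "int (nat y - 1) = y - 1"
    using assms(6) by auto
  then show ?thesis
    by (simp only: letter_box_TypeA pole_ord_add pole_ord_uminus pole_ord_Y_TypeA[OF assms(1-5)])
qed

lemma pole_step_TypeA:
  assumes q: "q \<noteq> 0" "not_root_of_unity q" "a \<noteq> 0" and x: "1 \<le> x" "x < top_letter (TypeA N)" "1 \<le> y"
  shows "pole_ord (TypeA N) q (step_node (TypeA N) x) (a * q powi (step_shift (TypeA N) x + 2 * dual_lacing (TypeA N) * d0))
       (letter_box (TypeA N) q a y (2 * dual_lacing (TypeA N) * d)) =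
        (if d = d0 \<and> y = x then 1 else 0) + (if d = d0 \<and> y = x + 1 then 1 else 0)
        - (if d = d0 - 1 \<and> row_rel (TypeA N) y (x + 1) \<and> \<not> row_rel (TypeA N) y x then 1 else 0)
        - (if d = d0 + 1 \<and> row_rel (TypeA N) x y \<and> \<not> row_rel (TypeA N) (x + 1) y then 1 else 0)"
proof -
  have "x \<le> int N"
    using x by simp
  show ?thesis
    unfolding step_node.simps pole_ord_letter_box_TypeA[OF q x(1) \<open>x \<le> int N\<close> x(3)] by auto
qed

lemma pole_no_step_TypeA:
  assumes q: "q \<noteq> 0" "not_root_of_unity q" "a \<noteq> 0" and i: "i \<in> nodes (TypeA N)"
    and l: "\<And>x d0. 1 \<le> x \<Longrightarrow> x < top_letter (TypeA N) \<Longrightarrow> step_node (TypeA N) x = i \<Longrightarrow>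
       l \<noteq> step_shift (TypeA N) x + 2 * dual_lacing (TypeA N) * d0"
    and y: "1 \<le> y"
  shows "pole_ord (TypeA N) q i (a * q powi l) (letter_box (TypeA N) q a y (2 * dual_lacing (TypeA N) * d)) = 0"
proof -
  have I: "1 \<le> int i" "int i \<le> int N"
    using i by (auto simp: nodes_def)
  have "l \<noteq> int i + 2 * d0" for d0
    using l[of "int i" d0] I by simp
  from this[of "d - 1"] this[of d] this[of "d + 1"] show ?thesis
    using pole_ord_letter_box_TypeA[OF q I y, of l "2 * dual_lacing (TypeA N) * d"] by (auto split: if_splits)
qed

text \<open>With nodes, letters and exponents all integers, the comparison in type B becomes a
  problem of Presburger arithmetic.\<close>

definition Y_pole :: "int \<Rightarrow> int \<Rightarrow> int \<Rightarrow> int \<Rightarrow> int \<Rightarrow> int" where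
  "Y_pole n I l j k = (if I = j then (if k = l - (if I < n then 2 else 1) then 1 else 0)
     - (if k = l + (if I < n then 2 else 1) then 1 else 0) else 0)"

definition box_pole :: "int \<Rightarrow> int \<Rightarrow> int \<Rightarrow> int \<Rightarrow> int \<Rightarrow> int" where
  "box_pole n I l y k =
    (if y < n then Y_pole n I l y (2 * y - 2 + k) - Y_pole n I l (y - 1) (2 * y + k)
     else if y = n then Y_pole n I l n (2 * n - 3 + k) + Y_pole n I l n (2 * n - 1 + k) - Y_pole n I l (n - 1) (2 * n + k)
     else if y = n + 1 then Y_pole n I l n (2 * n - 3 + k) - Y_pole n I l n (2 * n + 1 + k)
     else if y = n + 2 then Y_pole n I l (n - 1) (2 * n - 2 + k) - Y_pole n I l n (2 * n - 1 + k) - Y_pole n I l n (2 * n + 1 + k)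
     else Y_pole n I l (2 * n + 1 - y) (2 * y - 6 + k) - Y_pole n I l (2 * n + 2 - y) (2 * y - 4 + k))"

lemma pole_ord_letter_box_TypeB:
  assumes "q \<noteq> 0" "not_root_of_unity q" "a \<noteq> 0" "2 \<le> N" "1 \<le> I" "I \<le> int N" "1 \<le> y" "y \<le> 2 * int N + 1"
  shows "pole_ord (TypeB N) q (nat I) (a * q powi l) (letter_box (TypeB N) q a y k) = box_pole (int N) I l y k"
proof -
  have P: "pole_ord (TypeB N) q (nat I) (a * q powi l) (Y (TypeB N) q a j k) = Y_pole (int N) I l (int j) k" for j k
    unfolding Y_pole_def by (rule pole_ord_Y_TypeB[OF assms(1-3,5,6)])
  have n: "int (nat (y - 1)) = y - 1" "int (nat y) = y" "int (nat (int N - 1)) = int N - 1"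
    "int (nat (2 * int N + 1 - y)) = 2 * int N + 1 - y" "int (nat (2 * int N + 2 - y)) = 2 * int N + 2 - y"
    using assms(4-8) by auto
  show ?thesis
    unfolding letter_box_TypeB[OF assms(7,8)] box_pole_def
    by (simp only: pole_ord_add pole_ord_diff pole_ord_uminus P n if_distrib[of "pole_ord _ _ _ _"] cong: if_cong) simp
qed

lemma box_pole_step:
  fixes n x y d d0 :: int
  assumes range: "2 \<le> n" "1 \<le> x" "x \<le> 2 * n" "1 \<le> y" "y \<le> 2 * n + 1"
  shows "box_pole n (if x \<le> n then x else 2 * n + 1 - x) ((if x \<le> n then 2 * x else 2 * x - 4) + 4 * d0) y (4 * d) =
     (if d = d0 \<and> y = x then 1 else 0) + (if d = d0 \<and> y = x + 1 then 1 else 0)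
     - (if d = d0 - 1 \<and> (y \<le> x + 1 \<and> \<not> (y = n + 1 \<and> x + 1 = n + 1)) \<and> \<not> (y \<le> x \<and> \<not> (y = n + 1 \<and> x = n + 1)) then 1 else 0)
     - (if d = d0 + 1 \<and> (x \<le> y \<and> \<not> (x = n + 1 \<and> y = n + 1)) \<and> \<not> (x + 1 \<le> y \<and> \<not> (x + 1 = n + 1 \<and> y = n + 1)) then 1 else 0)"
proof -
  have x: "x < n \<or> x = n \<or> x = n + 1 \<or> x > n + 1"
    by linarith
  consider "y < n" | "y = n" | "y = n + 1" | "y = n + 2" | "y > n + 2"
    by linarith
  then show ?thesis
  proof cases
    case 1
    from x show ?thesis
      unfolding box_pole_def Y_pole_def using range 1 by (elim disjE) (simp; presburger)+
  next
    case 2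
    from x show ?thesis
      unfolding box_pole_def Y_pole_def using range 2 by (elim disjE) (simp; presburger)+
  next
    case 3
    from x show ?thesis
      unfolding box_pole_def Y_pole_def using range 3 by (elim disjE) (simp; presburger)+
  next
    case 4
    from x show ?thesis
      unfolding box_pole_def Y_pole_def using range 4 by (elim disjE) (simp; presburger)+
  next
    case 5
    from x show ?thesis
      unfolding box_pole_def Y_pole_def using range 5 by (elim disjE) (simp; presburger)+
  qed
qed

text \<open>In a box, the exponents at nodes below N are even and poles lie at distance 2; at node N
  they are odd and poles lie at distance 1. Either way zeros and poles sit at even
  exponents.\<close>

lemma box_pole_odd:
  fixes n I l y d :: int
  assumes "2 \<le> n" "odd l"
  shows "box_pole n I l y (4 * d) = 0"
proof -
  have z: "Y_pole n I l j (2 * u + 4 * d) = 0" if "j < n" for j u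
  proof -
    have "2 * u + 4 * d \<noteq> l - 2" "2 * u + 4 * d \<noteq> l + 2"
      using assms(2) by presburger+
    then show ?thesis
      using that by (simp add: Y_pole_def)
  qed
  have z': "Y_pole n I l n (2 * u + 1 + 4 * d) = 0" for u
  proof -
    have "2 * u + 1 + 4 * d \<noteq> l - 1" "2 * u + 1 + 4 * d \<noteq> l + 1"
      using assms(2) by presburger+
    then show ?thesis
      by (simp add: Y_pole_def)
  qed
  show ?thesis
    using z[of y "y - 1"] z[of "y - 1" y] z[of "n - 1" n] z[of "n - 1" "n - 1"] z'[of "n - 2"] z'[of "n - 1"] z'[of n]
      z[of "2 * n + 1 - y" "y - 3"] z[of "2 * n + 2 - y" "y - 2"]
    unfolding box_pole_def by simp
qed

lemma pole_step:
  assumes q: "q \<noteq> 0" "not_root_of_unity q" "a \<noteq> 0" and g: "valid_lie_type g"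
    and x: "1 \<le> x" "x < top_letter g" "1 \<le> y" "y \<le> top_letter g"
  shows "pole_ord g q (step_node g x) (a * q powi (step_shift g x + 2 * dual_lacing g * d0))
       (letter_box g q a y (2 * dual_lacing g * d)) =
        (if d = d0 \<and> y = x then 1 else 0) + (if d = d0 \<and> y = x + 1 then 1 else 0)
        - (if d = d0 - 1 \<and> row_rel g y (x + 1) \<and> \<not> row_rel g y x then 1 else 0)
        - (if d = d0 + 1 \<and> row_rel g x y \<and> \<not> row_rel g (x + 1) y then 1 else 0)"
proof (cases g)
  case (TypeA N)
  show ?thesis
    unfolding TypeA by (rule pole_step_TypeA) (use q x TypeA in auto)
next
  case (TypeB N)
  have N: "2 \<le> N" "2 \<le> int N"
    using g TypeB by simp_all
  have r: "1 \<le> x" "x \<le> 2 * int N" "1 \<le> y" "y \<le> 2 * int N + 1"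
    using x TypeB by simp_all
  have I: "1 \<le> (if x \<le> int N then x else 2 * int N + 1 - x)" "(if x \<le> int N then x else 2 * int N + 1 - x) \<le> int N"
    using r by auto
  have K: "2 * dual_lacing (TypeB N) * d = 4 * d" for d
    by simp
  show ?thesis
    unfolding TypeB step_node.simps step_shift.simps row_rel.simps K
      pole_ord_letter_box_TypeB[OF q N(1) I r(3,4)]
    by (rule box_pole_step[OF N(2) r])
qed

lemma pole_no_step:
  assumes q: "q \<noteq> 0" "not_root_of_unity q" "a \<noteq> 0" and g: "valid_lie_type g" and i: "i \<in> nodes g"
    and l: "\<And>x d0. 1 \<le> x \<Longrightarrow> x < top_letter g \<Longrightarrow> step_node g x = i \<Longrightarrow>
       l \<noteq> step_shift g x + 2 * dual_lacing g * d0"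
    and y: "1 \<le> y" "y \<le> top_letter g"
  shows "pole_ord g q i (a * q powi l) (letter_box g q a y (2 * dual_lacing g * d)) = 0"
proof (cases g)
  case (TypeA N)
  show ?thesis
    unfolding TypeA by (rule pole_no_step_TypeA) (use q i l y TypeA in auto)
next
  case (TypeB N)
  have N: "2 \<le> N" "2 \<le> int N"
    using g TypeB by simp_all
  have r: "1 \<le> y" "y \<le> 2 * int N + 1"
    using y TypeB by simp_all
  have I: "1 \<le> int i" "int i \<le> int N"
    using i TypeB by (auto simp: nodes_def)
  have "l \<noteq> 2 * int i + 4 * d0" for d0
    using l[of "int i" d0] I TypeB by simp
  moreover have "l \<noteq> 2 * (2 * int N + 1 - int i) - 4 + 4 * d0" for d0
    using l[of "2 * int N + 1 - int i" d0] I TypeB by simp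
  \<comment> \<open>The steps at node i use the exponents congruent to 2 i and to 2 i + 2 modulo 4,
    which together exhaust the even integers.\<close>
  ultimately have "odd l"
  proof (intro notI)
    assume *: "\<And>d0. l \<noteq> 2 * int i + 4 * d0" "\<And>d0. l \<noteq> 2 * (2 * int N + 1 - int i) - 4 + 4 * d0" "even l"
    then obtain m where m: "l = 2 * m"
      by blast
    show False
    proof (cases "even (m - int i)")
      case True
      then obtain c where "m - int i = 2 * c"
        by blast
      then show False
        using *(1)[of c] m by simp
    next
      case False
      then obtain c where "m - int i = 2 * c + 1"
        by (rule oddE)
      then show False
        using *(2)[of "c + int i - int N + 1"] m by simp
    qed
  qed
  have "pole_ord (TypeB N) q (nat (int i)) (a * q powi l) (letter_box (TypeB N) q a y (4 * d)) = 0"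
    unfolding pole_ord_letter_box_TypeB[OF q N(1) I r] by (rule box_pole_odd[OF N(2) \<open>odd l\<close>])
  then show ?thesis
    by (simp add: TypeB)
qed

section \<open>The skew diagram of a snake\<close>

text \<open>The lower bound for the rows of column \<open>t\<close> as an integer; the division is
  exact by the congruence that defines \<open>snake_points\<close>.\<close>

definition column_top :: "lie_type \<Rightarrow> (nat \<Rightarrow> nat) \<Rightarrow> (nat \<Rightarrow> int) \<Rightarrow> nat \<Rightarrow> int" where
  "column_top g i k t = int t - (k t + dual_lacing g * (int (i t) - 1)) div (2 * dual_lacing g)"

text \<open>Only boxes with letters above \<open>plain_bound g\<close> are affected by the spin node of type B.\<close>

fun plain_bound :: "lie_type \<Rightarrow> int" where
  "plain_bound (TypeA N) = int N"
| "plain_bound (TypeB N) = int N - 1"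

lemma dual_lacing_pos: "dual_lacing g > 0"
  by (cases g) auto

lemma plain_bound_less: "valid_lie_type g \<Longrightarrow> plain_bound g < top_letter g"
  by (cases g) auto

lemma row_rel_refl: "x \<le> plain_bound g + 1 \<Longrightarrow> row_rel g x x"
  by (cases g) auto

lemma snake_point:
  assumes "is_snake g T i k" "t \<in> {1..T}"
  shows "i t \<in> nodes g" "1 \<le> i t" "int (i t) \<le> plain_bound g"
    and "k t + dual_lacing g * (int (i t) - 1) = 2 * dual_lacing g * (int t - column_top g i k t)"
proof -
  have p: "(i t, k t) \<in> snake_points g"
    using assms by (simp add: is_snake_def)
  have "2 * dual_lacing g dvd k t + dual_lacing g * (int (i t) - 1)"
  proof (cases g)
    case (TypeA N)
    have "(int (i t) - k t) mod 2 = 1"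
      using p TypeA by (simp add: cong_def)
    then show ?thesis
      using TypeA by simp presburger
  next
    case (TypeB N)
    have "(2 * int (i t) - k t) mod 4 = 2"
      using p TypeB by (simp add: cong_def)
    then show ?thesis
      using TypeB by simp presburger
  qed
  then show "k t + dual_lacing g * (int (i t) - 1) = 2 * dual_lacing g * (int t - column_top g i k t)"
    by (simp add: column_top_def)
  show "i t \<in> nodes g" "1 \<le> i t" "int (i t) \<le> plain_bound g"
    using p by (cases g; auto simp: nodes_def)+
qed

lemma snake_step:
  assumes "is_snake g T i k" "t \<in> {1..T}" "Suc t \<in> {1..T}"
  shows "k (Suc t) - k t \<ge> dual_lacing g * \<bar>int (i (Suc t)) - int (i t)\<bar> + 2 * dual_lacing g"
proof -
  have "Suc t \<in> {2..T}"
    using assms(2,3) by auto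
  then have "snake_position g (i (Suc t - 1), k (Suc t - 1)) (i (Suc t), k (Suc t))"
    using assms(1) unfolding is_snake_def by blast
  then show ?thesis
    by (cases g) auto
qed

text \<open>The absolute value in the snake condition yields two inequalities, one for the tops of
  the columns and one for their bottoms. Together they make the shape skew.\<close>

lemma columns_descend:
  assumes "is_snake g T i k" "t \<in> {1..T}" "t' \<in> {1..T}" "t \<le> t'"
  shows "column_top g i k t' \<le> column_top g i k t
    \<and> column_top g i k t' + int (i t') \<le> column_top g i k t + int (i t)"
  using assms(4,3)
proof (induction t' rule: dec_induct)
  case (step u)
  have u: "u \<in> {1..T}" "Suc u \<in> {1..T}"
    using assms(2) step by auto
  have "column_top g i k (Suc u) \<le> column_top g i k u
    \<and> column_top g i k (Suc u) + int (i (Suc u)) \<le> column_top g i k u + int (i u)"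
    using snake_point(4)[OF assms(1) u(1)] snake_point(4)[OF assms(1) u(2)] snake_step[OF assms(1) u]
      abs_ge_self[of "int (i (Suc u)) - int (i u)"] abs_ge_minus_self[of "int (i (Suc u)) - int (i u)"]
    by (cases g) (simp_all add: algebra_simps)
  then show ?case
    using step.IH[OF u(1)] by linarith
qed simp

lemma skew_diagram_iff:
  assumes "is_snake g T i k"
  shows "(s, t) \<in> skew_diagram g T i k \<longleftrightarrow>
    t \<in> {1..T} \<and> column_top g i k t \<le> s \<and> s < column_top g i k t + int (i t)"
proof (cases "t \<in> {1..T}")
  case True
  define R where "R = dual_lacing g"
  define c where "c = int t - column_top g i k t"
  have R: "real_of_int R > 0"
    using dual_lacing_pos by (simp add: R_def)
  have "real_of_int (k t + R * (int (i t) - 1)) = real_of_int (2 * R * c)"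
    using snake_point(4)[OF assms True] by (simp only: R_def c_def)
  then have c: "of_int (k t) / (2 * of_int R) + (real (i t) - 1) / 2 = real_of_int c"
    using R by (simp add: field_simps)
  have "real_of_int c = real t - of_int (column_top g i k t)" "real (i t) = 2 * ((real (i t) - 1) / 2) + 1"
    by (simp_all add: c_def field_simps)
  with c have "real t - of_int (k t) / (2 * of_int R) - (real (i t) - 1) / 2 = of_int (column_top g i k t)"
    and "real t - of_int (k t) / (2 * of_int R) + (real (i t) - 1) / 2 = of_int (column_top g i k t + int (i t) - 1)"
    by (simp_all only: of_int_add of_int_diff of_int_1 of_int_of_nat_eq)
  then show ?thesis
    using True unfolding skew_diagram_def R_def[symmetric] mem_Collect_eq prod.case of_int_le_iff
    by (simp only: of_int_le_iff) auto
qed (auto simp: skew_diagram_def)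

lemma skew_diagram_eq:
  assumes "is_snake g T i k"
  shows "skew_diagram g T i k = (\<lambda>(t, j). (column_top g i k t + int j, t)) ` (SIGMA t:{1..T}. {..<i t})"
proof (rule set_eqI)
  fix \<beta> :: "int \<times> nat"
  obtain s t where \<beta>: "\<beta> = (s, t)"
    by (cases \<beta>)
  show "\<beta> \<in> skew_diagram g T i k \<longleftrightarrow> \<beta> \<in> (\<lambda>(t, j). (column_top g i k t + int j, t)) ` (SIGMA t:{1..T}. {..<i t})"
  proof
    assume "\<beta> \<in> skew_diagram g T i k"
    then have "t \<in> {1..T}" "column_top g i k t \<le> s" "s < column_top g i k t + int (i t)"
      using skew_diagram_iff[OF assms, of s t] by (simp_all add: \<beta>)
    then show "\<beta> \<in> (\<lambda>(t, j). (column_top g i k t + int j, t)) ` (SIGMA t:{1..T}. {..<i t})"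
      by (intro image_eqI[of _ _ "(t, nat (s - column_top g i k t))"]) (auto simp: \<beta>)
  qed (auto simp: \<beta> skew_diagram_iff[OF assms])
qed

lemma skew_tableaux_snake:
  assumes "is_snake g T i k"
  shows "skew_tableaux (row_rel g) (skew_diagram g T i k)"
proof
  show "finite (skew_diagram g T i k)"
    unfolding skew_diagram_eq[OF assms] by simp
  fix s t s' t' s1 t1
  assume *: "(s, t) \<in> skew_diagram g T i k" "(s', t') \<in> skew_diagram g T i k" "s \<le> s1" "s1 \<le> s'" "t \<le> t1" "t1 \<le> t'"
  note iff = skew_diagram_iff[OF assms]
  have t: "t \<in> {1..T}" "t' \<in> {1..T}" "t1 \<in> {1..T}"
    using *(1,2,5,6) by (auto simp: iff)
  show "(s1, t1) \<in> skew_diagram g T i k"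
    using columns_descend[OF assms t(1,3) *(5)] columns_descend[OF assms t(3,2) *(6)] * t by (simp add: iff)
qed (fact row_rel_mono row_rel_less row_rel_le)+

section \<open>The tableau of the highest l-weight\<close>

definition first_tableau :: "lie_type \<Rightarrow> nat \<Rightarrow> (nat \<Rightarrow> nat) \<Rightarrow> (nat \<Rightarrow> int) \<Rightarrow> int \<times> nat \<Rightarrow> int" where
  "first_tableau g T i k \<beta> = (if \<beta> \<in> skew_diagram g T i k then fst \<beta> - column_top g i k (snd \<beta>) + 1 else 0)"

lemma first_tableau_in:
  assumes g: "valid_lie_type g" and s: "is_snake g T i k"
  shows "first_tableau g T i k \<in> skew_tableaux.tabs (top_letter g) (row_rel g) (skew_diagram g T i k)"
proof -
  interpret skew_tableaux "top_letter g" "row_rel g" "skew_diagram g T i k"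
    by (rule skew_tableaux_snake[OF s])
  note iff = skew_diagram_iff[OF s]
  have range: "1 \<le> first_tableau g T i k (s', t) \<and> first_tableau g T i k (s', t) \<le> plain_bound g"
    if "(s', t) \<in> skew_diagram g T i k" for s' t
    using that snake_point(3)[OF s, of t] by (simp add: first_tableau_def iff)
  have row: "row_rel g (first_tableau g T i k (s', t)) (first_tableau g T i k (s', t + 1))"
    if "(s', t) \<in> skew_diagram g T i k" "(s', t + 1) \<in> skew_diagram g T i k" for s' t
  proof (rule row_rel_mono[OF row_rel_refl])
    show "first_tableau g T i k (s', t) \<le> plain_bound g + 1"
      using range[OF that(1)] by simp
    show "first_tableau g T i k (s', t) \<le> first_tableau g T i k (s', t + 1)"
      using that columns_descend[OF s, of t "t + 1"] by (simp add: first_tableau_def iff)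
  qed simp
  have col: "\<not> row_rel g (first_tableau g T i k (s' + 1, t)) (first_tableau g T i k (s', t))"
    if "(s', t) \<in> skew_diagram g T i k" "(s' + 1, t) \<in> skew_diagram g T i k" for s' t
    using that row_rel_le[of g "first_tableau g T i k (s' + 1, t)" "first_tableau g T i k (s', t)"]
    by (auto simp: first_tableau_def)
  have "1 \<le> first_tableau g T i k \<beta> \<and> first_tableau g T i k \<beta> \<le> top_letter g" if "\<beta> \<in> skew_diagram g T i k" for \<beta>
    using range[of "fst \<beta>" "snd \<beta>"] that plain_bound_less[OF g] by simp
  then show ?thesis
    unfolding tabs_def using row col by (auto simp: first_tableau_def)
qed

text \<open>A column grows by at least 1 per box except between two letters 0 of type B. In type B
  its length is below N, so the bound 1, 2, 3, ... never gets as far as that letter.\<close>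

lemma first_tableau_le:
  assumes s: "is_snake g T i k" and \<tau>: "\<tau> \<in> skew_tableaux.tabs (top_letter g) (row_rel g) (skew_diagram g T i k)"
  shows "first_tableau g T i k \<beta> \<le> \<tau> \<beta>"
proof -
  interpret skew_tableaux "top_letter g" "row_rel g" "skew_diagram g T i k"
    by (rule skew_tableaux_snake[OF s])
  note iff = skew_diagram_iff[OF s]
  show ?thesis
  proof (cases "\<beta> \<in> skew_diagram g T i k")
    case True
    obtain s' t where \<beta>: "\<beta> = (s', t)"
      by (cases \<beta>)
    let ?c = "column_top g i k t"
    have t: "t \<in> {1..T}" "?c \<le> s'" "s' < ?c + int (i t)"
      using True by (simp_all add: \<beta> iff)
    have "s' - ?c + 1 \<le> \<tau> (s', t)"
      using t(2,3)
    proof (induction s' rule: int_ge_induct)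
      case base
      then show ?case
        using tabs_range[OF \<tau>, of "(?c, t)"] t(1) by (simp add: iff)
    next
      case (step s1)
      have S: "(s1, t) \<in> skew_diagram g T i k" "(s1 + 1, t) \<in> skew_diagram g T i k"
        using step t(1) by (simp_all add: iff)
      have IH: "s1 - ?c + 1 \<le> \<tau> (s1, t)"
        using step by simp
      have V: "\<not> row_rel g (\<tau> (s1 + 1, t)) (\<tau> (s1, t))"
        by (rule tabs_col[OF \<tau> S])
      have "\<tau> (s1 + 1, t) \<noteq> s1 - ?c + 1"
      proof
        assume *: "\<tau> (s1 + 1, t) = s1 - ?c + 1"
        have "row_rel g (s1 - ?c + 1) (s1 - ?c + 1)"
          using step.prems snake_point(3)[OF s t(1)] by (intro row_rel_refl) simp
        then show False
          using V IH row_rel_mono[of g "s1 - ?c + 1" "s1 - ?c + 1" "s1 - ?c + 1" "\<tau> (s1, t)"] * by simp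
      qed
      moreover have "\<not> \<tau> (s1 + 1, t) < \<tau> (s1, t)"
        using V row_rel_less by blast
      ultimately show ?case
        using IH by simp
    qed
    then show ?thesis
      using True by (simp add: \<beta> first_tableau_def)
  qed (simp add: first_tableau_def tabs_outside[OF \<tau>])
qed

text \<open>For these letters the boxes of types A and B differ only in the scale
  \<open>dual_lacing\<close> of the exponents.\<close>

lemma letter_box_plain:
  assumes "1 \<le> x" "int x \<le> plain_bound g"
  shows "letter_box g q a (int x) k = Y g q a x (dual_lacing g * (int x - 1) + k) - Y g q a (x - 1) (dual_lacing g * int x + k)"
  using assms by (cases g) (auto simp: letter_box_def Let_def algebra_simps)

text \<open>In each column the negative factor of a box cancels the positive factor of the box above
  it. The product telescopes to the positive factor of the bottom box, which is the required
  variable.\<close>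

lemma first_tableau_monomial:
  assumes s: "is_snake g T i k"
  shows "(\<Sum>\<beta>\<in>skew_diagram g T i k. letter_box g q a (first_tableau g T i k \<beta>) (2 * dual_lacing g * (int (snd \<beta>) - fst \<beta>)))
     = (\<Sum>t = 1..T. Y g q a (i t) (k t))"
proof -
  let ?R = "dual_lacing g" and ?c = "column_top g i k"
  let ?f = "\<lambda>(t, j). (?c t + int j, t)"
  have inj: "inj_on ?f (SIGMA t:{1..T}. {..<i t})"
    by (auto simp: inj_on_def)
  have ft: "first_tableau g T i k (?c t + int j, t) = int (Suc j)" if "t \<in> {1..T}" "j < i t" for t j
    using that by (simp add: first_tableau_def skew_diagram_iff[OF s])
  have "(\<Sum>\<beta>\<in>skew_diagram g T i k. letter_box g q a (first_tableau g T i k \<beta>) (2 * ?R * (int (snd \<beta>) - fst \<beta>)))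
    = (\<Sum>(t, j)\<in>(SIGMA t:{1..T}. {..<i t}). letter_box g q a (first_tableau g T i k (?c t + int j, t)) (2 * ?R * (int t - (?c t + int j))))"
    unfolding skew_diagram_eq[OF s] sum.reindex[OF inj] by (simp add: case_prod_unfold)
  also have "\<dots> = (\<Sum>t\<in>{1..T}. \<Sum>j<i t. letter_box g q a (first_tableau g T i k (?c t + int j, t)) (2 * ?R * (int t - (?c t + int j))))"
    by (simp add: sum.Sigma)
  also have "\<dots> = (\<Sum>t\<in>{1..T}. Y g q a (i t) (k t))"
  proof (intro sum.cong refl)
    fix t assume t: "t \<in> {1..T}"
    note p = snake_point[OF s t]
    let ?Y = "\<lambda>j. Y g q a j (k t + ?R * (int (i t) - int j))"
    have "letter_box g q a (first_tableau g T i k (?c t + int j, t)) (2 * ?R * (int t - (?c t + int j))) = ?Y (Suc j) - ?Y j"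
      if j: "j \<in> {..<i t}" for j
    proof -
      have sp: "2 * ?R * (int t - (?c t + int j)) = k t + ?R * (int (i t) - 1) - 2 * ?R * int j"
        using p(4) by (simp add: algebra_simps)
      have "letter_box g q a (int (Suc j)) (2 * ?R * (int t - (?c t + int j)))
         = Y g q a (Suc j) (?R * (int (Suc j) - 1) + (2 * ?R * (int t - (?c t + int j))))
          - Y g q a (Suc j - 1) (?R * int (Suc j) + (2 * ?R * (int t - (?c t + int j))))"
        by (rule letter_box_plain) (use j p(3) in auto)
      also have "?R * (int (Suc j) - 1) + (2 * ?R * (int t - (?c t + int j))) = k t + ?R * (int (i t) - int (Suc j))"
        unfolding sp by (simp add: algebra_simps)
      also have "?R * int (Suc j) + (2 * ?R * (int t - (?c t + int j))) = k t + ?R * (int (i t) - int j)"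
        unfolding sp by (simp add: algebra_simps)
      finally show ?thesis
        using ft[OF t] j by simp
    qed
    then have "(\<Sum>j<i t. letter_box g q a (first_tableau g T i k (?c t + int j, t)) (2 * ?R * (int t - (?c t + int j))))
      = (\<Sum>j<i t. ?Y (Suc j) - ?Y j)"
      by (rule sum.cong[OF refl])
    also have "\<dots> = ?Y (i t) - ?Y 0"
      by (rule sum_lessThan_telescope)
    also have "\<dots> = Y g q a (i t) (k t)"
      by (simp add: Y_outside nodes_def)
    finally show "(\<Sum>j<i t. letter_box g q a (first_tableau g T i k (?c t + int j, t)) (2 * ?R * (int t - (?c t + int j))))
      = Y g q a (i t) (k t)" .
  qed
  finally show ?thesis .
qed

lemma boxed_tableaux_snake:
  assumes g: "valid_lie_type g" and q: "q \<noteq> 0" "not_root_of_unity q" "a \<noteq> 0" and s: "is_snake g T i k"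
  shows "boxed_tableaux (top_letter g) (row_rel g) (skew_diagram g T i k) g q a (step_node g) (step_shift g)
    (2 * dual_lacing g) (letter_box g q a) (first_tableau g T i k)"
proof -
  interpret skew_tableaux "top_letter g" "row_rel g" "skew_diagram g T i k"
    by (rule skew_tableaux_snake[OF s])
  show ?thesis
    by unfold_locales
      (fact g q first_tableau_in[OF g s] first_tableau_le[OF s] step_node_in[OF g] letter_box_monomial[OF q(1,3)]
        letter_box_step[OF g] step_inj pole_step[OF q g] pole_no_step[OF q g] pole_ord_letter_box_other[OF q(1)])+
qed

section \<open>Translation to tableaux in the given alphabet\<close>

lemma bij_tabs_Tab:
  assumes g: "valid_lie_type g" and s: "skew_tableaux (row_rel g) S"
  shows "bij_betw (\<lambda>\<tau>. restrict (letter_of g \<circ> \<tau>) S) (skew_tableaux.tabs (top_letter g) (row_rel g) S) (Tab g S)"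
proof -
  interpret skew_tableaux "top_letter g" "row_rel g" S
    by (rule s)
  let ?\<phi> = "\<lambda>\<tau>. restrict (letter_of g \<circ> \<tau>) S"
  let ?L = "{1..top_letter g}"
  have bij: "inj_on (letter_of g) ?L" "letter_of g ` ?L = alphabet g"
    using bij_letter_of[OF g] by (auto simp: bij_betw_def)
  have "inj_on ?\<phi> tabs"
  proof
    fix \<sigma> \<tau> assume *: "\<sigma> \<in> tabs" "\<tau> \<in> tabs" "?\<phi> \<sigma> = ?\<phi> \<tau>"
    show "\<sigma> = \<tau>"
    proof
      fix \<beta>
      show "\<sigma> \<beta> = \<tau> \<beta>"
      proof (cases "\<beta> \<in> S")
        case True
        then have "letter_of g (\<sigma> \<beta>) = letter_of g (\<tau> \<beta>)"
          using fun_cong[OF *(3), of \<beta>] by simp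
        then show ?thesis
          using inj_onD[OF bij(1)] tabs_range[OF *(1) True] tabs_range[OF *(2) True] by simp
      qed (use tabs_outside[OF *(1)] tabs_outside[OF *(2)] in simp)
    qed
  qed
  moreover have "?\<phi> \<tau> \<in> Tab g S" if \<tau>: "\<tau> \<in> tabs" for \<tau>
  proof -
    have L: "\<tau> \<beta> \<in> ?L" if "\<beta> \<in> S" for \<beta>
      using tabs_range[OF \<tau> that] by simp
    then have "?\<phi> \<tau> \<in> S \<rightarrow>\<^sub>E alphabet g"
      using bij(2) by auto
    moreover have "row_ok g (?\<phi> \<tau> (s, t)) (?\<phi> \<tau> (s, t + 1))" if "(s, t) \<in> S" "(s, t + 1) \<in> S" for s t
      using row_ok_letter_of[OF L L, OF that] tabs_row[OF \<tau> that] that by simp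
    moreover have "col_ok g (?\<phi> \<tau> (s, t)) (?\<phi> \<tau> (s + 1, t))" if "(s, t) \<in> S" "(s + 1, t) \<in> S" for s t
      using col_ok_letter_of[OF L L, OF that] tabs_col[OF \<tau> that] that by simp
    ultimately show ?thesis
      unfolding Tab_def by blast
  qed
  moreover have "\<exists>\<tau>\<in>tabs. ?\<phi> \<tau> = \<T>" if \<T>: "\<T> \<in> Tab g S" for \<T>
  proof -
    define \<tau> where "\<tau> = (\<lambda>\<beta>. if \<beta> \<in> S then inv_into ?L (letter_of g) (\<T> \<beta>) else 0)"
    have T: "\<T> \<in> S \<rightarrow>\<^sub>E alphabet g"
      "\<And>s t. (s, t) \<in> S \<Longrightarrow> (s, t + 1) \<in> S \<Longrightarrow> row_ok g (\<T> (s, t)) (\<T> (s, t + 1))"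
      "\<And>s t. (s, t) \<in> S \<Longrightarrow> (s + 1, t) \<in> S \<Longrightarrow> col_ok g (\<T> (s, t)) (\<T> (s + 1, t))"
      using \<T> unfolding Tab_def by blast+
    have L: "\<tau> \<beta> \<in> ?L" "letter_of g (\<tau> \<beta>) = \<T> \<beta>" if "\<beta> \<in> S" for \<beta>
    proof -
      have "\<T> \<beta> \<in> letter_of g ` ?L"
        using T(1) that bij(2) by auto
      then show "\<tau> \<beta> \<in> ?L" "letter_of g (\<tau> \<beta>) = \<T> \<beta>"
        using that by (simp_all only: \<tau>_def if_True inv_into_into f_inv_into_f)
    qed
    have "\<tau> \<in> tabs"
      unfolding tabs_def
    proof (intro CollectI conjI ballI allI impI)
      fix s t assume *: "(s, t) \<in> S \<and> (s, t + 1) \<in> S"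
      then show "row_rel g (\<tau> (s, t)) (\<tau> (s, t + 1))"
        using row_ok_letter_of[OF L(1) L(1), of "(s, t)" "(s, t + 1)"] T(2)[of s t] L(2) by simp
    next
      fix s t assume *: "(s, t) \<in> S \<and> (s + 1, t) \<in> S"
      then show "\<not> row_rel g (\<tau> (s + 1, t)) (\<tau> (s, t))"
        using col_ok_letter_of[OF L(1) L(1), of "(s, t)" "(s + 1, t)"] T(3)[of s t] L(2) by simp
    next
      fix \<beta> assume "\<beta> \<in> S"
      then show "1 \<le> \<tau> \<beta>" "\<tau> \<beta> \<le> top_letter g"
        using L(1) by auto
    next
      fix \<beta> assume "\<beta> \<notin> S"
      then show "\<tau> \<beta> = 0"
        by (simp add: \<tau>_def)
    qed
    moreover have "?\<phi> \<tau> = \<T>"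
    proof
      fix \<beta>
      show "?\<phi> \<tau> \<beta> = \<T> \<beta>"
        using L(2) PiE_arb[OF T(1)] by (cases "\<beta> \<in> S") auto
    qed
    ultimately show ?thesis
      by blast
  qed
  ultimately show ?thesis
    unfolding bij_betw_def by blast
qed

theorem corollary7p6:
  fixes g :: lie_type and q a :: complex
    and T :: nat and i :: "nat \<Rightarrow> nat" and k :: "nat \<Rightarrow> int"
    and scale :: "complex \<Rightarrow> 'v::ab_group_add \<Rightarrow> 'v"
    and act :: "dalg \<Rightarrow> 'v \<Rightarrow> 'v"
  assumes "valid_lie_type g"
    and "q \<noteq> 0" and "not_root_of_unity q" and "a \<noteq> 0"
    and "is_snake g T i k"
    and "quantum_affine_module scale g q act"
    and "quantum_affine_module.is_L scale g q act (\<Sum>t = 1..T. Y g q a (i t) (k t))"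
  shows "quantum_affine_module.q_character scale g q act =
    (\<Sum>\<T>\<in>Tab g (skew_diagram g T i k).
       Poly_Mapping.single (tableau_monomial g q a (skew_diagram g T i k) \<T>) 1)"
proof -
  let ?S = "skew_diagram g T i k" and ?K = "2 * dual_lacing g"
  interpret V: quantum_affine_module scale g q act
    by (rule assms(6))
  interpret tab: boxed_tableaux "top_letter g" "row_rel g" ?S g q a "step_node g" "step_shift g" ?K
    "letter_box g q a" "first_tableau g T i k"
    by (rule boxed_tableaux_snake[OF assms(1-5)])
  have mon: "tab.mon \<tau> = (\<Sum>\<beta>\<in>?S. letter_box g q a (\<tau> \<beta>) (?K * (int (snd \<beta>) - fst \<beta>)))" for \<tau>
    by (simp add: tab.mon_def tab.diag_def)
  \<comment> \<open>The first tableau takes the role of \<open>bot\<close>, so its monomial has to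
    be the highest l-weight of the given module.\<close>
  have top: "tab.mon (first_tableau g T i k) = (\<Sum>t = 1..T. Y g q a (i t) (k t))"
    unfolding mon by (rule first_tableau_monomial[OF assms(5)])
  have L: V.type_one V.irreducible_module "V.highest_l_weight (tab.mon (first_tableau g T i k))"
    using assms(7) by (simp_all add: V.is_L_def top)
  then obtain v where v: "v \<noteq> 0" "\<forall>j\<in>nodes g. \<forall>n. act (gx Plus j n) v = 0"
    "\<forall>j\<in>nodes g. \<forall>e r. act (phi q e j r) v = scale (fps_nth (l_weight g q (tab.mon (first_tableau g T i k)) e j) r) v"
    unfolding V.highest_l_weight_def by blast
  interpret thin: thin_lattice g q a tab.tabs "first_tableau g T i k" ?S tab.step_par tab.mon
    by (rule tab.thin)
  interpret thin_module scale g q act a tab.tabs "first_tableau g T i k" ?S tab.step_par tab.mon v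
    by unfold_locales (use L v assms(2) in auto)
  have "V.q_character = (\<Sum>\<tau>\<in>tab.tabs. Poly_Mapping.single (tab.mon \<tau>) 1)"
    by (rule q_character_eq)
  also have "\<dots> = (\<Sum>\<tau>\<in>tab.tabs. Poly_Mapping.single (tableau_monomial g q a ?S (restrict (letter_of g \<circ> \<tau>) ?S)) 1)"
  proof (intro sum.cong refl arg_cong[of _ _ "\<lambda>m. Poly_Mapping.single m 1"])
    fix \<tau>
    show "tab.mon \<tau> = tableau_monomial g q a ?S (restrict (letter_of g \<circ> \<tau>) ?S)"
      unfolding mon tableau_monomial_def by (intro sum.cong) (auto simp: letter_box_def)
  qed
  also have "\<dots> = (\<Sum>\<T>\<in>Tab g ?S. Poly_Mapping.single (tableau_monomial g q a ?S \<T>) 1)"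
    by (rule sum.reindex_bij_betw[OF bij_tabs_Tab[OF assms(1) skew_tableaux_snake[OF assms(5)]]])
  finally show ?thesis .
qed

end
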